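(* Let $\Phi$ be an irreducible root system of rank $\ell$ with Coxeter number $h$, and let $n\ge1$. Then, as quasi-polynomials in $t\in\mathbb{Z}$, $$\chi_{\mathrm{quasi}}(\mathcal{A}_\Phi^{[1,n]},nh-t)=(-1)^\ell\chi_{\mathrm{quasi}}(\mathcal{A}_\Phi^{[1,n]},t).$$
   Context: Let $V=\mathbb{R}^\ell$ with inner product $(\cdot,\cdot)$, $\Phi\subset V$ an irreducible crystallographic root system of rank $\ell$ with positive system $\Phi^+$, simple roots $\alpha_1,\dots,\alpha_\ell$ and Coxeter number $h$. For $\alpha\in\Phi^+$, $k\in\mathbb{Z}$, $H_{\alpha,k}=\{x\mid(\alpha,x)=k\}$; for integers $a\le b$, $\mathcal{A}_\Phi^{[a,b]}=\{H_{\alpha,k}\mid\alpha\in\Phi^+,a\le k\le b\}$. Coweight lattice $Z(\Phi)=\{x\mid(\alpha_i,x)\in\mathbb{Z}\ \forall i\}$. The characteristic quasi-polynomial $\chi_{\mathrm{quasi}}(\mathcal{A}_\Phi^{[a,b]},q)$ is the quasi-polynomial (a function $\mathbb{Z}\to\mathbb{Z}$ that is polynomial on each residue class modulo a period, hence defined for all integers) which equals, for all sufficiently large $q$, the number of $\bar x\in Z(\Phi)/qZ(\Phi)$ with $(\alpha,x)\not\equiv k\pmod q$ for all $\alpha\in\Phi^+$, $a\le k\le b$. *)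

theory Defs
  imports "HOL-Analysis.Analysis" "HOL-Computational_Algebra.Polynomial"
begin

text \<open>The ambient space V is an arbitrary Euclidean space \<open>'a\<close>, of dimension \<open>\<ell> = DIM('a)\<close>.\<close>

definition root_reflection :: "'a::euclidean_space \<Rightarrow> 'a \<Rightarrow> 'a" where
  "root_reflection \<alpha> x = x - (2 * (\<alpha> \<bullet> x) / (\<alpha> \<bullet> \<alpha>)) *\<^sub>R \<alpha>"

text \<open>Reduced crystallographic root systems whose rank is the dimension of the ambient space.\<close>

definition root_system :: "'a::euclidean_space set \<Rightarrow> bool" where
  "root_system \<Phi> \<longleftrightarrow>
     finite \<Phi> \<and> 0 \<notin> \<Phi> \<and> span \<Phi> = UNIV \<and>
     (\<forall>\<alpha>\<in>\<Phi>. \<forall>c::real. c *\<^sub>R \<alpha> \<in> \<Phi> \<longrightarrow> c = 1 \<or> c = -1) \<and>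
     (\<forall>\<alpha>\<in>\<Phi>. root_reflection \<alpha> ` \<Phi> = \<Phi>) \<and>
     (\<forall>\<alpha>\<in>\<Phi>. \<forall>\<beta>\<in>\<Phi>. 2 * (\<alpha> \<bullet> \<beta>) / (\<alpha> \<bullet> \<alpha>) \<in> \<int>)"

definition irreducible_root_system :: "'a::euclidean_space set \<Rightarrow> bool" where
  "irreducible_root_system \<Phi> \<longleftrightarrow>
     root_system \<Phi> \<and> \<Phi> \<noteq> {} \<and>
     \<not> (\<exists>\<Phi>1 \<Phi>2. \<Phi>1 \<noteq> {} \<and> \<Phi>2 \<noteq> {} \<and> \<Phi> = \<Phi>1 \<union> \<Phi>2 \<and> \<Phi>1 \<inter> \<Phi>2 = {} \<and>
          (\<forall>\<alpha>\<in>\<Phi>1. \<forall>\<beta>\<in>\<Phi>2. \<alpha> \<bullet> \<beta> = 0))"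

definition nonneg_combinations :: "'a::euclidean_space set \<Rightarrow> 'a set" where
  "nonneg_combinations \<Delta> = {\<beta>. \<exists>c::'a \<Rightarrow> nat. \<beta> = (\<Sum>\<alpha>\<in>\<Delta>. real (c \<alpha>) *\<^sub>R \<alpha>)}"

definition simple_roots :: "'a::euclidean_space set \<Rightarrow> 'a set \<Rightarrow> bool" where
  "simple_roots \<Phi> \<Delta> \<longleftrightarrow>
     \<Delta> \<subseteq> \<Phi> \<and> independent \<Delta> \<and> span \<Delta> = UNIV \<and>
     (\<forall>\<beta>\<in>\<Phi>. \<beta> \<in> nonneg_combinations \<Delta> \<or> - \<beta> \<in> nonneg_combinations \<Delta>)"

definition positive_roots :: "'a::euclidean_space set \<Rightarrow> 'a set \<Rightarrow> 'a set" where
  "positive_roots \<Phi> \<Delta> = \<Phi> \<inter> nonneg_combinations \<Delta>"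

definition coxeter_element :: "'a::euclidean_space set \<Rightarrow> ('a \<Rightarrow> 'a) \<Rightarrow> bool" where
  "coxeter_element \<Delta> c \<longleftrightarrow>
     (\<exists>xs. distinct xs \<and> set xs = \<Delta> \<and> c = foldr (\<lambda>\<alpha> w. root_reflection \<alpha> \<circ> w) xs id)"

text \<open>The Coxeter number is the order of a Coxeter element. It does not depend on the chosen
  ordering of the simple roots, so a relational definition with an existentially quantified
  Coxeter element is satisfied by exactly one number.\<close>

definition coxeter_number :: "'a::euclidean_space set \<Rightarrow> nat \<Rightarrow> bool" where
  "coxeter_number \<Delta> h \<longleftrightarrow>
     (\<exists>c. coxeter_element \<Delta> c \<and> 0 < h \<and> c ^^ h = id \<and> (\<forall>k. 0 < k \<and> k < h \<longrightarrow> c ^^ k \<noteq> id))"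

definition coweight_lattice :: "'a::euclidean_space set \<Rightarrow> 'a set" where
  "coweight_lattice \<Delta> = {x. \<forall>\<alpha>\<in>\<Delta>. \<alpha> \<bullet> x \<in> \<int>}"

definition coweight_lattice_mod :: "'a::euclidean_space set \<Rightarrow> nat \<Rightarrow> 'a set set" where
  "coweight_lattice_mod \<Delta> q =
     coweight_lattice \<Delta> //
       {(x, y). x \<in> coweight_lattice \<Delta> \<and> y \<in> coweight_lattice \<Delta> \<and>
                (\<exists>z\<in>coweight_lattice \<Delta>. x - y = real q *\<^sub>R z)}"

text \<open>The hyperplane \<open>{x. \<alpha> \<bullet> x = k}\<close> is represented by its defining datum \<open>(\<alpha>, k)\<close>. For positive
  roots of a reduced root system distinct pairs define distinct hyperplanes.\<close>

definition root_arrangement ::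
    "'a::euclidean_space set \<Rightarrow> 'a set \<Rightarrow> int \<Rightarrow> int \<Rightarrow> ('a \<times> int) set" where
  "root_arrangement \<Phi> \<Delta> a b = positive_roots \<Phi> \<Delta> \<times> {a..b}"

text \<open>Since \<open>\<alpha> \<bullet> x\<close> is an integer for every root \<open>\<alpha>\<close> and every \<open>x\<close> in the coweight lattice, the
  condition \<open>\<alpha> \<bullet> x \<noteq> k + m q\<close> for all integers \<open>m\<close> is incongruence modulo \<open>q\<close>. It does not
  depend on the representative \<open>x\<close> of the class \<open>X\<close>.\<close>

definition complement_count ::
    "'a::euclidean_space set \<Rightarrow> ('a \<times> int) set \<Rightarrow> nat \<Rightarrow> nat" where
  "complement_count \<Delta> A q =
     card {X \<in> coweight_lattice_mod \<Delta> q.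
             \<forall>x\<in>X. \<forall>(\<alpha>, k)\<in>A. \<forall>m::int. \<alpha> \<bullet> x \<noteq> of_int (k + m * int q)}"

definition quasi_polynomial :: "(int \<Rightarrow> int) \<Rightarrow> bool" where
  "quasi_polynomial f \<longleftrightarrow>
     (\<exists>\<rho>::nat. 0 < \<rho> \<and> (\<exists>p :: int \<Rightarrow> real poly.
        \<forall>t. of_int (f t) = poly (p (t mod int \<rho>)) (of_int t)))"

text \<open>A quasi-polynomial is determined by its values at all sufficiently large integers, so at most
  one function has the defining property. That one exists is a theorem of Kamiya, Takemura and
  Terao.\<close>

definition char_quasi ::
    "'a::euclidean_space set \<Rightarrow> ('a \<times> int) set \<Rightarrow> int \<Rightarrow> int" where
  "char_quasi \<Delta> A =
     (THE f. quasi_polynomial f \<and>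
             (\<forall>\<^sub>F q in sequentially. f (int q) = int (complement_count \<Delta> A q)))"

end

theory Submission
  imports Defs
begin

text \<open>
  Put \<open>h = 1 + ht(\<theta>)\<close> for the highest root \<open>\<theta>\<close>, let \<open>c\<close> be the marks of the affine simple roots
  (\<open>c = 1\<close> at \<open>-\<theta>\<close>), and let \<open>L(m)\<close> be the number of non-negative integral \<open>y\<close> with \<open>\<Sum> c y = m\<close>,
  the number of coweights in the \<open>m\<close>-fold closed fundamental alcove \<open>A\<close>. A small shift along
  \<open>-\<rho>\<close> moves every coweight off the hyperplanes of level divisible by \<open>q\<close>, hence modulo \<open>q\<close> into
  the interior of some \<open>g\<inverse>(q A)\<close>. There the forbidden residues \<open>1..n\<close> only push some walls inwards
  by \<open>n + 1\<close>, so that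
  \<open>f \<chi>(q) = \<Sum>\<^sub>g L(q - (n + 1) asc g)\<close> with a constant \<open>f > 0\<close>. Here \<open>g\<close> runs over all isometries
  preserving \<open>\<Phi>\<close>, a group containing \<open>-1\<close>, and \<open>asc g\<close> is the sum of the marks of the affine simple
  roots that are positive on \<open>g \<rho>\<close>. Since \<open>asc g + asc (-g) = \<Sum> c = h\<close>, the claim is the Ehrhart
  reciprocity \<open>L(-m - h) = (-1)\<^sup>\<ell> L(m)\<close>.

  That \<open>h\<close> is the order of a Coxeter element follows by counting roots twice. The operator
  \<open>x \<mapsto> \<Sum>\<^sub>\<alpha> (\<alpha>, x) \<alpha>\<^sup>\<or>\<close> is scalar, and comparing its trace with its value at \<open>\<theta>\<close> gives
  \<open>|\<Phi>| = h \<ell>\<close>. Following Steinberg, a bipartite Coxeter element of order \<open>m\<close> acts on a plane spanned by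
  dominant vectors as a rotation by \<open>2\<pi>/m\<close>, and counting the root hyperplanes through the rays of
  this plane gives \<open>|\<Phi>| = m \<ell>\<close>.
\<close>

section \<open>Reflections and based root systems\<close>

text \<open>The shift is by -\<rho>/h because a root has height strictly between -h and h and never
  0: every integral value moves by a nonzero amount below 1. So no coweight crosses a hyperplane,
  but a coweight lying on walls is assigned to one side of each, and this choice is recorded by the
  ascents of g. Conditions on the walls control all roots because every root is a non-negative
  combination of affine simple roots with coefficient 0 or 1 at -\<theta>; if the root is positive
  on g \<rho>, some affine simple root in such a combination is an ascent, and it passes on its
  margin n + 1. The Weyl group need not contain -1, whereas pairing g with -g drives the symmetry;
  hence the full isometry group. The price is a larger stabilizer of the alcove, whose order is the
  constant f. The centre of the symmetry comes from n h - t - (n + 1) (h - asc g) = -(t - (n + 1)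
  asc g) - h. The count produces h only as a sum of marks, while h is defined as an order; joining
  the two takes the whole study of Coxeter elements.\<close>

lemma root_reflection_inner:
  "root_reflection a x \<bullet> y = x \<bullet> y - 2 * (a \<bullet> x) * (a \<bullet> y) / (a \<bullet> a)"
  by (simp add: root_reflection_def inner_diff_left)

lemma linear_root_reflection: "linear (root_reflection a)"
  by (rule linearI) (simp_all add: root_reflection_def inner_right_distrib algebra_simps
      add_divide_distrib)

lemma root_reflection_self [simp]: "root_reflection a a = - a"
  by (cases "a = 0") (simp_all add: root_reflection_def scaleR_2)

lemma root_reflection_isometry [simp]: "root_reflection a x \<bullet> root_reflection a y = x \<bullet> y"
proof (cases "a = 0")
  case False
  then have "a \<bullet> a \<noteq> 0" by simp
  then show ?thesis
    by (simp add: root_reflection_def inner_diff_left inner_diff_right field_simps inner_commute)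
qed (simp add: root_reflection_def)

lemma root_reflection_involution [simp]: "root_reflection a (root_reflection a x) = x"
proof (cases "a = 0")
  case False
  then show ?thesis
    by (simp add: root_reflection_def inner_diff_right algebra_simps flip: scaleR_add_left)
qed (simp add: root_reflection_def)

lemma root_reflection_swap: "root_reflection a x \<bullet> y = x \<bullet> root_reflection a y"
  by (metis root_reflection_isometry root_reflection_involution)

lemma orthogonal_root_reflection: "orthogonal_transformation (root_reflection a)"
  by (simp add: orthogonal_transformation_def linear_root_reflection)

lemma root_reflection_commute:
  assumes "a \<bullet> b = 0"
  shows "root_reflection a (root_reflection b x) = root_reflection b (root_reflection a x)"
  using assms by (simp add: root_reflection_def inner_diff_right inner_commute algebra_simps)

lemma root_reflection_conjugate:
  assumes "orthogonal_transformation g"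
  shows "root_reflection (g a) (g x) = g (root_reflection a x)"
  using assms
  by (simp add: root_reflection_def orthogonal_transformation_def linear_diff linear_cmul)

section \<open>Simple roots, their dual basis and heights\<close>

locale based_root_system =
  fixes \<Phi> \<Delta> :: "'a::euclidean_space set"
  assumes irreducible: "irreducible_root_system \<Phi>"
    and simple: "simple_roots \<Phi> \<Delta>"
begin

abbreviation "\<Phi>\<^sub>p \<equiv> positive_roots \<Phi> \<Delta>"

lemma root_system: "root_system \<Phi>"
  using irreducible by (simp add: irreducible_root_system_def)

lemma finite_roots [simp]: "finite \<Phi>"
  and zero_notin_roots [simp]: "0 \<notin> \<Phi>"
  using root_system by (simp_all add: root_system_def)

lemma reduced: "\<alpha> \<in> \<Phi> \<Longrightarrow> c *\<^sub>R \<alpha> \<in> \<Phi> \<Longrightarrow> c = 1 \<or> c = -1"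
  using root_system by (auto simp: root_system_def)

lemma reflection_image: "\<alpha> \<in> \<Phi> \<Longrightarrow> root_reflection \<alpha> ` \<Phi> = \<Phi>"
  using root_system by (auto simp: root_system_def)

lemma reflection_root [intro]: "\<alpha> \<in> \<Phi> \<Longrightarrow> \<beta> \<in> \<Phi> \<Longrightarrow> root_reflection \<alpha> \<beta> \<in> \<Phi>"
  using reflection_image by blast

lemma crystallographic: "\<alpha> \<in> \<Phi> \<Longrightarrow> \<beta> \<in> \<Phi> \<Longrightarrow> 2 * (\<alpha> \<bullet> \<beta>) / (\<alpha> \<bullet> \<alpha>) \<in> \<int>"
  using root_system by (auto simp: root_system_def)

lemma uminus_root: "\<alpha> \<in> \<Phi> \<Longrightarrow> - \<alpha> \<in> \<Phi>"
  using reflection_root[of \<alpha> \<alpha>] by simp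

lemma uminus_root_iff [simp]: "- \<alpha> \<in> \<Phi> \<longleftrightarrow> \<alpha> \<in> \<Phi>"
  using uminus_root[of \<alpha>] uminus_root[of "- \<alpha>"] by auto

lemma root_nonzero: "\<alpha> \<in> \<Phi> \<Longrightarrow> \<alpha> \<noteq> 0"
  by auto

lemma root_inner_pos: "\<alpha> \<in> \<Phi> \<Longrightarrow> \<alpha> \<bullet> \<alpha> > 0"
  by (metis inner_gt_zero_iff zero_notin_roots)

lemma simple_subset: "\<Delta> \<subseteq> \<Phi>"
  and independent_simple: "independent \<Delta>"
  and span_simple: "span \<Delta> = UNIV"
  using simple by (simp_all add: simple_roots_def)

lemma simple_root [simp, intro]: "\<alpha> \<in> \<Delta> \<Longrightarrow> \<alpha> \<in> \<Phi>"
  using simple_subset by auto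

lemma finite_simple [simp]: "finite \<Delta>"
  using finite_subset[OF simple_subset] by simp

lemma card_simple: "card \<Delta> = DIM('a)"
  by (metis dim_UNIV dim_eq_card independent_simple span_UNIV span_simple)

text \<open>The basis dual to \<Delta>, i.e. the fundamental coweights. As Riesz vectors of the
  coordinate functionals they turn coefficients into inner products, so that linearity is free.
  Outside \<Delta> the value is 0, by the default of \<open>representation\<close>.\<close>

definition fw :: "'a \<Rightarrow> 'a" where
  "fw \<alpha> = (\<Sum>b\<in>Basis. representation \<Delta> b \<alpha> *\<^sub>R b)"

lemma fw_inner: "fw \<alpha> \<bullet> x = representation \<Delta> x \<alpha>"
proof -
  have "representation \<Delta> x \<alpha> = representation \<Delta> (\<Sum>b\<in>Basis. (x \<bullet> b) *\<^sub>R b) \<alpha>"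
    by (simp add: euclidean_representation)
  also have "\<dots> = (\<Sum>b\<in>Basis. (x \<bullet> b) * representation \<Delta> b \<alpha>)"
    using independent_simple span_simple
    by (simp add: representation_sum representation_scale)
  also have "\<dots> = fw \<alpha> \<bullet> x"
    by (simp add: fw_def inner_sum_left inner_sum_right inner_commute mult.commute)
  finally show ?thesis by simp
qed

lemma fw_simple: "\<alpha> \<in> \<Delta> \<Longrightarrow> fw \<beta> \<bullet> \<alpha> = (if \<beta> = \<alpha> then 1 else 0)"
  by (auto simp: fw_inner representation_basis independent_simple)

lemma simple_expansion: "(\<Sum>\<alpha>\<in>\<Delta>. (fw \<alpha> \<bullet> x) *\<^sub>R \<alpha>) = x"
  unfolding fw_inner
  using independent_simple span_simple by (intro sum_representation_eq) auto

lemma inner_expansion: "x \<bullet> y = (\<Sum>\<alpha>\<in>\<Delta>. (fw \<alpha> \<bullet> x) * (\<alpha> \<bullet> y))"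
  by (subst simple_expansion[of x, symmetric]) (simp add: inner_sum_left)

lemma fw_comb: "\<beta> \<in> \<Delta> \<Longrightarrow> fw \<beta> \<bullet> (\<Sum>\<alpha>\<in>\<Delta>. c \<alpha> *\<^sub>R \<alpha>) = c \<beta>"
  by (simp add: inner_sum_right fw_simple if_distrib cong: if_cong)

lemma fw_comb_subset:
  assumes "S \<subseteq> \<Delta>" "\<beta> \<in> \<Delta>"
  shows "fw \<beta> \<bullet> (\<Sum>\<alpha>\<in>S. c \<alpha> *\<^sub>R \<alpha>) = (if \<beta> \<in> S then c \<beta> else 0)"
proof -
  have "finite S" using assms(1) finite_subset finite_simple by blast
  have "fw \<beta> \<bullet> (\<Sum>\<alpha>\<in>S. c \<alpha> *\<^sub>R \<alpha>) = (\<Sum>\<alpha>\<in>S. if \<beta> = \<alpha> then c \<alpha> else 0)"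
    unfolding inner_sum_right
    using assms by (intro sum.cong) (auto simp: fw_simple subset_iff)
  then show ?thesis using \<open>finite S\<close> by simp
qed

lemma eqI_fw: "(\<And>\<alpha>. \<alpha> \<in> \<Delta> \<Longrightarrow> fw \<alpha> \<bullet> x = fw \<alpha> \<bullet> y) \<Longrightarrow> x = y"
  by (metis (mono_tags, lifting) simple_expansion sum.cong)

lemma nonzero_fw: "x \<noteq> 0 \<Longrightarrow> \<exists>\<alpha>\<in>\<Delta>. fw \<alpha> \<bullet> x \<noteq> 0"
  by (rule ccontr) (use eqI_fw[of x 0] in auto)

lemma nonneg_comb_fw:
  assumes "\<beta> \<in> nonneg_combinations \<Delta>" "\<alpha> \<in> \<Delta>"
  shows "fw \<alpha> \<bullet> \<beta> \<in> \<nat>"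
  using assms by (auto simp: nonneg_combinations_def fw_comb)

lemma pos_or_neg: "\<beta> \<in> \<Phi> \<Longrightarrow> \<beta> \<in> \<Phi>\<^sub>p \<or> - \<beta> \<in> \<Phi>\<^sub>p"
  using simple by (auto simp: positive_roots_def simple_roots_def)

lemma pos_root: "\<beta> \<in> \<Phi>\<^sub>p \<Longrightarrow> \<beta> \<in> \<Phi>"
  by (simp add: positive_roots_def)

lemma pos_fw: "\<beta> \<in> \<Phi>\<^sub>p \<Longrightarrow> \<alpha> \<in> \<Delta> \<Longrightarrow> fw \<alpha> \<bullet> \<beta> \<ge> 0"
  using nonneg_comb_fw[of \<beta> \<alpha>] by (auto simp: positive_roots_def elim: Nats_cases)

lemma finite_pos [simp]: "finite \<Phi>\<^sub>p"
  using finite_subset[of "\<Phi>\<^sub>p" \<Phi>] pos_root by auto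

lemma pos_ex: "\<beta> \<in> \<Phi>\<^sub>p \<Longrightarrow> \<exists>\<alpha>\<in>\<Delta>. fw \<alpha> \<bullet> \<beta> > 0"
  using nonzero_fw[of \<beta>] root_nonzero[of \<beta>] pos_fw[of \<beta>] pos_root[of \<beta>] by force

lemma not_pos_and_neg: "\<beta> \<in> \<Phi>\<^sub>p \<Longrightarrow> - \<beta> \<notin> \<Phi>\<^sub>p"
  using pos_ex[of \<beta>] pos_fw[of "- \<beta>"] by fastforce

lemma neg_pos_iff: "\<beta> \<in> \<Phi> \<Longrightarrow> - \<beta> \<in> \<Phi>\<^sub>p \<longleftrightarrow> \<beta> \<notin> \<Phi>\<^sub>p"
  using pos_or_neg not_pos_and_neg by blast

lemma posI: "\<beta> \<in> \<Phi> \<Longrightarrow> \<alpha> \<in> \<Delta> \<Longrightarrow> fw \<alpha> \<bullet> \<beta> > 0 \<Longrightarrow> \<beta> \<in> \<Phi>\<^sub>p"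
  using pos_or_neg[of \<beta>] pos_fw[of "- \<beta>" \<alpha>] by auto

lemma fw_int: "\<beta> \<in> \<Phi> \<Longrightarrow> \<alpha> \<in> \<Delta> \<Longrightarrow> fw \<alpha> \<bullet> \<beta> \<in> \<int>"
  using pos_or_neg[of \<beta>] nonneg_comb_fw[of \<beta> \<alpha>] nonneg_comb_fw[of "- \<beta>" \<alpha>]
  by (auto simp: positive_roots_def Nats_subset_Ints[THEN subsetD] dest!: Nats_subset_Ints[THEN subsetD])

lemma simple_pos [simp]: "\<alpha> \<in> \<Delta> \<Longrightarrow> \<alpha> \<in> \<Phi>\<^sub>p"
  by (rule posI[of _ \<alpha>]) (simp_all add: fw_simple)

lemma fw_reflection:
  assumes "\<alpha> \<in> \<Delta>" "\<beta> \<in> \<Delta>" "\<beta> \<noteq> \<alpha>"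
  shows "fw \<beta> \<bullet> root_reflection \<alpha> x = fw \<beta> \<bullet> x"
  using assms by (simp add: root_reflection_def inner_diff_right fw_simple)

lemma simple_inner_nonpos:
  assumes "\<alpha> \<in> \<Delta>" "\<beta> \<in> \<Delta>" "\<alpha> \<noteq> \<beta>"
  shows "\<alpha> \<bullet> \<beta> \<le> 0"
proof (rule ccontr)
  assume "\<not> ?thesis"
  then have *: "\<alpha> \<bullet> \<beta> > 0" by simp
  let ?r = "root_reflection \<alpha> \<beta>"
  have r: "?r \<in> \<Phi>" using assms by blast
  have "fw \<beta> \<bullet> ?r = 1" using assms by (simp add: fw_reflection fw_simple)
  then have "?r \<in> \<Phi>\<^sub>p" using posI[OF r assms(2)] by simp
  then have "fw \<alpha> \<bullet> ?r \<ge> 0" using pos_fw assms by blast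
  moreover have "fw \<alpha> \<bullet> ?r = - (2 * (\<alpha> \<bullet> \<beta>) / (\<alpha> \<bullet> \<alpha>))"
    using assms by (simp add: root_reflection_def inner_diff_right fw_simple)
  moreover have "2 * (\<alpha> \<bullet> \<beta>) / (\<alpha> \<bullet> \<alpha>) > 0"
    using * root_inner_pos[of \<alpha>] assms by simp
  ultimately show False by linarith
qed

text \<open>A positive root supported on \<alpha> alone is a multiple of \<alpha>, and reducedness
  leaves only \<alpha> itself. The surviving coefficient at another simple root is untouched by the
  reflection in \<alpha>, so it keeps the reflected root positive.\<close>

lemma pos_only_coeff:
  assumes "\<beta> \<in> \<Phi>\<^sub>p" "\<alpha> \<in> \<Delta>" "\<beta> \<noteq> \<alpha>"
  shows "\<exists>\<gamma>\<in>\<Delta>. \<gamma> \<noteq> \<alpha> \<and> fw \<gamma> \<bullet> \<beta> > 0"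
proof (rule ccontr)
  assume "\<not> ?thesis"
  then have z: "fw \<gamma> \<bullet> \<beta> = 0" if "\<gamma> \<in> \<Delta>" "\<gamma> \<noteq> \<alpha>" for \<gamma>
    using that pos_fw[OF assms(1)] by force
  have "\<beta> = (fw \<alpha> \<bullet> \<beta>) *\<^sub>R \<alpha>"
    by (rule eqI_fw) (use z assms in \<open>auto simp: fw_simple\<close>)
  then have "fw \<alpha> \<bullet> \<beta> = 1 \<or> fw \<alpha> \<bullet> \<beta> = -1"
    using reduced[of \<alpha> "fw \<alpha> \<bullet> \<beta>"] assms pos_root[of \<beta>] by auto
  with pos_fw[OF assms(1,2)] have "fw \<alpha> \<bullet> \<beta> = 1" by auto
  with \<open>\<beta> = _\<close> assms show False by simp
qed

lemma simple_reflection_pos: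
  assumes "\<beta> \<in> \<Phi>\<^sub>p" "\<alpha> \<in> \<Delta>" "\<beta> \<noteq> \<alpha>"
  shows "root_reflection \<alpha> \<beta> \<in> \<Phi>\<^sub>p"
proof -
  obtain \<gamma> where "\<gamma> \<in> \<Delta>" "\<gamma> \<noteq> \<alpha>" "fw \<gamma> \<bullet> \<beta> > 0"
    using pos_only_coeff assms by blast
  then show ?thesis
    using assms pos_root by (intro posI[of _ \<gamma>]) (auto simp: fw_reflection)
qed

lemma simple_reflection_pos_image:
  assumes "\<alpha> \<in> \<Delta>"
  shows "root_reflection \<alpha> ` (\<Phi>\<^sub>p - {\<alpha>}) = \<Phi>\<^sub>p - {\<alpha>}"
proof -
  have sub: "root_reflection \<alpha> ` (\<Phi>\<^sub>p - {\<alpha>}) \<subseteq> \<Phi>\<^sub>p - {\<alpha>}"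
  proof (rule image_subsetI)
    fix \<beta> assume "\<beta> \<in> \<Phi>\<^sub>p - {\<alpha>}"
    then have b: "\<beta> \<in> \<Phi>\<^sub>p" "\<beta> \<noteq> \<alpha>" by auto
    have "root_reflection \<alpha> \<beta> \<noteq> \<alpha>"
    proof
      assume "root_reflection \<alpha> \<beta> = \<alpha>"
      then have "\<beta> = - \<alpha>"
        by (metis root_reflection_involution root_reflection_self)
      then show False using b assms not_pos_and_neg[of \<alpha>] by auto
    qed
    then show "root_reflection \<alpha> \<beta> \<in> \<Phi>\<^sub>p - {\<alpha>}"
      using simple_reflection_pos b assms by auto
  qed
  show ?thesis
  proof
    show "\<Phi>\<^sub>p - {\<alpha>} \<subseteq> root_reflection \<alpha> ` (\<Phi>\<^sub>p - {\<alpha>})"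
    proof
      fix x assume "x \<in> \<Phi>\<^sub>p - {\<alpha>}"
      then have "root_reflection \<alpha> x \<in> \<Phi>\<^sub>p - {\<alpha>}" using sub by blast
      then show "x \<in> root_reflection \<alpha> ` (\<Phi>\<^sub>p - {\<alpha>})"
        by (metis image_eqI root_reflection_involution)
    qed
  qed (rule sub)
qed

text \<open>The sum of the fundamental coweights: its inner product with a root is the height of the
  root. By \<open>coroot_sum\<close> it is also half the sum of the positive coroots.\<close>

definition rho :: 'a where
  "rho = (\<Sum>\<alpha>\<in>\<Delta>. fw \<alpha>)"

lemma rho_simple [simp]: "\<alpha> \<in> \<Delta> \<Longrightarrow> rho \<bullet> \<alpha> = 1"
  by (simp add: rho_def inner_sum_left fw_simple)

lemma rho_inner: "rho \<bullet> x = (\<Sum>\<alpha>\<in>\<Delta>. fw \<alpha> \<bullet> x)"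
  by (simp add: rho_def inner_sum_left)

lemma rho_pos:
  assumes "\<beta> \<in> \<Phi>\<^sub>p" shows "rho \<bullet> \<beta> \<ge> 1"
proof -
  obtain \<alpha> where a: "\<alpha> \<in> \<Delta>" "fw \<alpha> \<bullet> \<beta> > 0" using pos_ex assms by blast
  then have "fw \<alpha> \<bullet> \<beta> \<ge> 1"
    using fw_int[of \<beta> \<alpha>] assms pos_root by (auto elim!: Ints_cases)
  moreover have "fw \<alpha> \<bullet> \<beta> \<le> (\<Sum>\<alpha>\<in>\<Delta>. fw \<alpha> \<bullet> \<beta>)"
    using a assms pos_fw by (intro member_le_sum) auto
  ultimately show ?thesis by (simp add: rho_inner)
qed

lemma rho_int: "\<beta> \<in> \<Phi> \<Longrightarrow> rho \<bullet> \<beta> \<in> \<int>"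
  unfolding rho_inner by (intro Ints_sum fw_int)

lemma pos_inner_ex:
  assumes "\<beta> \<in> \<Phi>\<^sub>p"
  shows "\<exists>\<alpha>\<in>\<Delta>. fw \<alpha> \<bullet> \<beta> > 0 \<and> \<alpha> \<bullet> \<beta> > 0"
proof (rule ccontr)
  assume "\<not> ?thesis"
  then have "(fw \<alpha> \<bullet> \<beta>) * (\<alpha> \<bullet> \<beta>) \<le> 0" if "\<alpha> \<in> \<Delta>" for \<alpha>
    using that pos_fw[OF assms that] by (cases "fw \<alpha> \<bullet> \<beta> = 0") (auto simp: not_less intro: mult_nonneg_nonpos)
  then have "\<beta> \<bullet> \<beta> \<le> 0" by (subst inner_expansion) (rule sum_nonpos)
  then show False using root_inner_pos[OF pos_root[OF assms]] by linarith
qed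

text \<open>Some simple root has positive inner product with \<beta>; reflecting in it lowers the
  height, and for a non-simple \<beta> the result is still positive. Heights are positive integers,
  so the descent ends at a simple root.\<close>

lemma pos_induct [consumes 1, case_names simple step]:
  assumes "\<beta> \<in> \<Phi>\<^sub>p"
    and simp: "\<And>\<alpha>. \<alpha> \<in> \<Delta> \<Longrightarrow> P \<alpha>"
    and step: "\<And>\<alpha> \<beta>. \<alpha> \<in> \<Delta> \<Longrightarrow> \<beta> \<in> \<Phi>\<^sub>p \<Longrightarrow> P \<beta> \<Longrightarrow> P (root_reflection \<alpha> \<beta>)"
  shows "P \<beta>"
  using assms(1)
proof (induction "nat \<lfloor>rho \<bullet> \<beta>\<rfloor>" arbitrary: \<beta> rule: less_induct)
  case less
  show ?case
  proof (cases "\<beta> \<in> \<Delta>")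
    case False
    obtain \<alpha> where a: "\<alpha> \<in> \<Delta>" "\<alpha> \<bullet> \<beta> > 0" using pos_inner_ex less.prems by blast
    let ?g = "root_reflection \<alpha> \<beta>"
    have g: "?g \<in> \<Phi>\<^sub>p" using simple_reflection_pos less.prems a False by blast
    have "rho \<bullet> ?g = rho \<bullet> \<beta> - 2 * (\<alpha> \<bullet> \<beta>) / (\<alpha> \<bullet> \<alpha>)"
      using a by (simp add: root_reflection_def inner_diff_right)
    then have lt: "rho \<bullet> ?g < rho \<bullet> \<beta>" using a root_inner_pos[of \<alpha>] by simp
    have "nat \<lfloor>rho \<bullet> ?g\<rfloor> < nat \<lfloor>rho \<bullet> \<beta>\<rfloor>"
      using lt rho_int[of ?g] rho_int[of \<beta>] g less.prems pos_root rho_pos[OF g]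
      by (auto elim!: Ints_cases)
    from step[OF a(1) g less.hyps[OF this g]]
    show ?thesis by simp
  qed (use simp in auto)
qed

text \<open>Connectedness of the Coxeter graph. If K were orthogonal to the other simple roots,
  reflecting would never mix the two spans, so by \<open>pos_induct\<close> every root would lie in
  one of them and \<Phi> would be reducible.\<close>

lemma simple_connected:
  assumes "K \<subseteq> \<Delta>" "K \<noteq> {}" "K \<noteq> \<Delta>"
  shows "\<exists>\<alpha>\<in>K. \<exists>\<beta>\<in>\<Delta> - K. \<alpha> \<bullet> \<beta> \<noteq> 0"
proof (rule ccontr)
  assume "\<not> ?thesis"
  then have orth: "\<alpha> \<bullet> \<beta> = 0" if "\<alpha> \<in> K" "\<beta> \<in> \<Delta> - K" for \<alpha> \<beta> using that by blast
  let ?A = "\<Phi> \<inter> span K" and ?B = "\<Phi> \<inter> span (\<Delta> - K)"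
  have o1: "x \<bullet> y = 0" if "x \<in> span K" "y \<in> span (\<Delta> - K)" for x y
  proof -
    have 1: "\<alpha> \<bullet> y = 0" if "\<alpha> \<in> K" for \<alpha>
      using \<open>y \<in> span _\<close> that
      by (metis orth orthogonal_def orthogonal_to_span)
    then show ?thesis using \<open>x \<in> span K\<close>
      by (metis orthogonal_def orthogonal_to_span inner_commute)
  qed
  have pos: "\<beta> \<in> span K \<or> \<beta> \<in> span (\<Delta> - K)" if "\<beta> \<in> \<Phi>\<^sub>p" for \<beta>
    using that
  proof (induction rule: pos_induct)
    case (simple \<alpha>)
    then show ?case by (cases "\<alpha> \<in> K") (auto simp: span_base)
  next
    case (step \<alpha> \<beta>)
    have sp: "root_reflection \<alpha> \<beta> \<in> span S" if "\<alpha> \<in> span S \<or> \<alpha> \<bullet> \<beta> = 0" "\<beta> \<in> span S" for S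
      using that by (auto simp: root_reflection_def intro: span_diff span_scale)
    have "\<alpha> \<in> span K \<or> \<alpha> \<in> span (\<Delta> - K)"
      using step.hyps by (cases "\<alpha> \<in> K") (auto simp: span_base)
    then show ?case
      using step.IH sp[of K] sp[of "\<Delta> - K"] o1[of \<alpha> \<beta>] o1[of \<beta> \<alpha>] by (auto simp: inner_commute)
  qed
  have "?A \<noteq> {}" "?B \<noteq> {}" using assms by (auto dest: span_base intro: span_base)
  moreover have "\<Phi> = ?A \<union> ?B"
  proof -
    have "\<beta> \<in> ?A \<union> ?B" if "\<beta> \<in> \<Phi>" for \<beta>
      using pos_or_neg[OF that] pos[of \<beta>] pos[of "- \<beta>"] that span_neg[of "- \<beta>"] by auto
    then show ?thesis by auto
  qed
  moreover have "?A \<inter> ?B = {}"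
  proof (rule equals0I)
    fix x assume "x \<in> ?A \<inter> ?B"
    then have "x \<bullet> x = 0" "x \<in> \<Phi>" using o1[of x x] by auto
    then show False using root_inner_pos[of x] by simp
  qed
  moreover have "\<forall>\<alpha>\<in>?A. \<forall>\<beta>\<in>?B. \<alpha> \<bullet> \<beta> = 0" using o1 by auto
  ultimately have "\<exists>\<Phi>1 \<Phi>2. \<Phi>1 \<noteq> {} \<and> \<Phi>2 \<noteq> {} \<and> \<Phi> = \<Phi>1 \<union> \<Phi>2 \<and> \<Phi>1 \<inter> \<Phi>2 = {} \<and>
          (\<forall>\<alpha>\<in>\<Phi>1. \<forall>\<beta>\<in>\<Phi>2. \<alpha> \<bullet> \<beta> = 0)"
    by (intro exI[of _ ?A] exI[of _ ?B] conjI)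
  then show False
    using irreducible unfolding irreducible_root_system_def by (elim conjE notE)
qed

section \<open>The highest root and the number of roots\<close>

text \<open>Both Cartan integers are positive and their product is at most 4. If one of them is 1, a
  reflection yields the difference up to sign; otherwise both are at least 2, Cauchy-Schwarz is an
  equality, and proportional roots of a reduced system with positive inner product coincide.\<close>

lemma root_diff:
  assumes "\<alpha> \<in> \<Phi>" "\<beta> \<in> \<Phi>" "\<alpha> \<bullet> \<beta> > 0" "\<alpha> \<noteq> \<beta>"
  shows "\<alpha> - \<beta> \<in> \<Phi>"
proof -
  define p where "p = 2 * (\<alpha> \<bullet> \<beta>) / (\<alpha> \<bullet> \<alpha>)"
  define q where "q = 2 * (\<alpha> \<bullet> \<beta>) / (\<beta> \<bullet> \<beta>)"
  have aa: "\<alpha> \<bullet> \<alpha> > 0" and bb: "\<beta> \<bullet> \<beta> > 0" using assms root_inner_pos by auto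
  have p: "p \<in> \<int>" "p > 0" and q: "q \<in> \<int>" "q > 0"
    using assms crystallographic[of \<alpha> \<beta>] crystallographic[of \<beta> \<alpha>] aa bb
    by (auto simp: p_def q_def inner_commute)
  consider "p = 1" | "q = 1" | "p \<ge> 2" "q \<ge> 2"
    using p q by (elim Ints_cases) (auto, linarith)
  then show ?thesis
  proof cases
    case 1
    then have "root_reflection \<alpha> \<beta> = - (\<alpha> - \<beta>)"
      unfolding root_reflection_def p_def[symmetric] by simp
    then show ?thesis using reflection_root[OF assms(1,2)] by (metis uminus_root_iff)
  next
    case 2
    then have "root_reflection \<beta> \<alpha> = \<alpha> - \<beta>"
      unfolding root_reflection_def inner_commute[of \<beta> \<alpha>] q_def[symmetric] by simp
    then show ?thesis using reflection_root[OF assms(2,1)] by simp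
  next
    case 3
    \<comment> \<open>The component of \<beta> orthogonal to \<alpha>; its squared norm is the
      defect in the Cauchy-Schwarz inequality.\<close>
    define v where "v = \<beta> - (p / 2) *\<^sub>R \<alpha>"
    have "p * q \<ge> 2 * 2" using 3 by (intro mult_mono) auto
    then have "(\<alpha> \<bullet> \<beta>)\<^sup>2 \<ge> (\<alpha> \<bullet> \<alpha>) * (\<beta> \<bullet> \<beta>)"
      using aa bb by (simp add: p_def q_def field_simps power2_eq_square)
    moreover have "v \<bullet> v = \<beta> \<bullet> \<beta> - (\<alpha> \<bullet> \<beta>)\<^sup>2 / (\<alpha> \<bullet> \<alpha>)"
      using aa by (simp add: v_def p_def inner_diff_left inner_diff_right inner_commute field_simps power2_eq_square)
    ultimately have "(\<alpha> \<bullet> \<alpha>) * (v \<bullet> v) \<le> 0" using aa by (simp add: field_simps)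
    then have "v \<bullet> v \<le> 0" using aa by (simp add: mult_le_0_iff)
    then have "v = 0" by (metis inner_gt_zero_iff not_le)
    then have b: "\<beta> = (p / 2) *\<^sub>R \<alpha>" by (simp add: v_def)
    then have "p / 2 = 1" using reduced[of \<alpha> "p/2"] assms p by auto
    with b assms show ?thesis by simp
  qed
qed

definition maximal_root :: "'a \<Rightarrow> bool" where
  "maximal_root \<theta> \<longleftrightarrow> \<theta> \<in> \<Phi> \<and>
     (\<forall>\<gamma>\<in>\<Phi>. (\<forall>\<alpha>\<in>\<Delta>. fw \<alpha> \<bullet> \<theta> \<le> fw \<alpha> \<bullet> \<gamma>) \<longrightarrow> \<gamma> = \<theta>)"

lemma maximal_rootD:
  "maximal_root \<theta> \<Longrightarrow> \<gamma> \<in> \<Phi> \<Longrightarrow> (\<And>\<alpha>. \<alpha> \<in> \<Delta> \<Longrightarrow> fw \<alpha> \<bullet> \<theta> \<le> fw \<alpha> \<bullet> \<gamma>) \<Longrightarrow> \<gamma> = \<theta>"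
  by (simp add: maximal_root_def)

lemma maximal_root_pos:
  assumes "maximal_root \<theta>" shows "\<theta> \<in> \<Phi>\<^sub>p"
proof (rule ccontr)
  have r: "\<theta> \<in> \<Phi>" using assms by (simp add: maximal_root_def)
  assume "\<theta> \<notin> \<Phi>\<^sub>p"
  then have n: "- \<theta> \<in> \<Phi>\<^sub>p" using neg_pos_iff r by blast
  have "- \<theta> = \<theta>"
    by (rule maximal_rootD[OF assms]) (use r pos_fw[OF n] in force)+
  then have "\<theta> \<bullet> \<theta> = - (\<theta> \<bullet> \<theta>)" by (metis inner_minus_left)
  then show False using root_inner_pos[OF r] by simp
qed

lemma maximal_root_dominant:
  assumes "maximal_root \<theta>" "\<alpha> \<in> \<Delta>" shows "\<alpha> \<bullet> \<theta> \<ge> 0"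
proof (rule ccontr)
  have r: "\<theta> \<in> \<Phi>" using assms by (simp add: maximal_root_def)
  assume "\<not> ?thesis"
  then have neg: "2 * (\<alpha> \<bullet> \<theta>) / (\<alpha> \<bullet> \<alpha>) < 0"
    using root_inner_pos[of \<alpha>] assms by (simp add: divide_neg_pos)
  have f: "fw \<gamma> \<bullet> root_reflection \<alpha> \<theta> = fw \<gamma> \<bullet> \<theta> - (if \<gamma> = \<alpha> then 2 * (\<alpha> \<bullet> \<theta>) / (\<alpha> \<bullet> \<alpha>) else 0)"
    if "\<gamma> \<in> \<Delta>" for \<gamma>
    using that assms by (simp add: root_reflection_def inner_diff_right fw_simple)
  have "root_reflection \<alpha> \<theta> = \<theta>"
    by (rule maximal_rootD[OF assms(1)]) (use r assms neg f in auto)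
  then show False using f[of \<alpha>] assms neg by auto
qed

text \<open>If the support were proper, connectedness would give a simple \<gamma> outside it
  adjacent to a member of it. All contributions to the inner product of \<theta> and \<gamma> would
  then be non-positive, one of them negative, against dominance.\<close>

lemma maximal_root_full_support:
  assumes "maximal_root \<theta>" "\<alpha> \<in> \<Delta>" shows "fw \<alpha> \<bullet> \<theta> > 0"
proof (rule ccontr)
  have pos: "\<theta> \<in> \<Phi>\<^sub>p" using maximal_root_pos assms by blast
  let ?K = "{\<beta>\<in>\<Delta>. fw \<beta> \<bullet> \<theta> > 0}"
  assume "\<not> ?thesis"
  then have "?K \<noteq> \<Delta>" using assms by blast
  moreover have "?K \<noteq> {}" using pos_ex[OF pos] by blast
  ultimately obtain \<beta> \<gamma> where bg: "\<beta> \<in> ?K" "\<gamma> \<in> \<Delta> - ?K" "\<beta> \<bullet> \<gamma> \<noteq> 0"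
    using simple_connected[of ?K] by blast
  have summand: "(fw \<delta> \<bullet> \<theta>) * (\<delta> \<bullet> \<gamma>) \<le> 0" if "\<delta> \<in> \<Delta>" for \<delta>
  proof (cases "\<delta> = \<gamma>")
    case True
    then have "fw \<delta> \<bullet> \<theta> = 0" using bg pos_fw[OF pos, of \<gamma>] by force
    then show ?thesis by simp
  next
    case False
    then show ?thesis
      using that bg pos_fw[OF pos that] simple_inner_nonpos[of \<delta> \<gamma>] by (simp add: mult_nonneg_nonpos)
  qed
  have "(fw \<beta> \<bullet> \<theta>) * (\<beta> \<bullet> \<gamma>) < 0"
    using bg simple_inner_nonpos[of \<beta> \<gamma>] by (force simp: mult_pos_neg)
  then have "\<theta> \<bullet> \<gamma> < 0"
    unfolding inner_expansion[of \<theta> \<gamma>] using bg summand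
    by (subst sum.remove[of _ \<beta>]) (auto intro!: add_neg_nonpos sum_nonpos)
  moreover have "\<gamma> \<bullet> \<theta> \<ge> 0" using maximal_root_dominant assms(1) bg by blast
  ultimately show False by (simp add: inner_commute)
qed

text \<open>Full support of one maximal root and dominance of the other make their inner product
  positive. If they differ, their difference is a root, hence has coefficients of one sign, and one
  of the two is not maximal.\<close>

lemma maximal_root_unique:
  assumes "maximal_root \<theta>" "maximal_root \<eta>" shows "\<theta> = \<eta>"
proof (rule ccontr)
  assume ne: "\<theta> \<noteq> \<eta>"
  have r: "\<theta> \<in> \<Phi>" "\<eta> \<in> \<Phi>" using assms by (auto simp: maximal_root_def)
  obtain \<alpha> where a: "\<alpha> \<in> \<Delta>" "\<alpha> \<bullet> \<eta> > 0"
    using pos_inner_ex[OF maximal_root_pos[OF assms(2)]] by blast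
  have "0 < (\<Sum>\<alpha>\<in>\<Delta>. (fw \<alpha> \<bullet> \<theta>) * (\<alpha> \<bullet> \<eta>))"
    using a assms maximal_root_full_support[OF assms(1)] maximal_root_dominant[OF assms(2)]
    by (intro sum_pos2[of _ \<alpha>]) (auto intro: less_imp_le mult_nonneg_nonneg)
  then have "\<theta> \<bullet> \<eta> > 0" using inner_expansion[of \<theta> \<eta>] by simp
  then have d: "\<theta> - \<eta> \<in> \<Phi>" using root_diff r ne by blast
  from pos_or_neg[OF d] show False
  proof
    assume "\<theta> - \<eta> \<in> \<Phi>\<^sub>p"
    then have "\<theta> = \<eta>"
      using pos_fw[of "\<theta> - \<eta>"]
      by (intro maximal_rootD[OF assms(2) r(1)]) (simp add: inner_diff_right)
    with ne show False by simp
  next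
    assume "- (\<theta> - \<eta>) \<in> \<Phi>\<^sub>p"
    then have "\<eta> = \<theta>"
      using pos_fw[of "\<eta> - \<theta>"]
      by (intro maximal_rootD[OF assms(1) r(2)]) (simp add: inner_diff_right)
    with ne show False by simp
  qed
qed

lemma maximal_root_above:
  assumes "\<beta> \<in> \<Phi>"
  shows "\<exists>\<theta>. maximal_root \<theta> \<and> (\<forall>\<alpha>\<in>\<Delta>. fw \<alpha> \<bullet> \<beta> \<le> fw \<alpha> \<bullet> \<theta>)"
proof -
  let ?S = "{\<gamma>\<in>\<Phi>. \<forall>\<alpha>\<in>\<Delta>. fw \<alpha> \<bullet> \<beta> \<le> fw \<alpha> \<bullet> \<gamma>}"
  have S: "finite ?S" "?S \<noteq> {}" using assms by auto
  have "Max ((\<bullet>) rho ` ?S) \<in> (\<bullet>) rho ` ?S" using S by (intro Max_in) auto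
  then obtain \<theta> where t: "\<theta> \<in> ?S" and mx: "rho \<bullet> \<theta> = Max ((\<bullet>) rho ` ?S)" by auto
  have m: "rho \<bullet> \<gamma> \<le> rho \<bullet> \<theta>" if "\<gamma> \<in> ?S" for \<gamma>
    unfolding mx using that S by (intro Max_ge) auto
  have "maximal_root \<theta>"
    unfolding maximal_root_def
  proof (intro conjI ballI impI)
    fix \<gamma> assume g: "\<gamma> \<in> \<Phi>" "\<forall>\<alpha>\<in>\<Delta>. fw \<alpha> \<bullet> \<theta> \<le> fw \<alpha> \<bullet> \<gamma>"
    then have "\<gamma> \<in> ?S" using t by (auto intro: order_trans)
    then have "(\<Sum>\<alpha>\<in>\<Delta>. fw \<alpha> \<bullet> \<gamma>) \<le> (\<Sum>\<alpha>\<in>\<Delta>. fw \<alpha> \<bullet> \<theta>)" using m by (simp add: rho_inner)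
    moreover have "(\<Sum>\<alpha>\<in>\<Delta>. fw \<alpha> \<bullet> \<theta>) \<le> (\<Sum>\<alpha>\<in>\<Delta>. fw \<alpha> \<bullet> \<gamma>)" using g by (intro sum_mono) auto
    ultimately have "(\<Sum>\<alpha>\<in>\<Delta>. fw \<alpha> \<bullet> \<theta>) = (\<Sum>\<alpha>\<in>\<Delta>. fw \<alpha> \<bullet> \<gamma>)" by simp
    then have "fw \<alpha> \<bullet> \<theta> = fw \<alpha> \<bullet> \<gamma>" if "\<alpha> \<in> \<Delta>" for \<alpha>
      using sum_mono_inv[of "\<lambda>\<alpha>. fw \<alpha> \<bullet> \<theta>" \<Delta> "\<lambda>\<alpha>. fw \<alpha> \<bullet> \<gamma>" \<alpha>] g that by auto
    then show "\<gamma> = \<theta>" by (intro eqI_fw) simp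
  qed (use t in auto)
  then show ?thesis using t by auto
qed

definition theta :: 'a where "theta = (SOME \<theta>. maximal_root \<theta>)"

lemma roots_nonempty: "\<Phi> \<noteq> {}"
  using irreducible by (simp add: irreducible_root_system_def)

lemma maximal_theta: "maximal_root theta"
  unfolding theta_def using maximal_root_above roots_nonempty by (metis someI_ex equals0I)

lemma theta_root [simp]: "theta \<in> \<Phi>"
  using maximal_theta by (simp add: maximal_root_def)

lemma theta_pos [simp]: "theta \<in> \<Phi>\<^sub>p"
  using maximal_theta maximal_root_pos by blast

lemma theta_highest: "\<beta> \<in> \<Phi> \<Longrightarrow> \<alpha> \<in> \<Delta> \<Longrightarrow> fw \<alpha> \<bullet> \<beta> \<le> fw \<alpha> \<bullet> theta"
  using maximal_root_above maximal_root_unique maximal_theta by metis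

lemma theta_fw_pos: "\<alpha> \<in> \<Delta> \<Longrightarrow> fw \<alpha> \<bullet> theta > 0"
  using maximal_root_full_support maximal_theta by blast

lemma theta_dominant: "\<beta> \<in> \<Phi>\<^sub>p \<Longrightarrow> theta \<bullet> \<beta> \<ge> 0"
  unfolding inner_commute[of theta] inner_expansion[of \<beta>]
  using maximal_root_dominant[OF maximal_theta] pos_fw by (intro sum_nonneg) auto

text \<open>If the Cartan integer k were at least 2, the root k \<theta> - \<beta>, which is minus
  the reflection of \<beta>, could have coefficients at most those of \<theta> only if \<beta>
  dominates \<theta>. The two remaining values are what linearizes the quadratic sum in
  \<open>card_roots\<close>.\<close>

lemma theta_string:
  assumes "\<beta> \<in> \<Phi>\<^sub>p" "\<beta> \<noteq> theta"
  shows "theta \<bullet> \<beta> = 0 \<or> 2 * (theta \<bullet> \<beta>) = theta \<bullet> theta"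
proof -
  have tt: "theta \<bullet> theta > 0" using root_inner_pos by simp
  define k where "k = 2 * (theta \<bullet> \<beta>) / (theta \<bullet> theta)"
  have b: "\<beta> \<in> \<Phi>" using assms pos_root by blast
  have k: "k \<in> \<int>" "k \<ge> 0"
    using crystallographic[of theta \<beta>] theta_dominant assms b tt by (auto simp: k_def)
  have "k < 2"
  proof (rule ccontr)
    assume "\<not> ?thesis"
    then have k2: "k \<ge> 2" by simp
    have "- root_reflection theta \<beta> \<in> \<Phi>" using b by auto
    moreover have "- root_reflection theta \<beta> = k *\<^sub>R theta - \<beta>"
      by (simp add: root_reflection_def k_def)
    ultimately have r: "k *\<^sub>R theta - \<beta> \<in> \<Phi>" by simp
    have "\<beta> = theta"
    proof (rule maximal_rootD[OF maximal_theta b])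
      fix \<alpha> assume a: "\<alpha> \<in> \<Delta>"
      have "k * (fw \<alpha> \<bullet> theta) \<ge> 2 * (fw \<alpha> \<bullet> theta)"
        using k2 theta_fw_pos[OF a] by (intro mult_right_mono) auto
      then show "fw \<alpha> \<bullet> theta \<le> fw \<alpha> \<bullet> \<beta>"
        using theta_highest[OF r a] by (simp add: inner_diff_right)
    qed
    with assms show False by simp
  qed
  with k have "k = 0 \<or> k = 1" by (elim Ints_cases) auto
  then show ?thesis using tt by (auto simp: k_def field_simps)
qed

section \<open>Coroots, the Casimir operator and the number of roots\<close>

definition coroot :: "'a \<Rightarrow> 'a" where "coroot \<alpha> = (2 / (\<alpha> \<bullet> \<alpha>)) *\<^sub>R \<alpha>"

text \<open>The reflection in \<alpha> permutes the positive roots other than \<alpha>. The sum of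
  their coroots is therefore fixed by it, i.e. orthogonal to \<alpha>, and only the coroot of
  \<alpha> contributes.\<close>

lemma coroot_sum_simple:
  assumes "\<alpha> \<in> \<Delta>"
  shows "(\<Sum>\<beta>\<in>\<Phi>\<^sub>p. coroot \<beta>) \<bullet> \<alpha> = 2"
proof -
  let ?s = "root_reflection \<alpha>"
  let ?S = "\<Sum>\<beta>\<in>\<Phi>\<^sub>p - {\<alpha>}. coroot \<beta>"
  have inj: "inj_on ?s A" for A by (metis inj_onI root_reflection_involution)
  have "?S = (\<Sum>\<beta>\<in>?s ` (\<Phi>\<^sub>p - {\<alpha>}). coroot \<beta>)"
    using simple_reflection_pos_image[OF assms] by simp
  also have "\<dots> = (\<Sum>\<beta>\<in>\<Phi>\<^sub>p - {\<alpha>}. coroot (?s \<beta>))"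
    by (simp add: sum.reindex[OF inj])
  also have "\<dots> = (\<Sum>\<beta>\<in>\<Phi>\<^sub>p - {\<alpha>}. ?s (coroot \<beta>))"
    by (simp add: coroot_def linear_cmul[OF linear_root_reflection])
  also have "\<dots> = ?s ?S" by (simp add: linear_sum[OF linear_root_reflection])
  finally have "?S \<bullet> \<alpha> = ?s ?S \<bullet> \<alpha>" by simp
  also have "\<dots> = - (?S \<bullet> \<alpha>)" by (simp add: root_reflection_swap)
  finally have "?S \<bullet> \<alpha> = 0" by simp
  moreover have "coroot \<alpha> \<bullet> \<alpha> = 2" using root_inner_pos[of \<alpha>] assms by (simp add: coroot_def)
  ultimately show ?thesis
    using assms by (subst sum.remove[of _ \<alpha>]) (auto simp: inner_add_left)
qed

lemma coroot_sum: "(\<Sum>\<beta>\<in>\<Phi>\<^sub>p. coroot \<beta>) \<bullet> x = 2 * (rho \<bullet> x)"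
proof -
  have "(\<Sum>\<beta>\<in>\<Phi>\<^sub>p. coroot \<beta>) \<bullet> (\<Sum>\<alpha>\<in>\<Delta>. (fw \<alpha> \<bullet> x) *\<^sub>R \<alpha>) = (\<Sum>\<alpha>\<in>\<Delta>. (fw \<alpha> \<bullet> x) * 2)"
    unfolding inner_sum_right[of _ _ \<Delta>] by (simp add: coroot_sum_simple)
  then show ?thesis by (simp add: simple_expansion rho_inner sum_distrib_left mult.commute)
qed

lemma sum_roots_even:
  fixes f :: "'a \<Rightarrow> real"
  assumes "\<And>x. f (- x) = f x"
  shows "sum f \<Phi> = 2 * sum f \<Phi>\<^sub>p"
proof -
  have "\<Phi> = \<Phi>\<^sub>p \<union> uminus ` \<Phi>\<^sub>p"
    using pos_or_neg pos_root by (auto simp: image_iff) (metis minus_minus)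
  moreover have "\<Phi>\<^sub>p \<inter> uminus ` \<Phi>\<^sub>p = {}" using not_pos_and_neg by auto
  ultimately have "sum f \<Phi> = sum f \<Phi>\<^sub>p + sum f (uminus ` \<Phi>\<^sub>p)"
    using sum.union_disjoint[of "\<Phi>\<^sub>p" "uminus ` \<Phi>\<^sub>p" f] by simp
  then show ?thesis by (simp add: sum.reindex assms)
qed

definition casimir :: "'a \<Rightarrow> 'a" where
  "casimir x = (\<Sum>\<alpha>\<in>\<Phi>. (2 * (\<alpha> \<bullet> x) / (\<alpha> \<bullet> \<alpha>)) *\<^sub>R \<alpha>)"

lemma linear_casimir: "linear casimir"
  by (rule linearI)
    (simp_all add: casimir_def inner_right_distrib sum.distrib algebra_simps add_divide_distrib
      scaleR_sum_right)

lemma casimir_inner: "casimir x \<bullet> y = (\<Sum>\<alpha>\<in>\<Phi>. 2 * (\<alpha> \<bullet> x) * (\<alpha> \<bullet> y) / (\<alpha> \<bullet> \<alpha>))"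
  by (simp add: casimir_def inner_sum_left)

lemma casimir_symmetric: "casimir x \<bullet> y = casimir y \<bullet> x"
  by (simp add: casimir_inner mult.commute mult.left_commute)

lemma casimir_reflection:
  assumes "\<beta> \<in> \<Phi>"
  shows "casimir (root_reflection \<beta> x) = root_reflection \<beta> (casimir x)"
proof -
  let ?s = "root_reflection \<beta>"
  have inj: "inj_on ?s A" for A by (metis inj_onI root_reflection_involution)
  have "casimir (?s x) = (\<Sum>\<alpha>\<in>?s ` \<Phi>. (2 * (\<alpha> \<bullet> ?s x) / (\<alpha> \<bullet> \<alpha>)) *\<^sub>R \<alpha>)"
    by (simp add: casimir_def reflection_image[OF assms])
  also have "\<dots> = (\<Sum>\<alpha>\<in>\<Phi>. (2 * (\<alpha> \<bullet> x) / (\<alpha> \<bullet> \<alpha>)) *\<^sub>R ?s \<alpha>)"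
    by (simp add: sum.reindex[OF inj])
  also have "\<dots> = ?s (casimir x)"
    by (simp add: casimir_def linear_sum[OF linear_root_reflection] linear_cmul[OF linear_root_reflection])
  finally show ?thesis .
qed

text \<open>The operator commutes with the reflection in \<beta>, so it preserves its
  (-1)-eigenspace, which is the line through \<beta>.\<close>

lemma casimir_root:
  assumes "\<beta> \<in> \<Phi>"
  shows "casimir \<beta> = ((casimir \<beta> \<bullet> \<beta>) / (\<beta> \<bullet> \<beta>)) *\<^sub>R \<beta>"
proof -
  have "root_reflection \<beta> (casimir \<beta>) = - casimir \<beta>"
    by (simp flip: casimir_reflection[OF assms] linear_neg[OF linear_casimir])
  then have "2 *\<^sub>R casimir \<beta> = (2 * (\<beta> \<bullet> casimir \<beta>) / (\<beta> \<bullet> \<beta>)) *\<^sub>R \<beta>"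
    by (simp add: root_reflection_def scaleR_2 algebra_simps)
  then have "(1/2) *\<^sub>R (2 *\<^sub>R casimir \<beta>) = (1/2) *\<^sub>R ((2 * (\<beta> \<bullet> casimir \<beta>) / (\<beta> \<bullet> \<beta>)) *\<^sub>R \<beta>)"
    by (rule arg_cong)
  then show ?thesis by (simp add: inner_commute)
qed

text \<open>All roots are eigenvectors. By symmetry of the operator, roots with different
  eigenvalues are orthogonal, so two eigenvalues would split \<Phi>.\<close>

lemma casimir_scalar: "\<exists>C. \<forall>x. casimir x = C *\<^sub>R x"
proof -
  define l where "l \<beta> = (casimir \<beta> \<bullet> \<beta>) / (\<beta> \<bullet> \<beta>)" for \<beta>
  let ?A = "{\<beta>\<in>\<Phi>. l \<beta> = l theta}" and ?B = "{\<beta>\<in>\<Phi>. l \<beta> \<noteq> l theta}"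
  have orth: "\<alpha> \<bullet> \<beta> = 0" if "\<alpha> \<in> ?A" "\<beta> \<in> ?B" for \<alpha> \<beta>
  proof -
    have "casimir \<alpha> = l \<alpha> *\<^sub>R \<alpha>" "casimir \<beta> = l \<beta> *\<^sub>R \<beta>"
      using that casimir_root unfolding l_def by blast+
    then have "l \<alpha> * (\<alpha> \<bullet> \<beta>) = l \<beta> * (\<alpha> \<bullet> \<beta>)"
      using casimir_symmetric[of \<alpha> \<beta>] by (simp add: inner_commute)
    then show ?thesis using that by auto
  qed
  have "?B = {}"
  proof (rule ccontr)
    assume "?B \<noteq> {}"
    moreover have "?A \<noteq> {}" using theta_root by blast
    moreover have "\<Phi> = ?A \<union> ?B" "?A \<inter> ?B = {}" by auto
    ultimately have "\<exists>\<Phi>1 \<Phi>2. \<Phi>1 \<noteq> {} \<and> \<Phi>2 \<noteq> {} \<and> \<Phi> = \<Phi>1 \<union> \<Phi>2 \<and> \<Phi>1 \<inter> \<Phi>2 = {} \<and>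
          (\<forall>\<alpha>\<in>\<Phi>1. \<forall>\<beta>\<in>\<Phi>2. \<alpha> \<bullet> \<beta> = 0)"
      using orth by (intro exI[of _ ?A] exI[of _ ?B] conjI) auto
    then show False
      using irreducible unfolding irreducible_root_system_def by (elim conjE notE)
  qed
  then have leq: "l \<alpha> = l theta" if "\<alpha> \<in> \<Phi>" for \<alpha> using that by blast
  have *: "casimir \<alpha> = l theta *\<^sub>R \<alpha>" if "\<alpha> \<in> \<Delta>" for \<alpha>
  proof -
    have "casimir \<alpha> = l \<alpha> *\<^sub>R \<alpha>"
      unfolding l_def by (rule casimir_root[OF simple_root[OF that]])
    then show ?thesis using leq[OF simple_root[OF that]] by simp
  qed
  have "casimir x = l theta *\<^sub>R x" for x
    by (rule linear_eq_on[OF linear_casimir _ _ *])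
       (auto simp: span_simple scaleR_add_right intro!: linearI)
  then show ?thesis by blast
qed

theorem card_roots: "real (card \<Phi>) = (rho \<bullet> theta + 1) * real DIM('a)"
proof -
  obtain C where C: "\<And>x. casimir x = C *\<^sub>R x" using casimir_scalar by blast
  have tt: "theta \<bullet> theta > 0" using root_inner_pos by simp
  have "C * real DIM('a) = (\<Sum>b\<in>Basis. casimir b \<bullet> b)"
    by (simp add: C inner_Basis)
  also have "\<dots> = (\<Sum>b\<in>Basis. \<Sum>\<alpha>\<in>\<Phi>. 2 * (\<alpha> \<bullet> b) * (\<alpha> \<bullet> b) / (\<alpha> \<bullet> \<alpha>))"
    by (simp add: casimir_inner)
  also have "\<dots> = (\<Sum>\<alpha>\<in>\<Phi>. 2 * (\<Sum>b\<in>Basis. (\<alpha> \<bullet> b) * (\<alpha> \<bullet> b)) / (\<alpha> \<bullet> \<alpha>))"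
    by (subst sum.swap) (simp add: sum_distrib_left sum_divide_distrib mult.assoc)
  also have "\<dots> = (\<Sum>\<alpha>\<in>\<Phi>. 2)"
    by (rule sum.cong) (use root_inner_pos in \<open>auto simp flip: euclidean_inner\<close>)
  finally have trace: "C * real DIM('a) = 2 * real (card \<Phi>)" by simp
  \<comment> \<open>By \<open>theta_string\<close> the inner product with \<theta> is 0 or half of
    the squared length of \<theta>, so its square is a fixed multiple of itself. Only \<alpha> =
    \<theta> deviates, by one squared length; this is the 1 in ht(\<theta>) + 1.\<close>
  have summand: "2 * (\<alpha> \<bullet> theta) * (\<alpha> \<bullet> theta) / (\<alpha> \<bullet> \<alpha>) =
      (theta \<bullet> theta) / 2 * (coroot \<alpha> \<bullet> theta) + (if \<alpha> = theta then theta \<bullet> theta else 0)"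
    if "\<alpha> \<in> \<Phi>\<^sub>p" for \<alpha>
  proof (cases "\<alpha> = theta")
    case True
    then show ?thesis using tt by (simp add: coroot_def)
  next
    case False
    then have "\<alpha> \<bullet> theta = 0 \<or> \<alpha> \<bullet> theta = (theta \<bullet> theta) / 2"
      using theta_string[OF that] by (auto simp: inner_commute)
    then show ?thesis using False by (auto simp: coroot_def)
  qed
  have "C * (theta \<bullet> theta) = casimir theta \<bullet> theta" by (simp add: C)
  also have "\<dots> = 2 * (\<Sum>\<alpha>\<in>\<Phi>\<^sub>p. 2 * (\<alpha> \<bullet> theta) * (\<alpha> \<bullet> theta) / (\<alpha> \<bullet> \<alpha>))"
    unfolding casimir_inner by (rule sum_roots_even) simp
  also have "(\<Sum>\<alpha>\<in>\<Phi>\<^sub>p. 2 * (\<alpha> \<bullet> theta) * (\<alpha> \<bullet> theta) / (\<alpha> \<bullet> \<alpha>)) =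
      (theta \<bullet> theta) / 2 * ((\<Sum>\<alpha>\<in>\<Phi>\<^sub>p. coroot \<alpha>) \<bullet> theta) + theta \<bullet> theta"
    by (simp add: summand sum.distrib inner_sum_left sum_distrib_left)
  also have "\<dots> = (theta \<bullet> theta) * (rho \<bullet> theta + 1)"
    unfolding coroot_sum by (simp add: algebra_simps)
  finally have "C = 2 * (rho \<bullet> theta + 1)" using tt by simp
  with trace show ?thesis by (simp add: algebra_simps)
qed

end

section \<open>Coxeter elements\<close>

definition reflection_word :: "'a::euclidean_space list \<Rightarrow> 'a \<Rightarrow> 'a" where
  "reflection_word xs = foldr (\<lambda>\<alpha> w. root_reflection \<alpha> \<circ> w) xs id"

lemma reflection_word_Nil [simp]: "reflection_word [] = id"
  and reflection_word_Cons [simp]: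
    "reflection_word (a # xs) = root_reflection a \<circ> reflection_word xs"
  by (simp_all add: reflection_word_def)

lemma reflection_word_append [simp]:
  "reflection_word (xs @ ys) = reflection_word xs \<circ> reflection_word ys"
  by (induction xs) (simp_all add: o_assoc)

lemma orthogonal_reflection_word: "orthogonal_transformation (reflection_word xs)"
  by (induction xs)
    (simp_all add: id_def o_def orthogonal_root_reflection
      orthogonal_transformation_compose[unfolded o_def])

lemma reflection_word_concat_replicate:
  "reflection_word (concat (replicate k xs)) = reflection_word xs ^^ k"
  by (induction k) simp_all

lemma root_reflection_comp_self: "root_reflection a \<circ> root_reflection a = id"
  by (simp add: fun_eq_iff)

lemma reflection_word_orthogonal_set:
  assumes "distinct xs" "\<And>a b. a \<in> set xs \<Longrightarrow> b \<in> set xs \<Longrightarrow> a \<noteq> b \<Longrightarrow> a \<bullet> b = 0"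
  shows "reflection_word xs x = x - (\<Sum>a\<in>set xs. (2 * (a \<bullet> x) / (a \<bullet> a)) *\<^sub>R a)"
  using assms
proof (induction xs)
  case (Cons c xs)
  have o: "c \<bullet> (\<Sum>a\<in>set xs. (2 * (a \<bullet> x) / (a \<bullet> a)) *\<^sub>R a) = 0"
    unfolding inner_sum_right using Cons.prems by (intro sum.neutral) auto
  have "reflection_word (c # xs) x
      = root_reflection c (x - (\<Sum>a\<in>set xs. (2 * (a \<bullet> x) / (a \<bullet> a)) *\<^sub>R a))"
    using Cons by simp
  then show ?case
    using Cons.prems o by (simp add: root_reflection_def inner_diff_right)
qed simp

text \<open>The two moves on words that respect the conjugacy class of the product: exchanging
  commuting neighbours leaves the product alone, and moving the first letter to the end conjugates
  by that letter.\<close>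

inductive coxeter_equiv :: "'a::euclidean_space list \<Rightarrow> 'a list \<Rightarrow> bool" where
  ceq_refl: "coxeter_equiv xs xs"
| ceq_swap: "a \<bullet> b = 0 \<Longrightarrow> coxeter_equiv (xs @ a # b # ys) (xs @ b # a # ys)"
| ceq_rotate: "coxeter_equiv (a # xs) (xs @ [a])"
| ceq_trans: "coxeter_equiv xs ys \<Longrightarrow> coxeter_equiv ys zs \<Longrightarrow> coxeter_equiv xs zs"

lemma coxeter_equiv_mset: "coxeter_equiv xs ys \<Longrightarrow> mset xs = mset ys"
  by (induction rule: coxeter_equiv.induct) auto

lemma coxeter_equiv_rotate: "coxeter_equiv (xs @ ys) (ys @ xs)"
proof (induction xs arbitrary: ys)
  case (Cons a xs)
  have "coxeter_equiv (a # xs @ ys) (xs @ ys @ [a])"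
    using coxeter_equiv.ceq_rotate[of a "xs @ ys"] by simp
  moreover have "coxeter_equiv (xs @ ys @ [a]) (ys @ a # xs)"
    using Cons[of "ys @ [a]"] by simp
  ultimately show ?case by (auto intro: coxeter_equiv.ceq_trans)
qed (simp add: coxeter_equiv.ceq_refl)

lemma coxeter_equiv_commute:
  "(\<And>z. z \<in> set xs \<Longrightarrow> a \<bullet> z = 0) \<Longrightarrow> coxeter_equiv (p @ xs @ [a]) (p @ a # xs)"
proof (induction xs arbitrary: p)
  case (Cons z xs)
  have "coxeter_equiv (p @ z # xs @ [a]) (p @ z # a # xs)"
    using Cons.IH[of "p @ [z]"] Cons.prems by simp
  moreover have "coxeter_equiv (p @ z # a # xs) (p @ a # z # xs)"
    using Cons.prems[of z] by (intro coxeter_equiv.ceq_swap) (simp add: inner_commute)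
  ultimately show ?case by (auto intro: coxeter_equiv.ceq_trans)
qed (simp add: coxeter_equiv.ceq_refl)

text \<open>Lifts an equivalence past a leaf a of the Coxeter graph with only possible neighbour b.
  The critical move is a rotation of y = b, which does not commute with a: then a commutes with all
  other letters, so it can travel around the far side of the word instead. Distinctness ensures that
  b does not occur a second time.\<close>

lemma coxeter_equiv_Cons:
  assumes "coxeter_equiv xs ys" "distinct xs" "\<And>z. z \<in> set xs \<Longrightarrow> z \<noteq> b \<Longrightarrow> a \<bullet> z = 0"
  shows "coxeter_equiv (a # xs) (a # ys)"
  using assms
proof (induction rule: coxeter_equiv.induct)
  case (ceq_swap c d xs ys)
  then show ?case using coxeter_equiv.ceq_swap[of c d "a # xs" ys] by simp
next
  case (ceq_rotate y xs)
  show ?case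
  proof (cases "a \<bullet> y = 0")
    case True
    have "coxeter_equiv (a # y # xs) (y # a # xs)"
      using coxeter_equiv.ceq_swap[OF True, of "[]"] by simp
    then show ?thesis
      using coxeter_equiv.ceq_rotate[of y "a # xs"] by (auto intro: coxeter_equiv.ceq_trans)
  next
    case False
    then have "y = b" using ceq_rotate by auto
    then have "a \<bullet> z = 0" if "z \<in> set xs" for z using that ceq_rotate by auto
    then have "coxeter_equiv (y # xs @ [a]) (y # a # xs)"
      using coxeter_equiv_commute[of xs a "[y]"] by simp
    moreover have "coxeter_equiv (a # y # xs) (y # xs @ [a])"
      using coxeter_equiv.ceq_rotate[of a "y # xs"] by simp
    moreover have "coxeter_equiv (y # a # xs) (a # xs @ [y])"
      using coxeter_equiv.ceq_rotate[of y "a # xs"] by simp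
    ultimately show ?thesis by (blast intro: coxeter_equiv.ceq_trans)
  qed
next
  case (ceq_trans xs ys zs)
  have "mset xs = mset ys" using ceq_trans.hyps coxeter_equiv_mset by blast
  then have "distinct ys" "set ys = set xs"
    using ceq_trans.prems by (metis mset_eq_imp_distinct_iff, metis mset_eq_setD)
  with ceq_trans show ?case by (metis coxeter_equiv.ceq_trans)
qed (simp add: coxeter_equiv.ceq_refl)

lemma coxeter_equiv_conjugate:
  assumes "coxeter_equiv xs ys"
  shows "\<exists>us. reflection_word ys \<circ> reflection_word us = reflection_word us \<circ> reflection_word xs"
  using assms
proof (induction rule: coxeter_equiv.induct)
  case (ceq_refl xs)
  show ?case by (rule exI[of _ "[]"]) simp
next
  case (ceq_swap a b xs ys)
  then show ?case
    by (intro exI[of _ "[]"]) (simp add: fun_eq_iff root_reflection_commute[OF ceq_swap])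
next
  case (ceq_rotate a xs)
  show ?case by (rule exI[of _ "[a]"]) (simp add: fun_eq_iff)
next
  case (ceq_trans xs ys zs)
  then obtain us vs where
    "reflection_word ys \<circ> reflection_word us = reflection_word us \<circ> reflection_word xs"
    "reflection_word zs \<circ> reflection_word vs = reflection_word vs \<circ> reflection_word ys" by blast
  then show ?case by (intro exI[of _ "vs @ us"]) (simp add: fun_eq_iff)
qed

lemma conjugate_funpow:
  assumes "g \<circ> u = u \<circ> f" shows "(g ^^ k) \<circ> u = u \<circ> (f ^^ k)"
proof (induction k)
  case (Suc k)
  have "(g ^^ Suc k) \<circ> u = g \<circ> ((g ^^ k) \<circ> u)" by (simp add: o_assoc)
  also have "\<dots> = (g \<circ> u) \<circ> (f ^^ k)" by (simp only: Suc o_assoc)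
  also have "\<dots> = u \<circ> (f ^^ Suc k)" by (simp add: assms o_assoc)
  finally show ?case .
qed simp

lemma coxeter_equiv_funpow_id:
  assumes "coxeter_equiv xs ys" "reflection_word xs ^^ k = id"
  shows "reflection_word ys ^^ k = id"
proof -
  obtain us where "reflection_word ys \<circ> reflection_word us = reflection_word us \<circ> reflection_word xs"
    using coxeter_equiv_conjugate assms by blast
  then have "(reflection_word ys ^^ k) \<circ> reflection_word us = reflection_word us"
    using conjugate_funpow[of "reflection_word ys" "reflection_word us" "reflection_word xs" k] assms
    by simp
  moreover have "surj (reflection_word us)"
    using orthogonal_reflection_word orthogonal_transformation_surj by blast
  ultimately show ?thesis by (auto simp: fun_eq_iff) (metis surjD)
qed

section \<open>Exchange condition and the shape of the Coxeter graph\<close>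

context based_root_system
begin

lemma reflection_word_root:
  "set xs \<subseteq> \<Delta> \<Longrightarrow> \<beta> \<in> \<Phi> \<Longrightarrow> reflection_word xs \<beta> \<in> \<Phi>"
  by (induction xs) auto

text \<open>The letters act from the right; at the moment when the image of \<alpha> first becomes
  negative, the image just before must be the simple root of the acting letter, as a simple
  reflection keeps all other positive roots positive.\<close>

lemma reflection_word_neg_split:
  assumes "set ys \<subseteq> \<Delta>" "\<alpha> \<in> \<Phi>\<^sub>p" "reflection_word ys \<alpha> \<notin> \<Phi>\<^sub>p"
  shows "\<exists>us b vs. ys = us @ b # vs \<and> reflection_word vs \<alpha> = b"
  using assms
proof (induction ys)
  case (Cons c ys)
  show ?case
  proof (cases "reflection_word ys \<alpha> \<in> \<Phi>\<^sub>p")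
    case True
    then have "reflection_word ys \<alpha> = c"
      using Cons.prems simple_reflection_pos[of "reflection_word ys \<alpha>" c] by auto
    then show ?thesis by (intro exI[of _ "[]"]) auto
  next
    case False
    then obtain us b vs where "ys = us @ b # vs" "reflection_word vs \<alpha> = b"
      using Cons by auto
    then show ?thesis by (intro exI[of _ "c # us"]) auto
  qed
qed simp

text \<open>A word whose product preserves positivity but is not reduced to the empty word can be
  shortened by two letters, by the exchange condition.\<close>

lemma reflection_word_pos_id:
  assumes "set xs \<subseteq> \<Delta>" "reflection_word xs ` \<Phi>\<^sub>p \<subseteq> \<Phi>\<^sub>p"
  shows "reflection_word xs = id"
  using assms
proof (induction "length xs" arbitrary: xs rule: less_induct)
  case less
  show ?case
  proof (cases xs rule: rev_cases)
    case (snoc ys a)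
    have a: "a \<in> \<Delta>" "set ys \<subseteq> \<Delta>" using less.prems snoc by auto
    have lin: "linear (reflection_word ys)"
      using orthogonal_reflection_word orthogonal_transformation_linear by blast
    have "reflection_word xs a \<in> \<Phi>\<^sub>p" using less.prems a by auto
    then have "- reflection_word ys a \<in> \<Phi>\<^sub>p" using snoc lin by (simp add: linear_neg)
    then have "reflection_word ys a \<notin> \<Phi>\<^sub>p" using not_pos_and_neg by force
    then obtain us b vs where s: "ys = us @ b # vs" "reflection_word vs a = b"
      using reflection_word_neg_split[of ys a] a by auto
    \<comment> \<open>The suffix \<open>vs\<close> maps a to b, hence conjugates the reflection in a
      into that in b; the two letters cancel and leave \<open>us @ vs\<close>.\<close>
    have c: "reflection_word vs (root_reflection a x) = root_reflection b (reflection_word vs x)" for x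
      using root_reflection_conjugate[OF orthogonal_reflection_word, of vs a x] s by simp
    have eq: "reflection_word xs = reflection_word (us @ vs)"
      by (simp add: fun_eq_iff snoc s(1) c)
    moreover have "reflection_word (us @ vs) = id"
    proof (rule less.hyps)
      show "reflection_word (us @ vs) ` \<Phi>\<^sub>p \<subseteq> \<Phi>\<^sub>p" using less.prems(2) unfolding eq .
    qed (use less.prems snoc s in auto)
    ultimately show ?thesis by simp
  qed simp
qed

text \<open>A word that fixes a strictly dominant vector preserves the sign of every root on that
  vector, hence preserves positivity. This turns a statement about one vector into an identity of
  maps.\<close>

lemma reflection_word_fixes_regular:
  assumes "set xs \<subseteq> \<Delta>" "\<And>\<beta>. \<beta> \<in> \<Phi>\<^sub>p \<Longrightarrow> v \<bullet> \<beta> > 0" "reflection_word xs v = v"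
  shows "reflection_word xs = id"
proof (rule reflection_word_pos_id[OF assms(1)], rule image_subsetI, rule ccontr)
  fix \<beta> assume b: "\<beta> \<in> \<Phi>\<^sub>p" "reflection_word xs \<beta> \<notin> \<Phi>\<^sub>p"
  have r: "reflection_word xs \<beta> \<in> \<Phi>" using reflection_word_root assms b pos_root by blast
  have "v \<bullet> reflection_word xs \<beta> = v \<bullet> \<beta>"
    using orthogonal_reflection_word[of xs] assms(3) unfolding orthogonal_transformation_def by metis
  moreover have "v \<bullet> (- reflection_word xs \<beta>) > 0"
    using assms(2) b r neg_pos_iff by blast
  ultimately show False using assms(2)[OF b(1)] by simp
qed

text \<open>Both Cartan integers are at most -1, so their product, four times the squared cosine, is
  at least 1.\<close>

lemma adjacent_inner_le:
  assumes "a \<in> \<Delta>" "b \<in> \<Delta>" "a \<noteq> b" "a \<bullet> b \<noteq> 0"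
  shows "a \<bullet> b / (norm a * norm b) \<le> - 1/2"
proof -
  have ab: "a \<bullet> b < 0" using simple_inner_nonpos assms by force
  have aa: "a \<bullet> a > 0" and bb: "b \<bullet> b > 0" using assms root_inner_pos by auto
  define p where "p = 2 * (a \<bullet> b) / (a \<bullet> a)"
  define q where "q = 2 * (a \<bullet> b) / (b \<bullet> b)"
  have "p \<in> \<int>" "q \<in> \<int>" using assms crystallographic[of a b] crystallographic[of b a]
    by (auto simp: p_def q_def inner_commute)
  moreover have "p < 0" "q < 0" using ab aa bb by (auto simp: p_def q_def divide_neg_pos)
  ultimately have "- p \<ge> 1" "- q \<ge> 1" by (auto elim!: Ints_cases)
  then have "1 * 1 \<le> (- p) * (- q)" by (intro mult_mono) auto
  then have "(a \<bullet> a) * (b \<bullet> b) \<le> (2 * (a \<bullet> b))\<^sup>2"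
    using aa bb by (simp add: p_def q_def field_simps power2_eq_square)
  then have "(norm a * norm b)\<^sup>2 \<le> (- 2 * (a \<bullet> b))\<^sup>2"
    by (simp add: power_mult_distrib dot_square_norm)
  then have "norm a * norm b \<le> - 2 * (a \<bullet> b)"
    by (rule power2_le_imp_le) (use ab in simp)
  moreover have "norm a * norm b > 0" using assms root_nonzero by auto
  ultimately show ?thesis by (simp add: field_simps)
qed

text \<open>The Coxeter graph is a forest: otherwise the sum of the unit vectors along a set of simple
  roots in which everyone has two neighbours would have non-positive norm.\<close>

lemma leaf_exists:
  assumes "S \<subseteq> \<Delta>" "S \<noteq> {}"
  shows "\<exists>a\<in>S. \<exists>b. \<forall>z\<in>S - {a}. z \<noteq> b \<longrightarrow> a \<bullet> z = 0"
proof (rule ccontr)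
  assume neg: "\<not> ?thesis"
  have fin: "finite S" using assms(1) finite_subset finite_simple by blast
  define z where "z = (\<Sum>a\<in>S. (1 / norm a) *\<^sub>R a)"
  have row: "(\<Sum>b\<in>S. (a \<bullet> b) / (norm a * norm b)) \<le> 0" if a: "a \<in> S" for a
  proof -
    let ?f = "\<lambda>b. (a \<bullet> b) / (norm a * norm b)"
    have an: "a \<noteq> 0" using a assms root_nonzero by auto
    \<comment> \<open>The negated claim yields a neighbour of a different from any prescribed b;
      applying it once more with b = x yields a second neighbour. Their two entries of at most -1/2
      cancel the diagonal entry 1.\<close>
    obtain x where x: "x \<in> S - {a}" "a \<bullet> x \<noteq> 0" using neg a by blast
    obtain y where y: "y \<in> S - {a}" "y \<noteq> x" "a \<bullet> y \<noteq> 0" using neg a by blast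
    have le: "?f b \<le> 0" if "b \<in> S - {a}" for b
      using that a assms simple_inner_nonpos[of a b] by (auto intro!: divide_nonpos_nonneg)
    have "sum ?f S = ?f a + (?f x + (?f y + sum ?f (S - {a} - {x} - {y})))"
      using a x y fin by (simp add: sum.remove[of S a] sum.remove[of "S - {a}" x] sum.remove[of "S - {a} - {x}" y])
    moreover have "?f a = 1" using an by (simp add: dot_square_norm power2_eq_square)
    moreover have "?f x \<le> - 1/2" using x a assms by (intro adjacent_inner_le) auto
    moreover have "?f y \<le> - 1/2" using y a assms by (intro adjacent_inner_le) auto
    moreover have "sum ?f (S - {a} - {x} - {y}) \<le> 0" using le by (intro sum_nonpos) auto
    ultimately show ?thesis by linarith
  qed
  have "z \<bullet> z = (\<Sum>a\<in>S. \<Sum>b\<in>S. (a \<bullet> b) / (norm a * norm b))"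
    by (simp add: z_def inner_sum_left inner_sum_right sum_distrib_left inner_commute mult.commute)
  also have "\<dots> \<le> 0" using row by (rule sum_nonpos)
  finally have "z = 0" by (metis inner_gt_zero_iff not_le)
  obtain a where a: "a \<in> S" using assms by blast
  then have "fw a \<bullet> z = 1 / norm a" unfolding z_def using assms by (subst fw_comb_subset) auto
  with \<open>z = 0\<close> show False using a assms root_nonzero by auto
qed

text \<open>All Coxeter elements are conjugate. Both words are rotated to start with the same leaf,
  the rest is equivalent by induction, and the leaf is put back by
  \<open>coxeter_equiv_Cons\<close>.\<close>

lemma coxeter_equiv_all:
  assumes "set xs \<subseteq> \<Delta>" "distinct xs" "distinct ys" "set ys = set xs"
  shows "coxeter_equiv xs ys"
  using assms
proof (induction "length xs" arbitrary: xs ys rule: less_induct)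
  case less
  show ?case
  proof (cases "xs = []")
    case False
    then obtain a b where a: "a \<in> set xs" "\<forall>z\<in>set xs - {a}. z \<noteq> b \<longrightarrow> a \<bullet> z = 0"
      using leaf_exists[of "set xs"] less.prems by auto
    obtain p q where xs: "xs = p @ a # q" using a split_list by metis
    obtain r s where ys: "ys = r @ a # s" using a less.prems split_list by metis
    have st: "set (s @ r) = set (q @ p)" using less.prems unfolding xs ys by auto
    have "coxeter_equiv (q @ p) (s @ r)"
      by (rule less.hyps) (use less.prems xs ys st in auto)
    then have "coxeter_equiv (a # q @ p) (a # s @ r)"
      by (rule coxeter_equiv_Cons[where b = b]) (use less.prems xs a in auto)
    moreover have "coxeter_equiv xs (a # q @ p)"
      using coxeter_equiv_rotate[of p "a # q"] xs by simp
    moreover have "coxeter_equiv (a # s @ r) ys"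
      using coxeter_equiv_rotate[of "a # s" r] ys by simp
    ultimately show ?thesis by (blast intro: coxeter_equiv.ceq_trans)
  qed (use less.prems in \<open>auto intro: coxeter_equiv.ceq_refl\<close>)
qed

text \<open>Two-colouring of a forest: a leaf joins the class that does not contain its only
  neighbour.\<close>

lemma bipartition:
  assumes "S \<subseteq> \<Delta>"
  shows "\<exists>I J. I \<union> J = S \<and> I \<inter> J = {} \<and> pairwise orthogonal I \<and> pairwise orthogonal J"
proof -
  have "finite S" using assms finite_subset finite_simple by blast
  then show ?thesis using assms
  proof (induction S rule: finite_psubset_induct)
    case (psubset S)
    show ?case
    proof (cases "S = {}")
      case False
      then obtain a b where a: "a \<in> S" "\<forall>z\<in>S - {a}. z \<noteq> b \<longrightarrow> a \<bullet> z = 0"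
        using leaf_exists[of S] psubset.prems by blast
      obtain I J where IJ: "I \<union> J = S - {a}" "I \<inter> J = {}" "pairwise orthogonal I" "pairwise orthogonal J"
        using psubset.IH[of "S - {a}"] a psubset.prems by blast
      have *: "pairwise orthogonal (insert a K)" if "pairwise orthogonal K" "b \<notin> K" "K \<subseteq> S - {a}" for K
        using that a by (auto simp: pairwise_insert orthogonal_def inner_commute)
      show ?thesis
      proof (cases "b \<in> I")
        case True
        then have "pairwise orthogonal (insert a J)" using IJ by (intro *) auto
        then show ?thesis using IJ a by (intro exI[of _ I] exI[of _ "insert a J"]) auto
      next
        case False
        then have "pairwise orthogonal (insert a I)" using IJ by (intro *) auto
        then show ?thesis using IJ a by (intro exI[of _ "insert a I"] exI[of _ J]) auto
      qed
    qed auto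
  qed
qed

end

section \<open>The Perron eigenvector\<close>

lemma linear_term_zero:
  fixes B Q :: real
  assumes "\<And>s. 0 \<le> 2 * s * B + s\<^sup>2 * Q" "Q \<ge> 0"
  shows "B = 0"
proof (rule ccontr)
  assume "B \<noteq> 0"
  \<comment> \<open>The minimizer of the quadratic would be -B / Q; the denominator Q + 1 also
    covers Q = 0 and still gives a negative value.\<close>
  have "0 \<le> 2 * (- B / (Q + 1)) * B + (- B / (Q + 1))\<^sup>2 * Q" by (rule assms(1))
  also have "\<dots> = - (B\<^sup>2 * (Q + 2)) / (Q + 1)\<^sup>2"
  proof -
    obtain D where D: "Q = D - 1" "D > 0"
      using assms(2) by (metis add_diff_cancel_right' add_nonneg_pos zero_less_one)
    then show ?thesis unfolding D(1) by (simp add: field_simps power2_eq_square)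
  qed
  also have "\<dots> < 0" using \<open>B \<noteq> 0\<close> assms(2) by (intro divide_neg_pos) auto
  finally show False by simp
qed

context based_root_system
begin

text \<open>Perron--Frobenius for the Gram matrix of the unit simple roots. The eigenvector maximizes
  the sum of squares of coordinates on the unit sphere of V.\<close>

lemma perron:
  obtains \<mu> z where "\<mu> > 0" "\<And>a. a \<in> \<Delta> \<Longrightarrow> fw a \<bullet> z > 0"
    "\<And>a. a \<in> \<Delta> \<Longrightarrow> \<mu> * (a \<bullet> z) = (a \<bullet> a) * (fw a \<bullet> z)"
proof -
  define x where "x a v = norm a * (fw a \<bullet> v)" for a v :: 'a
  define N where "N v = (\<Sum>a\<in>\<Delta>. (x a v)\<^sup>2)" for v
  have expand: "u \<bullet> v = (\<Sum>a\<in>\<Delta>. \<Sum>b\<in>\<Delta>. (x a u * x b v) * ((a \<bullet> b) / (norm a * norm b)))" for u v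
  proof -
    have "u \<bullet> v = (\<Sum>a\<in>\<Delta>. (fw a \<bullet> u) *\<^sub>R a) \<bullet> (\<Sum>b\<in>\<Delta>. (fw b \<bullet> v) *\<^sub>R b)"
      by (simp add: simple_expansion)
    also have "\<dots> = (\<Sum>a\<in>\<Delta>. \<Sum>b\<in>\<Delta>. (fw a \<bullet> u) * (fw b \<bullet> v) * (a \<bullet> b))"
      by (simp add: inner_sum_left inner_sum_right sum_distrib_left mult.assoc)
         (subst sum.swap, simp add: mult.left_commute)
    also have "\<dots> = (\<Sum>a\<in>\<Delta>. \<Sum>b\<in>\<Delta>. (x a u * x b v) * ((a \<bullet> b) / (norm a * norm b)))"
      by (intro sum.cong refl) (use root_nonzero in \<open>auto simp: x_def\<close>)
    finally show ?thesis .
  qed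
  have "\<exists>w\<in>sphere 0 1. \<forall>v\<in>sphere 0 1. N v \<le> N w"
    unfolding N_def x_def
    by (intro continuous_attains_sup continuous_intros) (auto simp: vector_choose_size)
  then obtain w where w: "norm w = 1" and max: "\<And>v. norm v = 1 \<Longrightarrow> N v \<le> N w" by auto
  define \<mu> where "\<mu> = N w"
  have N_scale: "N (c *\<^sub>R v) = c\<^sup>2 * N v" for c v
    by (simp add: N_def x_def sum_distrib_left power_mult_distrib mult.left_commute)
  have N_le: "N v \<le> \<mu> * (v \<bullet> v)" for v
  proof (cases "v = 0")
    case False
    then have "N ((1 / norm v) *\<^sub>R v) \<le> \<mu>" unfolding \<mu>_def by (intro max) simp
    then show ?thesis using False unfolding N_scale
      by (simp add: field_simps power2_eq_square dot_square_norm)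
  qed (simp add: N_def x_def)
  have N_pos: "N v > 0" if nz: "v \<noteq> 0" for v
  proof -
    obtain a where "a \<in> \<Delta>" "fw a \<bullet> v \<noteq> 0" using nonzero_fw[OF nz] by blast
    then show ?thesis unfolding N_def x_def
      using root_nonzero[of a] by (intro sum_pos2[of _ a]) auto
  qed
  have \<mu>: "\<mu> > 0" unfolding \<mu>_def using w by (intro N_pos) auto
  \<comment> \<open>Replacing coordinates by absolute values keeps \<open>N\<close> and, since
    distinct simple roots have non-positive inner product, does not increase the norm. So z
    satisfies the extremal inequality \<open>N_le\<close> with equality.\<close>
  define z where "z = (\<Sum>a\<in>\<Delta>. \<bar>fw a \<bullet> w\<bar> *\<^sub>R a)"
  have fz: "fw a \<bullet> z = \<bar>fw a \<bullet> w\<bar>" if "a \<in> \<Delta>" for a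
    using that by (simp add: z_def fw_comb)
  then have xz: "x a z = \<bar>x a w\<bar>" if "a \<in> \<Delta>" for a
    using that by (simp add: x_def abs_mult)
  have Nz: "N z = \<mu>" by (simp add: N_def \<mu>_def xz)
  have "z \<bullet> z \<le> w \<bullet> w"
    unfolding expand[of z z] expand[of w w]
  proof (intro sum_mono)
    fix a b assume ab: "a \<in> \<Delta>" "b \<in> \<Delta>"
    show "x a z * x b z * (a \<bullet> b / (norm a * norm b)) \<le> x a w * x b w * (a \<bullet> b / (norm a * norm b))"
    proof (cases "a = b")
      case True
      then show ?thesis using ab by (simp add: xz)
    next
      case False
      then have "a \<bullet> b / (norm a * norm b) \<le> 0"
        using ab simple_inner_nonpos by (intro divide_nonpos_nonneg) auto
      moreover have "x a w * x b w \<le> x a z * x b z"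
        using ab by (simp add: xz flip: abs_mult)
      ultimately show ?thesis by (rule mult_right_mono_neg[rotated])
    qed
  qed
  then have "\<mu> * (z \<bullet> z) \<le> \<mu>" using \<mu> w by (simp add: dot_square_norm)
  then have zz: "\<mu> * (z \<bullet> z) = N z" using N_le[of z] Nz by simp
  \<comment> \<open>The form \<open>Q\<close> is non-negative and vanishes at z, so its derivative
    at z vanishes in every direction y.\<close>
  have eig: "\<mu> * (z \<bullet> y) = (\<Sum>a\<in>\<Delta>. x a z * x a y)" for y
  proof -
    define Q where "Q v = \<mu> * (v \<bullet> v) - N v" for v
    have "0 \<le> 2 * s * (\<mu> * (z \<bullet> y) - (\<Sum>a\<in>\<Delta>. x a z * x a y)) + s\<^sup>2 * Q y" for s
    proof -
      have "0 \<le> Q (z + s *\<^sub>R y)" using N_le by (simp add: Q_def)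
      also have "N (z + s *\<^sub>R y) = N z + 2 * s * (\<Sum>a\<in>\<Delta>. x a z * x a y) + s\<^sup>2 * N y"
        by (simp add: N_def x_def inner_add_right algebra_simps power2_eq_square sum.distrib sum_distrib_left)
      then have "Q (z + s *\<^sub>R y) = Q z + 2 * s * (\<mu> * (z \<bullet> y) - (\<Sum>a\<in>\<Delta>. x a z * x a y)) + s\<^sup>2 * Q y"
        by (simp add: Q_def inner_add_left inner_add_right inner_commute[of y z] algebra_simps power2_eq_square)
      finally show ?thesis using zz by (simp add: Q_def)
    qed
    then have "\<mu> * (z \<bullet> y) - (\<Sum>a\<in>\<Delta>. x a z * x a y) = 0"
      by (rule linear_term_zero) (use N_le in \<open>simp add: Q_def\<close>)
    then show ?thesis by simp
  qed
  have eq: "\<mu> * (b \<bullet> z) = (b \<bullet> b) * (fw b \<bullet> z)" if "b \<in> \<Delta>" for b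
  proof -
    have "(\<Sum>a\<in>\<Delta>. x a z * x a b) = (\<Sum>a\<in>\<Delta>. if a = b then (b \<bullet> b) * (fw b \<bullet> z) else 0)"
      using that by (intro sum.cong) (auto simp: x_def fw_simple dot_square_norm power2_eq_square)
    then show ?thesis using eig[of b] that by (simp add: inner_commute)
  qed
  have nonneg: "fw a \<bullet> z \<ge> 0" if "a \<in> \<Delta>" for a using fz that by simp
  let ?K = "{a\<in>\<Delta>. fw a \<bullet> z > 0}"
  have "z \<noteq> 0" using Nz \<mu> by (auto simp: N_def x_def)
  then obtain a where "a \<in> \<Delta>" "fw a \<bullet> z \<noteq> 0" using nonzero_fw by blast
  then have "?K \<noteq> {}" using nonneg by force
  \<comment> \<open>Strict positivity: at a simple root b outside the support but adjacent to it,
    the eigenvalue equation gives inner product 0 with z, while the edge makes it negative.\<close>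
  have "?K = \<Delta>"
  proof (rule ccontr)
    assume "?K \<noteq> \<Delta>"
    then obtain a b where ab: "a \<in> ?K" "b \<in> \<Delta> - ?K" "a \<bullet> b \<noteq> 0"
      using simple_connected[of ?K] \<open>?K \<noteq> {}\<close> by blast
    have b0: "fw b \<bullet> z = 0" using ab nonneg[of b] by auto
    have "(fw a \<bullet> z) * (a \<bullet> b) < 0"
      using ab simple_inner_nonpos[of a b] by (force simp: mult_pos_neg)
    moreover have "(fw c \<bullet> z) * (c \<bullet> b) \<le> 0" if "c \<in> \<Delta>" for c
      using that ab b0 nonneg[OF that] simple_inner_nonpos[of c b]
      by (cases "c = b") (auto simp: mult_nonneg_nonpos)
    ultimately have "z \<bullet> b < 0"
      unfolding inner_expansion[of z b] using ab
      by (subst sum.remove[of _ a]) (auto intro!: add_neg_nonpos sum_nonpos)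
    moreover have "\<mu> * (b \<bullet> z) = 0" using eq[of b] ab b0 by simp
    ultimately show False using \<mu> by (simp add: inner_commute)
  qed
  then have "fw a \<bullet> z > 0" if "a \<in> \<Delta>" for a using that by blast
  then show ?thesis using that \<mu> eq by blast
qed

lemma eqI_simple:
  assumes "\<And>a. a \<in> \<Delta> \<Longrightarrow> a \<bullet> x = a \<bullet> y" shows "x = y"
proof -
  have "(x - y) \<bullet> (x - y) = (\<Sum>a\<in>\<Delta>. (fw a \<bullet> (x - y)) * (a \<bullet> (x - y)))" by (rule inner_expansion)
  also have "\<dots> = 0" using assms by (intro sum.neutral) (auto simp: inner_diff_right)
  finally show ?thesis by simp
qed

text \<open>At a simple root a in its support, such a root has inner product equal to its
  a-coefficient times the squared length of a, so the reflection in a negates that coefficient. As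
  the reflected root must stay positive unless \<beta> = a, the root is simple.\<close>

lemma pos_root_orthogonal_support:
  assumes "\<beta> \<in> \<Phi>\<^sub>p" "J \<subseteq> \<Delta>" "pairwise orthogonal J" "\<And>a. a \<in> \<Delta> - J \<Longrightarrow> fw a \<bullet> \<beta> = 0"
  shows "\<beta> \<in> J"
proof -
  obtain a where a: "a \<in> \<Delta>" "fw a \<bullet> \<beta> > 0" using pos_ex assms by blast
  then have aJ: "a \<in> J" using assms(4)[of a] by fastforce
  have "\<beta> \<bullet> a = (\<Sum>c\<in>\<Delta>. if c = a then (fw a \<bullet> \<beta>) * (a \<bullet> a) else 0)"
    unfolding inner_expansion[of \<beta>]
  proof (rule sum.cong)
    fix c assume "c \<in> \<Delta>"
    then show "fw c \<bullet> \<beta> * (c \<bullet> a) = (if c = a then fw a \<bullet> \<beta> * (a \<bullet> a) else 0)"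
      using assms aJ by (cases "c \<in> J") (auto simp: pairwise_def orthogonal_def)
  qed simp
  then have ip: "a \<bullet> \<beta> = (fw a \<bullet> \<beta>) * (a \<bullet> a)" using a by (simp add: inner_commute)
  have "\<beta> = a"
  proof (rule ccontr)
    assume "\<beta> \<noteq> a"
    then have "fw a \<bullet> root_reflection a \<beta> \<ge> 0"
      using simple_reflection_pos[OF assms(1)] a pos_fw by blast
    moreover have "fw a \<bullet> root_reflection a \<beta> = - (fw a \<bullet> \<beta>)"
      using a root_inner_pos[of a] by (simp add: root_reflection_def inner_diff_right fw_simple ip)
    ultimately show False using a by simp
  qed
  then show ?thesis using aJ by simp
qed

end

text \<open>The point at angle \<open>k\<psi>\<close> on the ellipse through the conjugate directions \<open>a\<close> (at 0) and
  \<open>b\<close> (at \<open>\<psi>\<close>).\<close>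

definition ray :: "real \<Rightarrow> 'a::real_vector \<Rightarrow> 'a \<Rightarrow> nat \<Rightarrow> 'a" where
  "ray \<psi> a b k = (sin (real k * \<psi>) / sin \<psi>) *\<^sub>R b - (sin ((real k - 1) * \<psi>) / sin \<psi>) *\<^sub>R a"

lemma sin_shift: "sin ((x + 1) * p) = 2 * cos p * sin (x * p) - sin ((x - 1) * p)" for x p :: real
proof -
  have "sin ((x + 1) * p) = sin (x * p + p)" "sin ((x - 1) * p) = sin (x * p - p)"
    by (simp_all add: algebra_simps)
  then show ?thesis by (simp add: sin_add sin_diff)
qed

lemma ray_step: "ray \<psi> a b (Suc (Suc k)) = (2 * cos \<psi>) *\<^sub>R ray \<psi> a b (Suc k) - ray \<psi> a b k"
proof -
  have 1: "sin (real (Suc (Suc k)) * \<psi>) = 2 * cos \<psi> * sin (real (Suc k) * \<psi>) - sin (real k * \<psi>)"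
    using sin_shift[of "real (Suc k)" \<psi>] by (simp add: add.commute)
  have 2: "sin ((real (Suc (Suc k)) - 1) * \<psi>) = 2 * cos \<psi> * sin ((real (Suc k) - 1) * \<psi>) - sin ((real k - 1) * \<psi>)"
    using sin_shift[of "real k" \<psi>] by (simp add: add.commute)
  show ?thesis unfolding ray_def 1 2
    by (simp add: algebra_simps diff_divide_distrib)
qed

lemma ray_0: "sin \<psi> \<noteq> 0 \<Longrightarrow> ray \<psi> a b 0 = a"
  and ray_1: "sin \<psi> \<noteq> 0 \<Longrightarrow> ray \<psi> a b (Suc 0) = b"
  by (simp_all add: ray_def)

text \<open>The points satisfy a two-term recurrence that does not mention the index, so they may be
  restarted from any consecutive pair.\<close>

lemma ray_add:
  assumes "sin \<psi> \<noteq> 0"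
  shows "ray \<psi> a b (k + j) = ray \<psi> (ray \<psi> a b k) (ray \<psi> a b (Suc k)) j"
proof (induction j rule: induct_nat_012)
  case (ge2 n)
  then show ?case by (simp add: ray_step)
qed (simp_all add: ray_0 ray_1 assms)

section \<open>Root hyperplanes in the Coxeter plane\<close>

context based_root_system
begin

text \<open>No root hyperplane enters the open cone spanned by \<open>u\<close> and \<open>v\<close> or contains both vectors.\<close>

definition unseparated :: "'a \<Rightarrow> 'a \<Rightarrow> bool" where
  "unseparated u v \<longleftrightarrow> (\<forall>\<beta>\<in>\<Phi>. 0 \<le> (\<beta> \<bullet> u) * (\<beta> \<bullet> v) \<and> (\<beta> \<bullet> u \<noteq> 0 \<or> \<beta> \<bullet> v \<noteq> 0))"

lemma unseparated_commute: "unseparated u v \<Longrightarrow> unseparated v u"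
  by (auto simp: unseparated_def mult.commute)

lemma unseparated_transform:
  assumes "orthogonal_transformation g" "g ` \<Phi> = \<Phi>" "unseparated u v"
  shows "unseparated (g u) (g v)"
  unfolding unseparated_def
proof
  fix \<beta> assume "\<beta> \<in> \<Phi>"
  then obtain \<gamma> where g: "\<gamma> \<in> \<Phi>" "\<beta> = g \<gamma>" using assms(2) by blast
  have "\<beta> \<bullet> g x = \<gamma> \<bullet> x" for x
    using assms(1) g by (simp add: orthogonal_transformation_def)
  then show "0 \<le> (\<beta> \<bullet> g u) * (\<beta> \<bullet> g v) \<and> (\<beta> \<bullet> g u \<noteq> 0 \<or> \<beta> \<bullet> g v \<noteq> 0)"
    using assms(3) g by (simp add: unseparated_def)
qed

lemma reflection_word_image:
  assumes "set xs \<subseteq> \<Delta>" shows "reflection_word xs ` \<Phi> = \<Phi>"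
proof (rule endo_inj_surj)
  show "inj_on (reflection_word xs) \<Phi>"
    using orthogonal_transformation_inj[OF orthogonal_reflection_word] by (rule inj_on_subset) simp
qed (use reflection_word_root assms in auto)

text \<open>On the plane of the unit vectors a and b, p and q are reflections in the lines through b
  and a, so c advances the rays \<open>r k\<close>, at angles k \<psi>, by two steps. Root
  hyperplanes meet the plane only in these lines. Hence \<psi> = \<pi>/m, and each root vanishes on
  exactly one of m consecutive rays, which gives the count. The roots \<alpha> and \<beta> witness
  that the lines through b and a really are cut out by roots.\<close>

lemma dihedral_order:
  fixes p q :: "'a \<Rightarrow> 'a" and a b :: 'a
  defines "c \<equiv> p \<circ> q"
  assumes p: "orthogonal_transformation p" "p ` \<Phi> = \<Phi>" "p b = b" "p a = (2 * (a \<bullet> b)) *\<^sub>R b - a"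
    and q: "orthogonal_transformation q" "q ` \<Phi> = \<Phi>" "q a = a" "q b = (2 * (a \<bullet> b)) *\<^sub>R a - b"
    and norm: "\<bar>a \<bullet> b\<bar> < 1"
    and unsep: "unseparated a b"
    and walls: "\<alpha> \<in> \<Phi>" "\<alpha> \<bullet> b = 0" "\<beta> \<in> \<Phi>" "\<beta> \<bullet> a = 0"
  obtains m where "m > 0" "(c ^^ m) a = a" "(c ^^ m) b = b"
    "\<And>k. 0 < k \<Longrightarrow> k < m \<Longrightarrow> c ^^ k \<noteq> id"
    "2 * card \<Phi> = m * (card {\<beta>\<in>\<Phi>. \<beta> \<bullet> a = 0} + card {\<beta>\<in>\<Phi>. \<beta> \<bullet> b = 0})"
proof -
  define \<psi> where "\<psi> = arccos (a \<bullet> b)"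
  have psi: "0 < \<psi>" "\<psi> < pi" "cos \<psi> = a \<bullet> b"
    using norm arccos_lt_bounded[of "a \<bullet> b"] by (auto simp: \<psi>_def)
  have sin_pos: "sin \<psi> > 0" using psi by (simp add: sin_gt_zero)
  define r where "r = ray \<psi> a b"
  have r0: "r 0 = a" and r1: "r (Suc 0) = b" using sin_pos by (simp_all add: r_def ray_0 ray_1)
  have step: "r (Suc (Suc k)) = (2 * (a \<bullet> b)) *\<^sub>R r (Suc k) - r k" for k
    by (simp add: r_def ray_step psi)
  have lin: "linear c" and oc: "orthogonal_transformation c"
    using p(1) q(1) by (simp_all add: c_def orthogonal_transformation_compose orthogonal_transformation_linear)
  have cim: "c ` \<Phi> = \<Phi>" unfolding c_def image_comp[symmetric] by (simp add: p q)
  have lp: "linear p" using p(1) by (rule orthogonal_transformation_linear)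
  have c_r: "c (r k) = r (Suc (Suc k))" for k
  proof (induction k rule: induct_nat_012)
    case 0
    show ?case by (simp add: step r0 r1 c_def q p)
  next
    case 1
    show ?case by (simp add: step r0 r1 c_def q p linear_diff[OF lp] linear_cmul[OF lp])
  next
    case (ge2 n)
    then show ?case by (simp add: step[of n] step[of "Suc (Suc n)"] linear_diff[OF lin] linear_cmul[OF lin])
  qed
  have c_pow_r: "(c ^^ j) (r k) = r (2 * j + k)" for j k
    by (induction j) (simp_all add: c_r)
  have unsep_r: "unseparated (r k) (r (Suc k))" for k
  proof (induction k rule: induct_nat_012)
    case 0
    show ?case using unsep by (simp add: r0 r1)
  next
    case 1
    have "unseparated (p b) (p a)"
      by (rule unseparated_transform[OF p(1,2) unseparated_commute[OF unsep]])
    then show ?case by (simp add: step r0 r1 p)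
  next
    case (ge2 n)
    then show ?case using unseparated_transform[OF oc cim ge2(1)] by (simp add: c_r)
  qed
  have f_ray: "\<gamma> \<bullet> r k = (sin (real k * \<psi>) / sin \<psi>) * (\<gamma> \<bullet> b) - (sin ((real k - 1) * \<psi>) / sin \<psi>) * (\<gamma> \<bullet> a)"
    for \<gamma> k by (simp add: r_def ray_def inner_diff_right)
  define m where "m = nat \<lfloor>pi / \<psi>\<rfloor>"
  have "pi / \<psi> > 1" using psi by simp
  then have mr: "real m = \<lfloor>pi / \<psi>\<rfloor>" and m1: "m \<ge> 1" unfolding m_def by linarith+
  have "real m \<le> pi / \<psi>" "pi / \<psi> < real m + 1" unfolding mr by linarith+
  then have m_le: "real m * \<psi> \<le> pi" and m_gt: "pi < (real m + 1) * \<psi>"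
    using psi by (simp_all add: field_simps)
  \<comment> \<open>The root \<alpha> vanishes at angle \<psi>, hence at \<psi> + \<pi>. If m \<psi>
    < \<pi> < (m + 1) \<psi>, this angle lies strictly between those of the rays m + 1 and m + 2,
    which no root hyperplane separates.\<close>
  have m_pi: "real m * \<psi> = pi"
  proof (rule ccontr)
    assume "\<not> ?thesis"
    then have lt: "real m * \<psi> < pi" using m_le by simp
    have s1: "sin (real m * \<psi>) > 0" using lt psi m1 by (intro sin_gt_zero) auto
    have s2: "sin ((real m + 1) * \<psi>) < 0"
      using m_gt lt psi by (intro sin_lt_zero) (auto simp: algebra_simps)
    have ab: "\<alpha> \<bullet> a \<noteq> 0" using unsep walls by (auto simp: unseparated_def)
    have e: "\<alpha> \<bullet> r (Suc m) = - sin (real m * \<psi>) / sin \<psi> * (\<alpha> \<bullet> a)"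
      "\<alpha> \<bullet> r (Suc (Suc m)) = - sin ((real m + 1) * \<psi>) / sin \<psi> * (\<alpha> \<bullet> a)"
      by (simp_all add: f_ray walls add.commute)
    have "(\<alpha> \<bullet> r (Suc m)) * (\<alpha> \<bullet> r (Suc (Suc m)))
        = (sin (real m * \<psi>) * sin ((real m + 1) * \<psi>)) * ((\<alpha> \<bullet> a) / sin \<psi>)\<^sup>2"
      unfolding e by (simp add: power2_eq_square)
    also have "\<dots> < 0" by (rule mult_neg_pos[OF mult_pos_neg[OF s1 s2]]) (use ab sin_pos in simp)
    finally show False using unsep_r[of "Suc m"] walls(1) by (auto simp: unseparated_def)
  qed
  have r_m: "r m = - a" "r (Suc m) = - b"
  proof -
    have "(real m - 1) * \<psi> = pi - \<psi>" "real (Suc m) * \<psi> = pi + \<psi>" "(real (Suc m) - 1) * \<psi> = pi"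
      using m_pi by (simp_all add: algebra_simps)
    then show "r m = - a" "r (Suc m) = - b"
      using sin_pos unfolding r_def ray_def m_pi by (simp_all add: sin_diff sin_add)
  qed
  have r_add_m: "r (m + k) = - r k" for k
  proof -
    have "r (m + k) = ray \<psi> (- a) (- b) k" unfolding r_def
      using r_m sin_pos ray_add[of \<psi> a b m k] by (simp add: r_def)
    then show ?thesis by (simp add: r_def ray_def)
  qed
  have pos_sin: "sin (real j * \<psi>) > 0" if "0 < j" "j < m" for j
  proof (rule sin_gt_zero)
    have "real j * \<psi> < real m * \<psi>" using that psi by simp
    then show "real j * \<psi> < pi" using m_pi by simp
  qed (use that psi in simp)
  \<comment> \<open>A zero exists because the signs at ray 0 and at ray m, its negative, are
    opposite and consecutive rays are never separated. Two zeros at angular distance below \<pi>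
    would make \<gamma> vanish on the whole plane, contrary to \<open>unsep_r\<close>.\<close>
  have unique_zero: "card {k\<in>{..<m}. \<gamma> \<bullet> r k = 0} = 1" if g: "\<gamma> \<in> \<Phi>" for \<gamma>
  proof -
    have "\<exists>k<m. \<gamma> \<bullet> r k = 0"
    proof (rule ccontr)
      assume "\<not> ?thesis"
      then have nz: "\<gamma> \<bullet> r k \<noteq> 0" if "k < m" for k using that by blast
      have same: "k < m \<Longrightarrow> (\<gamma> \<bullet> r k) * (\<gamma> \<bullet> a) > 0" for k
      proof (induction k)
        case 0
        then show ?case using nz[of 0] by (simp add: r0 zero_less_mult_iff) linarith
      next
        case (Suc k)
        have "0 \<le> (\<gamma> \<bullet> r k) * (\<gamma> \<bullet> r (Suc k))" using unsep_r g by (auto simp: unseparated_def)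
        then show ?case using Suc nz[of "Suc k"] by (auto simp: zero_less_mult_iff zero_le_mult_iff)
      qed
      obtain j where j: "m = Suc j" using m1 by (cases m) auto
      have "r (Suc j) = - a" using r_m(1) j by simp
      moreover have "0 \<le> (\<gamma> \<bullet> r j) * (\<gamma> \<bullet> r (Suc j))"
        using unsep_r[of j] g by (auto simp: unseparated_def)
      ultimately show False using same[of j] j by simp
    qed
    then obtain k where k: "k < m" "\<gamma> \<bullet> r k = 0" by blast
    have later: "\<gamma> \<bullet> r (i + j) \<noteq> 0" if "\<gamma> \<bullet> r i = 0" "0 < j" "j < m" for i j
    proof -
      have "\<gamma> \<bullet> r (Suc i) \<noteq> 0" using unsep_r[of i] g that by (auto simp: unseparated_def)
      moreover have "\<gamma> \<bullet> r (i + j) = (sin (real j * \<psi>) / sin \<psi>) * (\<gamma> \<bullet> r (Suc i))"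
        using sin_pos that unfolding r_def by (subst ray_add) (simp_all add: ray_def[of _ _ _ j] inner_diff_right)
      ultimately show ?thesis using pos_sin[OF that(2,3)] sin_pos by simp
    qed
    have "{k\<in>{..<m}. \<gamma> \<bullet> r k = 0} = {k}"
    proof -
      have "i = k" if "i < m" "\<gamma> \<bullet> r i = 0" for i
      proof (rule ccontr)
        assume "i \<noteq> k"
        then consider "i < k" | "k < i" by linarith
        then show False
          using later[of i "k - i"] later[of k "i - k"] that k
            less_imp_diff_less[of k m i] less_imp_diff_less[of i m k] by cases auto
      qed
      then show ?thesis using k by blast
    qed
    then show ?thesis by simp
  qed
  define Z where "Z k = {\<gamma>\<in>\<Phi>. \<gamma> \<bullet> r k = 0}" for k
  have cardZ2: "card (Z (Suc (Suc k))) = card (Z k)" for k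
  proof -
    have "c \<gamma> \<bullet> r (Suc (Suc k)) = \<gamma> \<bullet> r k" for \<gamma>
      using oc unfolding c_r[symmetric] by (simp add: orthogonal_transformation_def)
    then have "Z (Suc (Suc k)) = c ` Z k" using cim by (fastforce simp: Z_def)
    then show ?thesis
      using orthogonal_transformation_inj[OF oc] by (simp add: card_image inj_on_subset)
  qed
  have cardZ: "card (Z k) = (if even k then card (Z 0) else card (Z 1))" for k
    by (induction k rule: induct_nat_012) (auto simp: cardZ2)
  have cardZm: "card (Z (m + k)) = card (Z k)" for k
    by (simp add: Z_def r_add_m)
  have "card \<Phi> = (\<Sum>\<gamma>\<in>\<Phi>. card {k\<in>{..<m}. \<gamma> \<bullet> r k = 0})"
    by (simp add: unique_zero[simplified])
  also have "\<dots> = (\<Sum>\<gamma>\<in>\<Phi>. \<Sum>k<m. if \<gamma> \<bullet> r k = 0 then 1 else 0)"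
    by (simp add: sum.If_cases Int_def)
  also have "\<dots> = (\<Sum>k<m. card (Z k))"
    by (subst sum.swap) (simp add: sum.If_cases Int_def Z_def)
  finally have c1: "card \<Phi> = (\<Sum>k<m. card (Z k))" .
  have split: "(\<Sum>k<i + j. card (Z k)) = (\<Sum>k<i. card (Z k)) + (\<Sum>k<j. card (Z (i + k)))" for i j
    by (induction j) simp_all
  \<comment> \<open>The count depends on the parity of the ray, since c moves by two. Summing over 2
    m rays gives each parity m times, whatever the parity of m.\<close>
  have "2 * card \<Phi> = (\<Sum>k<m. card (Z k)) + (\<Sum>k<m. card (Z (m + k)))"
    by (simp add: c1 cardZm)
  also have "\<dots> = (\<Sum>k<2*m. card (Z k))"
    by (simp add: mult_2 split)
  also have "\<dots> = m * (card (Z 0) + card (Z 1))"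
  proof (induction m)
    case (Suc m)
    have "card (Z (2 * m)) = card (Z 0)" "card (Z (Suc (2 * m))) = card (Z 1)"
      using cardZ[of "2 * m"] cardZ[of "Suc (2 * m)"] by simp_all
    with Suc show ?case by simp
  qed simp
  finally have count: "2 * card \<Phi> = m * (card {\<beta>\<in>\<Phi>. \<beta> \<bullet> a = 0} + card {\<beta>\<in>\<Phi>. \<beta> \<bullet> b = 0})"
    by (simp add: Z_def r0 r1)
  have period: "r (2 * m + k) = r k" for k
    using r_add_m[of "m + k"] r_add_m[of k] by (simp add: mult_2 add.assoc)
  have fixed: "(c ^^ m) a = a" "(c ^^ m) b = b"
    using c_pow_r[of m 0] c_pow_r[of m "Suc 0"] period[of 0] period[of "Suc 0"] by (simp_all add: r0 r1)
  \<comment> \<open>If c^k were the identity, ray 2 k would be ray 0, so 2 k \<psi> would be a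
    multiple of 2 \<pi>; but 0 < k \<psi> < \<pi>. Evaluation on the two walls isolates the two
    coordinates in the plane.\<close>
  have minimal: "c ^^ k \<noteq> id" if k: "0 < k" "k < m" for k
  proof
    assume "c ^^ k = id"
    then have e: "r (2 * k) = a" using c_pow_r[of k 0] by (simp add: r0)
    let ?x = "2 * (real k * \<psi>)"
    have ab: "\<alpha> \<bullet> a \<noteq> 0" "\<beta> \<bullet> b \<noteq> 0" using unsep walls by (auto simp: unseparated_def)
    have "sin ?x = 0"
      using f_ray[of \<beta> "2 * k"] ab walls sin_pos unfolding e by (simp add: mult.assoc)
    moreover have "(real (2 * k) - 1) * \<psi> = ?x - \<psi>" by (simp add: algebra_simps)
    then have "\<alpha> \<bullet> a = - (sin (?x - \<psi>) / sin \<psi>) * (\<alpha> \<bullet> a)"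
      using f_ray[of \<alpha> "2 * k"] walls unfolding e by simp
    then have "1 * (\<alpha> \<bullet> a) = - (sin (?x - \<psi>) / sin \<psi>) * (\<alpha> \<bullet> a)" by simp
    then have "1 = - (sin (?x - \<psi>) / sin \<psi>)" using ab(1) by (metis mult_cancel_right)
    then have "sin (?x - \<psi>) = - sin \<psi>" using sin_pos by (simp add: field_simps)
    ultimately have "cos ?x = 1" using sin_pos by (simp add: sin_diff)
    then have "sin (real k * \<psi>) = 0" unfolding cos_double_sin by simp
    with pos_sin[OF k] show False by simp
  qed
  show ?thesis using that[of m] m1 fixed minimal count by simp
qed


text \<open>For the Perron vector z the eigenvalue equation says that \<mu> z is the sum of these
  vectors over the two colour classes. The part for K is dominant and orthogonal to the simple roots
  of the other class; the two parts span the Coxeter plane.\<close>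

definition dominant_part :: "'a \<Rightarrow> 'a set \<Rightarrow> 'a" where
  "dominant_part z K = (\<Sum>c\<in>K. ((c \<bullet> c) * (fw c \<bullet> z)) *\<^sub>R fw c)"

lemma dominant_part_inner:
  assumes "K \<subseteq> \<Delta>" "d \<in> \<Delta>"
  shows "d \<bullet> dominant_part z K = (if d \<in> K then (d \<bullet> d) * (fw d \<bullet> z) else 0)"
proof -
  have "finite K" using assms finite_subset finite_simple by blast
  have "d \<bullet> dominant_part z K = (\<Sum>c\<in>K. if c = d then (d \<bullet> d) * (fw d \<bullet> z) else 0)"
    unfolding dominant_part_def inner_sum_right
    using assms by (intro sum.cong) (auto simp: fw_simple inner_commute[of d "fw c" for c])
  then show ?thesis using \<open>finite K\<close> by simp
qed

lemma dominant_part_nonneg: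
  assumes "K \<subseteq> \<Delta>" "\<And>c. c \<in> \<Delta> \<Longrightarrow> fw c \<bullet> z > 0" "\<beta> \<in> \<Phi>\<^sub>p"
  shows "\<beta> \<bullet> dominant_part z K \<ge> 0"
  unfolding inner_expansion[of \<beta>]
  using assms pos_fw by (intro sum_nonneg) (auto simp: dominant_part_inner less_imp_le)

lemma dominant_part_zero:
  assumes "K \<subseteq> \<Delta>" "\<And>c. c \<in> \<Delta> \<Longrightarrow> fw c \<bullet> z > 0" "\<beta> \<in> \<Phi>\<^sub>p" "\<beta> \<bullet> dominant_part z K = 0" "c \<in> K"
  shows "fw c \<bullet> \<beta> = 0"
proof -
  have "(\<Sum>c\<in>\<Delta>. (fw c \<bullet> \<beta>) * (c \<bullet> dominant_part z K)) = 0"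
    using assms(4) inner_expansion[of \<beta>] by simp
  moreover have "0 \<le> (fw c \<bullet> \<beta>) * (c \<bullet> dominant_part z K)" if "c \<in> \<Delta>" for c
    using that assms pos_fw by (auto simp: dominant_part_inner less_imp_le)
  ultimately have "\<forall>c\<in>\<Delta>. (fw c \<bullet> \<beta>) * (c \<bullet> dominant_part z K) = 0"
    by (subst (asm) sum_nonneg_eq_0_iff) simp_all
  then have "(fw c \<bullet> \<beta>) * (c \<bullet> dominant_part z K) = 0" using assms(1,5) by blast
  moreover have "c \<bullet> dominant_part z K > 0"
    using assms root_inner_pos[of c] by (auto simp: dominant_part_inner subset_iff)
  ultimately show ?thesis by simp
qed

context
  fixes \<mu> :: real and z :: 'a and K L :: "'a set"
  assumes mu: "\<mu> > 0"
    and zpos: "\<And>a. a \<in> \<Delta> \<Longrightarrow> fw a \<bullet> z > 0"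
    and eig: "\<And>a. a \<in> \<Delta> \<Longrightarrow> \<mu> * (a \<bullet> z) = (a \<bullet> a) * (fw a \<bullet> z)"
    and KL: "K \<union> L = \<Delta>" "K \<inter> L = {}" "pairwise orthogonal K" "pairwise orthogonal L"
begin

text \<open>The commuting reflections in K together subtract twice the orthogonal projection to the
  span of K. For the part belonging to K this projection is the K-component of z, and the eigenvalue
  equation puts that component into the plane of the two parts.\<close>

lemma coxeter_plane_reflection:
  assumes ks: "distinct ks" "set ks = K"
  shows "reflection_word ks (dominant_part z K) = - dominant_part z K - (2 * (1 / \<mu> - 1)) *\<^sub>R dominant_part z L"
    and "reflection_word ks (dominant_part z L) = dominant_part z L"
proof -
  have sub: "K \<subseteq> \<Delta>" "L \<subseteq> \<Delta>" using KL by auto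
  then have fin: "finite K" "finite L" using finite_subset finite_simple by blast+
  define zK where "zK S = (\<Sum>c\<in>S. (fw c \<bullet> z) *\<^sub>R c)" for S
  have z: "zK K + zK L = z"
    using simple_expansion[of z] KL sum.union_disjoint[OF fin KL(2), of "\<lambda>c. (fw c \<bullet> z) *\<^sub>R c"]
    by (simp add: zK_def)
  have self: "d \<bullet> zK S = (d \<bullet> d) * (fw d \<bullet> z)"
    if S: "pairwise orthogonal S" "finite S" "d \<in> S" for S d
  proof -
    have "d \<bullet> zK S = (\<Sum>c\<in>S. if c = d then (d \<bullet> d) * (fw d \<bullet> z) else 0)"
      unfolding zK_def inner_sum_right
      using S by (intro sum.cong) (auto simp: pairwise_def orthogonal_def)
    then show ?thesis using S by simp
  qed
  \<comment> \<open>Compared on simple roots: on K only the diagonal term survives; on L the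
    component is z minus its L-component, and the eigenvalue equation turns the difference into the
    factor 1/\<mu> - 1.\<close>
  have zK: "zK K = dominant_part z K + (1 / \<mu> - 1) *\<^sub>R dominant_part z L"
  proof (rule eqI_simple)
    fix d assume d: "d \<in> \<Delta>"
    show "d \<bullet> zK K = d \<bullet> (dominant_part z K + (1 / \<mu> - 1) *\<^sub>R dominant_part z L)"
    proof (cases "d \<in> K")
      case True
      then have "d \<notin> L" using KL by auto
      then show ?thesis using True d sub self[of K d] KL fin
        by (simp add: inner_add_right dominant_part_inner)
    next
      case False
      then have dL: "d \<in> L" using KL d by auto
      have "d \<bullet> zK K = d \<bullet> z - d \<bullet> zK L" using arg_cong[OF z, of "(\<bullet>) d"] by (simp add: inner_add_right)
      also have "\<dots> = (1 / \<mu> - 1) * ((d \<bullet> d) * (fw d \<bullet> z))"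
        using self[of L d] KL fin dL eig[OF d] mu by (simp add: field_simps)
      finally show ?thesis using False d sub dL
        by (simp add: inner_add_right dominant_part_inner)
    qed
  qed
  have w: "reflection_word ks x = x - (\<Sum>c\<in>K. (2 * (c \<bullet> x) / (c \<bullet> c)) *\<^sub>R c)" for x
    using reflection_word_orthogonal_set[of ks x] ks KL
    by (auto simp: pairwise_def orthogonal_def)
  have "(\<Sum>c\<in>K. (2 * (c \<bullet> dominant_part z K) / (c \<bullet> c)) *\<^sub>R c) = 2 *\<^sub>R zK K"
    unfolding zK_def scaleR_sum_right
    using sub root_nonzero by (intro sum.cong) (auto simp: dominant_part_inner subset_iff)
  then have "reflection_word ks (dominant_part z K) = dominant_part z K - 2 *\<^sub>R zK K"
    by (simp add: w)
  also have "\<dots> = - dominant_part z K - (2 * (1 / \<mu> - 1)) *\<^sub>R dominant_part z L"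
    unfolding zK by (simp add: scaleR_add_right scaleR_2)
  finally show "reflection_word ks (dominant_part z K) = - dominant_part z K - (2 * (1 / \<mu> - 1)) *\<^sub>R dominant_part z L" .
  have "(\<Sum>c\<in>K. (2 * (c \<bullet> dominant_part z L) / (c \<bullet> c)) *\<^sub>R c) = 0"
  proof (rule sum.neutral, rule ballI)
    fix c assume "c \<in> K"
    then have "c \<in> \<Delta>" "c \<notin> L" using KL by auto
    then show "(2 * (c \<bullet> dominant_part z L) / (c \<bullet> c)) *\<^sub>R c = 0" using sub by (simp add: dominant_part_inner)
  qed
  then show "reflection_word ks (dominant_part z L) = dominant_part z L" by (simp add: w)
qed

text \<open>A positive root orthogonal to a vector that is positive on K and zero on L has support
  in L, and since L is orthogonal it belongs to L. The factor 2 counts signs.\<close>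

lemma card_roots_orthogonal_dominant_part:
  "card {\<beta>\<in>\<Phi>. \<beta> \<bullet> dominant_part z K = 0} = 2 * card L"
proof -
  have sub: "K \<subseteq> \<Delta>" "L \<subseteq> \<Delta>" using KL by auto
  have pos: "\<beta> \<in> L" if "\<beta> \<in> \<Phi>\<^sub>p" "\<beta> \<bullet> dominant_part z K = 0" for \<beta>
    using dominant_part_zero[OF sub(1) zpos that] KL
    by (intro pos_root_orthogonal_support[OF that(1) sub(2)]) auto
  have orth: "\<beta> \<bullet> dominant_part z K = 0" if "\<beta> \<in> L" for \<beta>
    using that sub KL(2) by (subst dominant_part_inner) auto
  have "{\<beta>\<in>\<Phi>. \<beta> \<bullet> dominant_part z K = 0} = L \<union> uminus ` L"
  proof (intro equalityI subsetI)
    fix \<beta> assume b: "\<beta> \<in> {\<beta>\<in>\<Phi>. \<beta> \<bullet> dominant_part z K = 0}"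
    then consider "\<beta> \<in> \<Phi>\<^sub>p" | "- \<beta> \<in> \<Phi>\<^sub>p" using pos_or_neg by blast
    then show "\<beta> \<in> L \<union> uminus ` L"
    proof cases
      case 1
      then show ?thesis using pos b by auto
    next
      case 2
      then have "- \<beta> \<in> L" using pos[of "- \<beta>"] b by auto
      then show ?thesis by (metis UnI2 image_eqI minus_minus)
    qed
  next
    fix \<beta> assume "\<beta> \<in> L \<union> uminus ` L"
    then show "\<beta> \<in> {\<beta>\<in>\<Phi>. \<beta> \<bullet> dominant_part z K = 0}"
      using orth sub by auto
  qed
  moreover have "L \<inter> uminus ` L = {}"
  proof (rule equals0I)
    fix x assume "x \<in> L \<inter> uminus ` L"
    then have "x \<in> \<Phi>\<^sub>p" "- x \<in> \<Phi>\<^sub>p" using sub by auto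
    then show False using not_pos_and_neg by blast
  qed
  moreover have "finite L" using sub finite_subset finite_simple by blast
  ultimately show ?thesis by (simp add: card_Un_disjoint card_image)
qed

end

text \<open>Computed for the bipartite word, all letters of one colour before those of the other,
  and transferred to any word by \<open>coxeter_equiv_all\<close>.\<close>

lemma coxeter_word_order:
  assumes xs: "distinct xs" "set xs = \<Delta>"
  obtains m where "m > 0" "card \<Phi> = m * DIM('a)" "reflection_word xs ^^ m = id"
    "\<And>k. 0 < k \<Longrightarrow> k < m \<Longrightarrow> reflection_word xs ^^ k \<noteq> id"
proof -
  obtain I J where IJ: "I \<union> J = \<Delta>" "I \<inter> J = {}" "pairwise orthogonal I" "pairwise orthogonal J"
    using bipartition[of \<Delta>] by blast
  have ne: "\<Delta> \<noteq> {}" using card_simple by auto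
  show ?thesis
  \<comment> \<open>In rank one a colour class is empty and there is no plane; the order 2 is
    checked by hand.\<close>
  proof (cases "\<exists>a. \<Delta> = {a}")
    case True
    then obtain a where a: "\<Delta> = {a}" by blast
    have "a \<noteq> 0" using a root_nonzero by auto
    then have an: "a \<noteq> - a" by (simp add: eq_neg_iff_add_eq_0 flip: scaleR_2)
    have p: "\<beta> = a" if "\<beta> \<in> \<Phi>\<^sub>p" for \<beta> using pos_only_coeff[OF that, of a] a by auto
    have "\<Phi> = {a, - a}"
    proof
      show "\<Phi> \<subseteq> {a, - a}"
        using p pos_or_neg by (metis insertI1 insert_subset minus_minus singletonI subsetI insert_iff)
    qed (use a in auto)
    then have c: "card \<Phi> = 2" using an by simp
    have "xs = [a]" using xs a by (metis distinct_card empty_set card.empty is_singletonI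
          is_singleton_altdef length_0_conv length_Suc_conv list.simps(15) One_nat_def singleton_insert_inj_eq')
    then have w: "reflection_word xs = root_reflection a" by simp
    show ?thesis
    proof (rule that[of 2])
      show "reflection_word xs ^^ 2 = id"
        by (simp add: w numeral_2_eq_2 root_reflection_comp_self)
      fix k :: nat assume "0 < k" "k < 2"
      then have "k = 1" by simp
      moreover have "root_reflection a \<noteq> id" using an by (metis id_apply root_reflection_self)
      ultimately show "reflection_word xs ^^ k \<noteq> id" unfolding w by simp
    qed (use c card_simple a in auto)
  next
    case False
    have nonempty: "L \<noteq> {}" if KL: "K \<union> L = \<Delta>" "pairwise orthogonal K" for K L
    proof
      assume "L = {}"
      then have K: "K = \<Delta>" using KL by simp
      obtain a where a: "a \<in> \<Delta>" using ne by blast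
      have "{a} \<noteq> \<Delta>" using False by metis
      then obtain b where b: "b \<in> \<Delta> - {a}" "a \<bullet> b \<noteq> 0"
        using simple_connected[of "{a}"] a by blast
      then have "orthogonal a b" using KL(2) a unfolding K by (metis DiffE insertI1 pairwise_def)
      then show False using b by (simp add: orthogonal_def)
    qed
    obtain \<alpha> where al: "\<alpha> \<in> I" using nonempty[of J I] IJ by auto
    obtain \<beta> where be: "\<beta> \<in> J" using nonempty[of I J] IJ by auto
    have sub: "I \<subseteq> \<Delta>" "J \<subseteq> \<Delta>" using IJ by auto
    then have fin: "finite I" "finite J" using finite_subset finite_simple by blast+
    obtain us where us: "distinct us" "set us = I" using finite_distinct_list fin by metis
    obtain vs where vs: "distinct vs" "set vs = J" using finite_distinct_list fin by metis
    obtain \<mu> z where mu: "\<mu> > 0" and zpos: "\<And>a. a \<in> \<Delta> \<Longrightarrow> fw a \<bullet> z > 0"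
      and eig: "\<And>a. a \<in> \<Delta> \<Longrightarrow> \<mu> * (a \<bullet> z) = (a \<bullet> a) * (fw a \<bullet> z)"
      using perron by blast
    have JI: "J \<union> I = \<Delta>" "J \<inter> I = {}" using IJ by auto
    note plane_I = coxeter_plane_reflection[OF mu zpos eig IJ us]
    note plane_J = coxeter_plane_reflection[OF mu zpos eig JI IJ(4,3) vs]
    define A where "A = dominant_part z I"
    define B where "B = dominant_part z J"
    have alA: "\<alpha> \<bullet> A > 0" "\<alpha> \<bullet> B = 0"
      using al sub IJ zpos[of \<alpha>] root_inner_pos[of \<alpha>] by (auto simp: A_def B_def dominant_part_inner subset_iff)
    have beB: "\<beta> \<bullet> B > 0" "\<beta> \<bullet> A = 0"
      using be sub IJ zpos[of \<beta>] root_inner_pos[of \<beta>] by (auto simp: A_def B_def dominant_part_inner subset_iff)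
    have AB0: "A \<noteq> 0" "B \<noteq> 0" using alA beB by auto
    define a where "a = (1 / norm A) *\<^sub>R A"
    define b where "b = (1 / norm B) *\<^sub>R B"
    have unit: "a \<bullet> a = 1" "b \<bullet> b = 1"
      using AB0 by (simp_all add: a_def b_def dot_square_norm power2_eq_square)
    have ala: "\<alpha> \<bullet> a > 0" "\<alpha> \<bullet> b = 0" "\<beta> \<bullet> b > 0" "\<beta> \<bullet> a = 0"
      using alA beB AB0 by (simp_all add: a_def b_def)
    define p where "p = reflection_word us"
    define q where "q = reflection_word vs"
    have op: "orthogonal_transformation p" "orthogonal_transformation q"
      by (simp_all add: p_def q_def orthogonal_reflection_word)
    then have lin: "linear p" "linear q" by (simp_all add: orthogonal_transformation_linear)
    have im: "p ` \<Phi> = \<Phi>" "q ` \<Phi> = \<Phi>"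
      using sub us vs by (simp_all add: p_def q_def reflection_word_image)
    have pb: "p b = b" and qa: "q a = a"
      using plane_I(2) plane_J(2) lin by (simp_all add: p_def q_def a_def b_def A_def B_def linear_cmul)
    define \<kappa> where "\<kappa> = 2 * (1 / \<mu> - 1)"
    have pA: "p A = - A - \<kappa> *\<^sub>R B" and qB: "q B = - B - \<kappa> *\<^sub>R A"
      using plane_I(1) plane_J(1) by (simp_all add: p_def q_def A_def B_def \<kappa>_def)
    have pa: "p a = (2 * (a \<bullet> b)) *\<^sub>R b - a"
    proof -
      have "p a = - a + (- \<kappa> * norm B / norm A) *\<^sub>R b"
        using lin AB0 by (simp add: a_def b_def linear_cmul pA scaleR_diff_right)
      \<comment> \<open>The coefficient need not be computed from \<mu>: an isometry that fixes the
        unit vector b and sends a to -a + t b has t equal to twice the inner product of a and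
        b.\<close>
      then obtain t where t: "p a = - a + t *\<^sub>R b" by blast
      have "p a \<bullet> b = a \<bullet> b" using op(1) pb unfolding orthogonal_transformation_def by metis
      then have "t = 2 * (a \<bullet> b)" unfolding t by (simp add: inner_diff_left inner_add_left unit)
      then show ?thesis using t by simp
    qed
    have qb: "q b = (2 * (a \<bullet> b)) *\<^sub>R a - b"
    proof -
      have "q b = - b + (- \<kappa> * norm A / norm B) *\<^sub>R a"
        using lin AB0 by (simp add: a_def b_def linear_cmul qB scaleR_diff_right)
      then obtain t where t: "q b = - b + t *\<^sub>R a" by blast
      have "q b \<bullet> a = b \<bullet> a" using op(2) qa unfolding orthogonal_transformation_def by metis
      then have "t = 2 * (b \<bullet> a)" unfolding t by (simp add: inner_diff_left inner_add_left unit)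
      then show ?thesis using t by (simp add: inner_commute)
    qed
    have ab1: "\<bar>a \<bullet> b\<bar> < 1"
    proof (rule ccontr)
      assume n: "\<not> ?thesis"
      define s where "s = a \<bullet> b"
      have "(a - s *\<^sub>R b) \<bullet> (a - s *\<^sub>R b) = 1 - s * s"
        by (simp add: inner_diff_left inner_diff_right unit inner_commute[of b a] flip: s_def)
      moreover have "1 \<le> s * s"
        using n mult_mono[of 1 "\<bar>s\<bar>" 1 "\<bar>s\<bar>"] by (simp add: s_def not_less)
      ultimately have "(a - s *\<^sub>R b) \<bullet> (a - s *\<^sub>R b) \<le> 0" by simp
      then have "a = s *\<^sub>R b" by (metis eq_iff_diff_eq_0 inner_gt_zero_iff not_le)
      then have "\<alpha> \<bullet> a = s * (\<alpha> \<bullet> b)" by (metis inner_scaleR_right)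
      then show False using ala by simp
    qed
    have sum_pos: "\<gamma> \<bullet> a \<ge> 0" "\<gamma> \<bullet> b \<ge> 0" "\<gamma> \<bullet> a + \<gamma> \<bullet> b > 0" if g: "\<gamma> \<in> \<Phi>\<^sub>p" for \<gamma>
    proof -
      have nn: "\<gamma> \<bullet> A \<ge> 0" "\<gamma> \<bullet> B \<ge> 0"
        unfolding A_def B_def using sub zpos g by (auto intro!: dominant_part_nonneg)
      have "\<not> (\<gamma> \<bullet> A = 0 \<and> \<gamma> \<bullet> B = 0)"
      proof
        assume "\<gamma> \<bullet> A = 0 \<and> \<gamma> \<bullet> B = 0"
        then have "fw c \<bullet> \<gamma> = 0" if "c \<in> \<Delta>" for c
          using dominant_part_zero[of I z \<gamma> c] dominant_part_zero[of J z \<gamma> c] sub zpos g that IJ(1)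
          unfolding A_def B_def by blast
        then show False using pos_ex[OF g] by force
      qed
      then have "\<not> (\<gamma> \<bullet> a = 0 \<and> \<gamma> \<bullet> b = 0)" using AB0 by (simp add: a_def b_def)
      moreover show "\<gamma> \<bullet> a \<ge> 0" "\<gamma> \<bullet> b \<ge> 0" using nn by (simp_all add: a_def b_def)
      ultimately show "\<gamma> \<bullet> a + \<gamma> \<bullet> b > 0" by linarith
    qed
    have unsep: "unseparated a b"
      unfolding unseparated_def
    proof
      fix \<gamma> assume "\<gamma> \<in> \<Phi>"
      then consider "\<gamma> \<in> \<Phi>\<^sub>p" | "- \<gamma> \<in> \<Phi>\<^sub>p" using pos_or_neg by blast
      then show "0 \<le> (\<gamma> \<bullet> a) * (\<gamma> \<bullet> b) \<and> (\<gamma> \<bullet> a \<noteq> 0 \<or> \<gamma> \<bullet> b \<noteq> 0)"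
      proof cases
        case 1
        then show ?thesis using sum_pos[of \<gamma>] by auto
      next
        case 2
        then show ?thesis using sum_pos[of "- \<gamma>"] by (auto simp: mult_nonpos_nonpos)
      qed
    qed
    have roots: "\<alpha> \<in> \<Phi>" "\<beta> \<in> \<Phi>" using al be sub by auto
    obtain m where m: "m > 0" "((p \<circ> q) ^^ m) a = a" "((p \<circ> q) ^^ m) b = b"
      and min: "\<And>k. 0 < k \<Longrightarrow> k < m \<Longrightarrow> (p \<circ> q) ^^ k \<noteq> id"
      and count: "2 * card \<Phi> = m * (card {\<beta>\<in>\<Phi>. \<beta> \<bullet> a = 0} + card {\<beta>\<in>\<Phi>. \<beta> \<bullet> b = 0})"
      by (rule dihedral_order[OF op(1) im(1) pb pa op(2) im(2) qa qb ab1 unsep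
            roots(1) ala(2) roots(2) ala(4)]) (rule that; blast)
    have pq: "p \<circ> q = reflection_word (us @ vs)" by (simp only: p_def q_def reflection_word_append)
    have "{\<beta>\<in>\<Phi>. \<beta> \<bullet> a = 0} = {\<beta>\<in>\<Phi>. \<beta> \<bullet> A = 0}" "{\<beta>\<in>\<Phi>. \<beta> \<bullet> b = 0} = {\<beta>\<in>\<Phi>. \<beta> \<bullet> B = 0}"
      using AB0 by (simp_all add: a_def b_def)
    then have "2 * card \<Phi> = m * (2 * card J + 2 * card I)"
      using count card_roots_orthogonal_dominant_part[OF mu zpos eig IJ]
        card_roots_orthogonal_dominant_part[OF mu zpos eig JI IJ(4,3)]
      by (simp add: A_def B_def)
    then have "2 * card \<Phi> = 2 * (m * (card I + card J))" by (simp add: algebra_simps)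
    moreover have "card I + card J = DIM('a)"
      using card_Un_disjoint[OF fin IJ(2)] IJ(1) card_simple by simp
    ultimately have card: "card \<Phi> = m * DIM('a)" by simp
    have word: "(p \<circ> q) ^^ m = reflection_word (concat (replicate m (us @ vs)))"
      by (simp only: reflection_word_concat_replicate pq)
    \<comment> \<open>The rotation statement concerns only the plane. It extends to all of V because
      the power fixes a + b, which is strictly dominant.\<close>
    have id: "(p \<circ> q) ^^ m = id"
      unfolding word
    proof (rule reflection_word_fixes_regular)
      show "set (concat (replicate m (us @ vs))) \<subseteq> \<Delta>" using us vs sub by auto
      show "(a + b) \<bullet> \<gamma> > 0" if "\<gamma> \<in> \<Phi>\<^sub>p" for \<gamma>
        using sum_pos[OF that] by (simp add: inner_commute[of "a + b"] inner_add_right)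
      have "reflection_word (concat (replicate m (us @ vs))) (a + b) =
          reflection_word (concat (replicate m (us @ vs))) a + reflection_word (concat (replicate m (us @ vs))) b"
        by (rule linear_add[OF orthogonal_transformation_linear[OF orthogonal_reflection_word]])
      then show "reflection_word (concat (replicate m (us @ vs))) (a + b) = a + b"
        unfolding word[symmetric] m(2,3) .
    qed
    have ds: "distinct (us @ vs)" "set (us @ vs) = \<Delta>" using us vs IJ by auto
    have e1: "coxeter_equiv (us @ vs) xs" using ds xs by (intro coxeter_equiv_all) auto
    have e2: "coxeter_equiv xs (us @ vs)" using ds xs by (intro coxeter_equiv_all) auto
    show ?thesis
    proof (rule that[of m])
      show "reflection_word xs ^^ m = id"
        using coxeter_equiv_funpow_id[OF e1] id unfolding pq by blast
      show "reflection_word xs ^^ k \<noteq> id" if "0 < k" "k < m" for k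
        using coxeter_equiv_funpow_id[OF e2] min[OF that] unfolding pq by blast
    qed (simp_all add: m(1) card)
  qed
qed

theorem coxeter_number_height:
  assumes "coxeter_number \<Delta> h"
  shows "real h = rho \<bullet> theta + 1"
proof -
  obtain xs where xs: "distinct xs" "set xs = \<Delta>" and h: "0 < h" "reflection_word xs ^^ h = id"
    "\<And>k. 0 < k \<Longrightarrow> k < h \<Longrightarrow> reflection_word xs ^^ k \<noteq> id"
    using assms unfolding coxeter_number_def coxeter_element_def reflection_word_def by blast
  obtain m where m: "m > 0" "card \<Phi> = m * DIM('a)" "reflection_word xs ^^ m = id"
    "\<And>k. 0 < k \<Longrightarrow> k < m \<Longrightarrow> reflection_word xs ^^ k \<noteq> id"
    using coxeter_word_order[OF xs] by blast
  have "h = m" using h m by (metis linorder_neqE_nat)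
  then show ?thesis using card_roots m(2) by simp
qed

end

section \<open>Quasi-polynomials and partition functions\<close>

text \<open>A real-valued counterpart of \<open>quasi_polynomial\<close> with explicit period: the
  intermediate functions contain binomial polynomials and a division by the order of a group, so
  their integrality is known only at the end.\<close>

definition periodic_poly :: "nat \<Rightarrow> (int \<Rightarrow> real) \<Rightarrow> bool" where
  "periodic_poly \<rho> f \<longleftrightarrow> (\<forall>r. \<exists>p. \<forall>t. t mod int \<rho> = r \<longrightarrow> f t = poly p (of_int t))"

lemma periodic_poly_add:
  "periodic_poly \<rho> f \<Longrightarrow> periodic_poly \<rho> g \<Longrightarrow> periodic_poly \<rho> (\<lambda>t. f t + g t)"
  unfolding periodic_poly_def by (metis poly_add)

lemma periodic_poly_scale:
  "periodic_poly \<rho> f \<Longrightarrow> periodic_poly \<rho> (\<lambda>t. c * f t)"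
  unfolding periodic_poly_def by (metis poly_smult)

lemma periodic_poly_zero: "periodic_poly \<rho> (\<lambda>t. 0)"
  unfolding periodic_poly_def by (metis poly_0)

lemma periodic_poly_sum:
  "(\<And>i. i \<in> A \<Longrightarrow> periodic_poly \<rho> (f i)) \<Longrightarrow> periodic_poly \<rho> (\<lambda>t. \<Sum>i\<in>A. f i t)"
  by (induction A rule: infinite_finite_induct)
     (auto intro: periodic_poly_add simp: periodic_poly_zero)

lemma periodic_poly_shift:
  assumes "periodic_poly \<rho> f" shows "periodic_poly \<rho> (\<lambda>t. f (t - a))"
  unfolding periodic_poly_def
proof
  fix r
  obtain p where p: "\<And>t. t mod int \<rho> = (r - a) mod int \<rho> \<Longrightarrow> f t = poly p (of_int t)"
    using assms unfolding periodic_poly_def by blast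
  show "\<exists>p. \<forall>t. t mod int \<rho> = r \<longrightarrow> f (t - a) = poly p (of_int t)"
  proof (intro exI[of _ "pcompose p [:- of_int a, 1:]"] allI impI)
    fix t assume "t mod int \<rho> = r"
    then have "(t - a) mod int \<rho> = (r - a) mod int \<rho>" by (metis mod_diff_left_eq)
    then show "f (t - a) = poly (pcompose p [:- of_int a, 1:]) (of_int t)"
      by (simp add: p poly_pcompose)
  qed
qed

lemma periodic_poly_dvd:
  assumes "\<rho> > 0"
  shows "periodic_poly \<rho> (\<lambda>t. if int \<rho> dvd t then poly p (of_int t / of_nat \<rho>) else 0)"
  unfolding periodic_poly_def
proof
  fix r
  show "\<exists>p'. \<forall>t. t mod int \<rho> = r \<longrightarrow>
      (if int \<rho> dvd t then poly p (of_int t / of_nat \<rho>) else 0) = poly p' (of_int t)"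
  proof (cases "r = 0")
    case True
    then show ?thesis
      by (intro exI[of _ "pcompose p [:0, 1 / of_nat \<rho>:]"])
         (auto simp: poly_pcompose dvd_eq_mod_eq_0 mult.commute)
  next
    case False
    then show ?thesis by (intro exI[of _ 0]) (auto simp: dvd_eq_mod_eq_0)
  qed
qed

lemma periodic_poly_mult:
  assumes "periodic_poly \<rho> f" shows "periodic_poly (\<rho> * \<sigma>) f"
  unfolding periodic_poly_def
proof
  fix r
  obtain p where p: "\<And>t. t mod int \<rho> = r mod int \<rho> \<Longrightarrow> f t = poly p (of_int t)"
    using assms unfolding periodic_poly_def by blast
  show "\<exists>p. \<forall>t. t mod int (\<rho> * \<sigma>) = r \<longrightarrow> f t = poly p (of_int t)"
    by (intro exI[of _ p] allI impI p) (auto simp: mod_mod_cancel)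
qed

lemma periodic_poly_along_class:
  assumes "periodic_poly \<rho> f"
  obtains p where "\<And>s. f (t + int \<rho> * s) = poly p (of_int s)"
proof -
  obtain p where p: "\<And>u. u mod int \<rho> = t mod int \<rho> \<Longrightarrow> f u = poly p (of_int u)"
    using assms unfolding periodic_poly_def by blast
  have "f (t + int \<rho> * s) = poly (pcompose p [:of_int t, of_nat \<rho>:]) (of_int s)" for s
    by (subst p) (simp_all add: poly_pcompose mult.commute)
  then show ?thesis by (rule that)
qed

lemma poly_eventually_zero:
  fixes p :: "real poly"
  assumes "\<And>s::int. s \<ge> S \<Longrightarrow> poly p (of_int s) = 0"
  shows "p = 0"
proof (rule ccontr)
  assume "p \<noteq> 0"
  then have "finite {x. poly p x = 0}" by (rule poly_roots_finite)
  then have "finite (of_int ` {S..} :: real set)"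
    by (rule rev_finite_subset) (use assms in auto)
  then show False
    by (simp add: finite_image_iff inj_on_def infinite_Ici)
qed

text \<open>Induction on the degree by the difference operator: the differences are integral
  everywhere, so integrality descends from S to all smaller arguments one step at a time.\<close>

lemma poly_eventually_int:
  fixes p :: "real poly"
  assumes "\<And>s::int. s \<ge> S \<Longrightarrow> poly p (of_int s) \<in> \<int>"
  shows "poly p (of_int s) \<in> \<int>"
  using assms
proof (induction "degree p" arbitrary: p s rule: less_induct)
  case less
  show ?case
  proof (cases "degree p = 0")
    case True
    then obtain a where "p = [:a:]" by (rule degree_eq_zeroE)
    then show ?thesis using less.prems[of S] by simp
  next
    case False
    define d where "d = pcompose p [:1, 1:] - p"
    have d: "poly d (of_int s) = poly p (of_int (s + 1)) - poly p (of_int s)" for s :: int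
      by (simp add: d_def poly_pcompose add.commute)
    have "degree d \<le> degree p" unfolding d_def by (intro degree_diff_le) (simp_all add: degree_pcompose)
    moreover have "coeff d (degree p) = 0"
      using lead_coeff_comp[of "[:1, 1:]" p] by (simp add: d_def degree_pcompose)
    ultimately have deg: "degree d < degree p" using eq_zero_or_degree_less[of d "degree p"] False by auto
    have di: "poly d (of_int s) \<in> \<int>" for s :: int
    proof (rule less.hyps[OF deg])
      fix s assume "s \<ge> S"
      then have "poly p (of_int (s + 1)) \<in> \<int>" "poly p (of_int s) \<in> \<int>"
        using less.prems[of "s + 1"] less.prems[of s] by simp_all
      then show "poly d (of_int s) \<in> \<int>" unfolding d by (rule Ints_diff)
    qed
    have down: "poly p (of_int (S - int k)) \<in> \<int>" for k
    proof (induction k)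
      case (Suc k)
      have e: "S - int (Suc k) + 1 = S - int k" by simp
      have "poly p (of_int (S - int (Suc k))) = poly p (of_int (S - int k)) - poly d (of_int (S - int (Suc k)))"
        unfolding d e by simp
      then show ?case using Suc di[of "S - int (Suc k)"] by (metis Ints_diff)
    qed (use less.prems[of S] in simp)
    show ?thesis
    proof (cases "s \<ge> S")
      case False
      then show ?thesis using down[of "nat (S - s)"] by simp
    qed (use less.prems in blast)
  qed
qed

lemma large_in_class:
  assumes "\<rho> > 0" "s \<ge> int (nat \<bar>t\<bar>) + int n"
  shows "t + int \<rho> * s \<ge> int n"
proof -
  have "1 * s \<le> int \<rho> * s" using assms by (intro mult_right_mono) auto
  then show ?thesis using assms by linarith
qed

text \<open>Carries integrality from large arguments, where the values count something, to all
  integers, negative ones included: along each residue class the function is one polynomial.\<close>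

lemma periodic_poly_int:
  assumes "periodic_poly \<rho> f" "\<rho> > 0" "\<forall>\<^sub>F q in sequentially. f (int q) \<in> \<int>"
  shows "f t \<in> \<int>"
proof -
  obtain n where n: "\<And>q. q \<ge> n \<Longrightarrow> f (int q) \<in> \<int>"
    using assms(3) unfolding eventually_sequentially by blast
  obtain p where p: "\<And>s. f (t + int \<rho> * s) = poly p (of_int s)"
    using periodic_poly_along_class[OF assms(1)] by blast
  have "poly p (of_int 0) \<in> \<int>"
  proof (rule poly_eventually_int)
    fix s assume "s \<ge> int (nat \<bar>t\<bar>) + int n"
    then have "t + int \<rho> * s \<ge> int n" by (rule large_in_class[OF assms(2)])
    then show "poly p (of_int s) \<in> \<int>" using n[of "nat (t + int \<rho> * s)"] by (simp flip: p)
  qed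
  then show ?thesis using p[of 0] by simp
qed

lemma periodic_poly_unique:
  assumes "periodic_poly \<rho> f" "\<rho> > 0" "periodic_poly \<sigma> g" "\<sigma> > 0"
    and "\<forall>\<^sub>F q in sequentially. f (int q) = g (int q)"
  shows "f = g"
proof
  fix t
  define h where "h t = f t + (-1) * g t" for t
  have "periodic_poly (\<rho> * \<sigma>) h" unfolding h_def
    using periodic_poly_mult[OF assms(1), of \<sigma>] periodic_poly_mult[OF assms(3), of \<rho>]
    by (intro periodic_poly_add periodic_poly_scale) (simp_all add: mult.commute)
  then obtain p where p: "\<And>s. h (t + int (\<rho> * \<sigma>) * s) = poly p (of_int s)"
    using periodic_poly_along_class by blast
  obtain n where n: "\<And>q. q \<ge> n \<Longrightarrow> h (int q) = 0"
    using assms(5) unfolding eventually_sequentially h_def by auto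
  have "p = 0"
  proof (rule poly_eventually_zero)
    fix s assume "s \<ge> int (nat \<bar>t\<bar>) + int n"
    then have "t + int (\<rho> * \<sigma>) * s \<ge> int n" using assms by (intro large_in_class) auto
    then show "poly p (of_int s) = 0" using n[of "nat (t + int (\<rho> * \<sigma>) * s)"] by (simp flip: p)
  qed
  then show "f t = g t" using p[of 0] by (simp add: h_def)
qed

lemma quasi_polynomial_iff:
  "quasi_polynomial f \<longleftrightarrow> (\<exists>\<rho>>0. periodic_poly \<rho> (\<lambda>t. of_int (f t)))"
proof -
  have "(\<exists>p :: int \<Rightarrow> real poly. \<forall>t. of_int (f t) = poly (p (t mod int \<rho>)) (of_int t))
      \<longleftrightarrow> periodic_poly \<rho> (\<lambda>t. of_int (f t))" for \<rho>
  proof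
    assume "periodic_poly \<rho> (\<lambda>t. of_int (f t))"
    then have "\<exists>p. \<forall>r. \<forall>t. t mod int \<rho> = r \<longrightarrow> of_int (f t) = poly (p r) (of_int t :: real)"
      unfolding periodic_poly_def by (rule choice)
    then show "\<exists>p :: int \<Rightarrow> real poly. \<forall>t. of_int (f t) = poly (p (t mod int \<rho>)) (of_int t)"
      by blast
  qed (auto simp: periodic_poly_def)
  then show ?thesis unfolding quasi_polynomial_def by metis
qed

section \<open>Compositions and restricted partitions\<close>

lemma card_PiE_insert_sum:
  assumes "finite S" "a \<notin> S"
  shows "card {k \<in> insert a S \<rightarrow>\<^sub>E (UNIV :: nat set). sum k (insert a S) = m}
       = (\<Sum>j\<le>m. card {k \<in> S \<rightarrow>\<^sub>E (UNIV :: nat set). sum k S = j})"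
proof -
  have fin: "finite {k \<in> S \<rightarrow>\<^sub>E (UNIV :: nat set). sum k S = j}" for j
  proof (rule finite_subset)
    show "{k \<in> S \<rightarrow>\<^sub>E UNIV. sum k S = j} \<subseteq> S \<rightarrow>\<^sub>E {..j}"
      using assms by (auto simp: PiE_iff extensional_def intro: member_le_sum)
  qed (use assms in \<open>simp add: finite_PiE\<close>)
  have "bij_betw (\<lambda>(j, k). k(a := m - j)) (SIGMA j:{..m}. {k \<in> S \<rightarrow>\<^sub>E (UNIV :: nat set). sum k S = j})
      {k \<in> insert a S \<rightarrow>\<^sub>E (UNIV :: nat set). sum k (insert a S) = m}"
  proof (rule bij_betw_byWitness[where f' = "\<lambda>k. (sum k S, k(a := undefined))"])
    have s: "sum (k(a := x)) S = sum k S" for k :: "'a \<Rightarrow> nat" and x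
      using assms by (intro sum.cong) auto
    have s2: "(\<Sum>i\<in>S. if i = a then x else k i) = sum k S" for k :: "'a \<Rightarrow> nat" and x
      using assms by (intro sum.cong) auto
    have und: "k(a := undefined) = k" if "k \<in> S \<rightarrow>\<^sub>E (UNIV :: nat set)" for k
      using PiE_arb[OF that assms(2)] by (intro fun_upd_idem)
    show "\<forall>p\<in>SIGMA j:{..m}. {k \<in> S \<rightarrow>\<^sub>E (UNIV :: nat set). sum k S = j}.
        (\<lambda>k. (sum k S, k(a := undefined))) ((\<lambda>(j, k). k(a := m - j)) p) = p"
      using und by (auto simp: s simp del: fun_upd_apply)
    show "\<forall>k\<in>{k \<in> insert a S \<rightarrow>\<^sub>E (UNIV :: nat set). sum k (insert a S) = m}.
        (\<lambda>(j, k). k(a := m - j)) ((\<lambda>k. (sum k S, k(a := undefined))) k) = k"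
      using assms by (auto simp: fun_eq_iff)
    show "(\<lambda>(j, k). k(a := m - j)) ` (SIGMA j:{..m}. {k \<in> S \<rightarrow>\<^sub>E (UNIV :: nat set). sum k S = j})
        \<subseteq> {k \<in> insert a S \<rightarrow>\<^sub>E (UNIV :: nat set). sum k (insert a S) = m}"
      using assms by (auto simp: s2 PiE_iff extensional_def)
    show "(\<lambda>k. (sum k S, k(a := undefined))) ` {k \<in> insert a S \<rightarrow>\<^sub>E (UNIV :: nat set). sum k (insert a S) = m}
        \<subseteq> (SIGMA j:{..m}. {k \<in> S \<rightarrow>\<^sub>E (UNIV :: nat set). sum k S = j})"
      using assms by (auto simp: s2 PiE_iff extensional_def)
  qed
  then have "card {k \<in> insert a S \<rightarrow>\<^sub>E (UNIV :: nat set). sum k (insert a S) = m}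
      = card (SIGMA j:{..m}. {k \<in> S \<rightarrow>\<^sub>E (UNIV :: nat set). sum k S = j})"
    by (simp add: bij_betw_same_card)
  then show ?thesis using fin by simp
qed

text \<open>Stars and bars, by induction with the hockey-stick identity: once the sum over the other
  indices is chosen, the new coordinate is forced.\<close>

lemma card_compositions:
  assumes "finite S" "S \<noteq> {}"
  shows "card {k \<in> S \<rightarrow>\<^sub>E (UNIV :: nat set). sum k S = m} = (m + (card S - 1)) choose m"
  using assms
proof (induction S arbitrary: m rule: finite_ne_induct)
  case (singleton a)
  have "card {k \<in> {a} \<rightarrow>\<^sub>E (UNIV :: nat set). sum k {a} = m}
      = (\<Sum>j\<le>m. card {k \<in> ({} :: 'a set) \<rightarrow>\<^sub>E (UNIV :: nat set). sum k {} = j})"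
    by (rule card_PiE_insert_sum) auto
  also have "\<dots> = (\<Sum>j\<le>m. if j = 0 then 1 else 0)"
    by (rule sum.cong) auto
  finally show ?case by simp
next
  case (insert a S)
  have "card S > 0" using insert by (simp add: card_gt_0_iff)
  have "card {k \<in> insert a S \<rightarrow>\<^sub>E (UNIV :: nat set). sum k (insert a S) = m}
      = (\<Sum>j\<le>m. card {k \<in> S \<rightarrow>\<^sub>E (UNIV :: nat set). sum k S = j})"
    using insert by (intro card_PiE_insert_sum)
  also have "\<dots> = (\<Sum>j\<le>m. (card S - 1 + j) choose j)"
    by (simp add: insert.IH add.commute)
  also have "\<dots> = Suc (card S - 1 + m) choose m" by (rule sum_choose_lower)
  finally show ?case using insert \<open>card S > 0\<close> by (simp add: add.commute)
qed

text \<open>The denumerant of the parts c. The argument is an integer since the alcove count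
  evaluates it at differences; negative arguments simply give 0.\<close>

definition partition_count :: "'b set \<Rightarrow> ('b \<Rightarrow> nat) \<Rightarrow> int \<Rightarrow> nat" where
  "partition_count S c t = card {y \<in> S \<rightarrow>\<^sub>E (UNIV :: nat set). int (\<Sum>i\<in>S. c i * y i) = t}"

text \<open>Write \<open>y i = (N div c i) * k i + r i\<close> with \<open>N = prod c S\<close>: each residue vector \<open>r\<close> leaves
  a count of compositions.\<close>

definition partition_quasi :: "'b set \<Rightarrow> ('b \<Rightarrow> nat) \<Rightarrow> int \<Rightarrow> real" where
  "partition_quasi S c t = (\<Sum>r\<in>(\<Pi>\<^sub>E i\<in>S. {..<prod c S div c i}).
     if int (prod c S) dvd t - int (\<Sum>i\<in>S. c i * r i)
     then (of_int (t - int (\<Sum>i\<in>S. c i * r i)) / of_nat (prod c S) + of_nat (card S - 1)) gchoose (card S - 1)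
     else 0)"

lemma gbinomial_poly: "\<exists>p :: real poly. \<forall>x. poly p x = (x + of_nat l) gchoose l"
proof -
  have "poly (smult (1 / fact l) (\<Prod>i=0..<l. [:of_nat l - of_nat i, 1:])) x = (x + of_nat l) gchoose l"
    for x :: real
    by (simp add: gbinomial_prod_rev poly_prod algebra_simps)
  then show ?thesis by blast
qed

lemma periodic_poly_partition_quasi:
  assumes "finite S" "\<And>i. i \<in> S \<Longrightarrow> c i > 0"
  shows "periodic_poly (prod c S) (partition_quasi S c)"
proof -
  obtain p :: "real poly" where p: "\<And>x. (x + of_nat (card S - 1)) gchoose (card S - 1) = poly p x"
    using gbinomial_poly by metis
  have "prod c S > 0" using assms by (simp add: prod_pos)
  then show ?thesis
    unfolding partition_quasi_def p
    by (intro periodic_poly_sum periodic_poly_shift[OF periodic_poly_dvd])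
qed

context
  fixes S :: "'b set" and c :: "'b \<Rightarrow> nat"
  assumes fin: "finite S" and ne: "S \<noteq> {}" and pos: "\<And>i. i \<in> S \<Longrightarrow> c i > 0"
begin

private abbreviation "N \<equiv> prod c S"
private abbreviation "d i \<equiv> prod c S div c i"

declare of_nat_prod [simp del] of_nat_sum [simp del]

lemma marks_mult: "i \<in> S \<Longrightarrow> c i * d i = N"
  by (rule dvd_mult_div_cancel, rule dvd_prodI[OF fin, of _ c])

lemma marks_div_pos: "i \<in> S \<Longrightarrow> d i > 0"
proof -
  assume "i \<in> S"
  moreover have "N > 0" using pos by (simp add: prod_pos)
  ultimately show ?thesis using marks_mult[of i] by (metis gr0I mult_0_right nless_le)
qed

lemma finite_partitions: "finite {y \<in> S \<rightarrow>\<^sub>E (UNIV :: nat set). int (\<Sum>i\<in>S. c i * y i) = t}"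
proof (rule finite_subset)
  show "{y \<in> S \<rightarrow>\<^sub>E UNIV. int (\<Sum>i\<in>S. c i * y i) = t} \<subseteq> S \<rightarrow>\<^sub>E {..nat t}"
  proof
    fix y assume y: "y \<in> {y \<in> S \<rightarrow>\<^sub>E (UNIV :: nat set). int (\<Sum>i\<in>S. c i * y i) = t}"
    have "y i \<le> nat t" if i: "i \<in> S" for i
    proof -
      have "1 * y i \<le> c i * y i" using pos[OF i] by (intro mult_right_mono) auto
      also have "\<dots> \<le> (\<Sum>i\<in>S. c i * y i)"
        using fin i by (intro member_le_sum) auto
      also have "\<dots> = nat t" using y by (metis (mono_tags, lifting) mem_Collect_eq nat_int)
      finally show ?thesis by simp
    qed
    then show "y \<in> S \<rightarrow>\<^sub>E {..nat t}" using y by (auto simp: PiE_iff)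
  qed
qed (use fin in \<open>simp add: finite_PiE\<close>)

text \<open>Dividing y i by N / c i makes every unit of quotient weigh exactly N, whatever i is. So
  the quotients form a composition of (t - s) / N, where s is the weight of the residues. The bound
  on t keeps this number non-negative; at sufficiently negative integers the binomial polynomial
  need not vanish although the count does.\<close>

lemma card_partitions_residue:
  assumes r: "r \<in> (\<Pi>\<^sub>E i\<in>S. {..<d i})" and t: "t \<ge> int (\<Sum>i\<in>S. c i * r i)"
  shows "real (card {y \<in> S \<rightarrow>\<^sub>E (UNIV :: nat set). int (\<Sum>i\<in>S. c i * y i) = t \<and> (\<forall>i\<in>S. y i mod d i = r i)})
    = (if int N dvd t - int (\<Sum>i\<in>S. c i * r i)
       then (of_int (t - int (\<Sum>i\<in>S. c i * r i)) / of_nat N + of_nat (card S - 1)) gchoose (card S - 1)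
       else 0)"
proof -
  let ?s = "int (\<Sum>i\<in>S. c i * r i)"
  let ?Y = "{y \<in> S \<rightarrow>\<^sub>E (UNIV :: nat set). int (\<Sum>i\<in>S. c i * y i) = t \<and> (\<forall>i\<in>S. y i mod d i = r i)}"
  let ?K = "{k \<in> S \<rightarrow>\<^sub>E (UNIV :: nat set). int N * int (sum k S) = t - ?s}"
  have Npos: "N > 0" using pos by (simp add: prod_pos)
  have rd: "r i < d i" if "i \<in> S" for i using r that by auto
  have divmod: "(d i * x + r i) div d i = x" "(d i * x + r i) mod d i = r i" if "i \<in> S" for i x
    using rd[OF that] by (cases "d i = 0"; simp)+
  have total: "(\<Sum>i\<in>S. c i * (d i * k i + r i)) = N * sum k S + (\<Sum>i\<in>S. c i * r i)" for k
  proof -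
    have "(\<Sum>i\<in>S. c i * (d i * k i + r i)) = (\<Sum>i\<in>S. N * k i + c i * r i)"
      by (intro sum.cong refl) (simp add: distrib_left marks_mult flip: mult.assoc)
    then show ?thesis by (simp add: sum.distrib sum_distrib_left)
  qed
  have "bij_betw (\<lambda>k. \<lambda>i\<in>S. d i * k i + r i) ?K ?Y"
  proof (rule bij_betw_byWitness[where f' = "\<lambda>y. \<lambda>i\<in>S. y i div d i"])
    show "\<forall>k\<in>?K. (\<lambda>i\<in>S. (\<lambda>i\<in>S. d i * k i + r i) i div d i) = k"
    proof
      fix k assume "k \<in> ?K"
      then show "(\<lambda>i\<in>S. (\<lambda>i\<in>S. d i * k i + r i) i div d i) = k"
        by (auto simp: PiE_iff extensional_def fun_eq_iff divmod)
    qed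
    show "\<forall>y\<in>?Y. (\<lambda>i\<in>S. d i * (\<lambda>i\<in>S. y i div d i) i + r i) = y"
    proof
      fix y assume y: "y \<in> ?Y"
      have "d i * (y i div d i) + r i = y i" if "i \<in> S" for i
        using y that mult_div_mod_eq[of "d i" "y i"] by auto
      then show "(\<lambda>i\<in>S. d i * (\<lambda>i\<in>S. y i div d i) i + r i) = y"
        using y by (auto simp: PiE_iff extensional_def fun_eq_iff)
    qed
    show "(\<lambda>k. \<lambda>i\<in>S. d i * k i + r i) ` ?K \<subseteq> ?Y"
    proof (rule image_subsetI)
      fix k assume "k \<in> ?K"
      then have "int (N * sum k S) + ?s = t" by simp
      then have "int (\<Sum>i\<in>S. c i * (d i * k i + r i)) = t" unfolding total by simp
      then show "(\<lambda>i\<in>S. d i * k i + r i) \<in> ?Y" by (simp add: divmod rd)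
    qed
    show "(\<lambda>y. \<lambda>i\<in>S. y i div d i) ` ?Y \<subseteq> ?K"
    proof (rule image_subsetI)
      fix y assume y: "y \<in> ?Y"
      have "(\<Sum>i\<in>S. c i * (d i * (y i div d i) + r i)) = (\<Sum>i\<in>S. c i * y i)"
      proof (intro sum.cong refl)
        fix i assume "i \<in> S"
        then show "c i * (d i * (y i div d i) + r i) = c i * y i"
          using y mult_div_mod_eq[of "d i" "y i"] by auto
      qed
      then have "int (N * (\<Sum>i\<in>S. y i div d i) + (\<Sum>i\<in>S. c i * r i)) = t"
        using y total[of "\<lambda>i. y i div d i"] by auto
      then show "(\<lambda>i\<in>S. y i div d i) \<in> ?K" by simp
    qed
  qed
  then have "card ?Y = card ?K" by (simp add: bij_betw_same_card)
  also have "real \<dots> = (if int N dvd t - ?s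
       then (of_int (t - ?s) / of_nat N + of_nat (card S - 1)) gchoose (card S - 1) else 0)"
  proof (cases "int N dvd t - ?s")
    case True
    then obtain m' where m': "t - ?s = int N * m'" by blast
    then have "m' \<ge> 0" using t Npos by (metis diff_ge_0_iff_ge of_nat_0_less_iff zero_le_mult_iff not_le)
    then obtain m where m: "t - ?s = int N * int m" using m' zero_le_imp_eq_int by metis
    have "?K = {k \<in> S \<rightarrow>\<^sub>E (UNIV :: nat set). sum k S = m}"
      unfolding m using Npos by (auto simp: mult_left_cancel)
    then have "card ?K = (m + (card S - 1)) choose m" using card_compositions[OF fin ne] by simp
    also have "\<dots> = (m + (card S - 1)) choose (card S - 1)"
      using binomial_symmetric[of m "m + (card S - 1)"] by simp
    finally have "real (card ?K) = (of_nat m + of_nat (card S - 1)) gchoose (card S - 1)"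
      by (simp add: binomial_gbinomial)
    moreover have "(of_int (t - ?s) :: real) / of_nat N = of_nat m"
      unfolding m using Npos by simp
    ultimately show ?thesis using True by simp
  next
    case False
    then have "?K = {}" by (metis (mono_tags, lifting) dvd_triv_left empty_Collect_eq)
    then show ?thesis using False by (metis card.empty of_nat_0)
  qed
  finally show ?thesis .
qed

text \<open>Each residue term weighs at most N, so beyond card S * N the bound of
  \<open>card_partitions_residue\<close> holds for all residue vectors simultaneously.\<close>

lemma partition_count_quasi:
  assumes "t \<ge> int (card S * N)"
  shows "real (partition_count S c t) = partition_quasi S c t"
proof -
  let ?X = "{y \<in> S \<rightarrow>\<^sub>E (UNIV :: nat set). int (\<Sum>i\<in>S. c i * y i) = t}"
  let ?R = "\<Pi>\<^sub>E i\<in>S. {..<d i}"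
  have finR: "finite ?R" using fin by (simp add: finite_PiE)
  have sub: "(\<lambda>y. \<lambda>i\<in>S. y i mod d i) ` ?X \<subseteq> ?R" using marks_div_pos by auto
  have "card ?X = (\<Sum>r\<in>?R. card {y\<in>?X. (\<lambda>i\<in>S. y i mod d i) = r})"
    using sum.group[OF finite_partitions finR sub, of "\<lambda>_. 1::nat"] by (simp only: card_eq_sum)
  also have "\<dots> = (\<Sum>r\<in>?R. card {y \<in> S \<rightarrow>\<^sub>E (UNIV :: nat set). int (\<Sum>i\<in>S. c i * y i) = t \<and> (\<forall>i\<in>S. y i mod d i = r i)})"
  proof (rule sum.cong[OF refl], rule arg_cong[of _ _ card])
    fix r assume "r \<in> ?R"
    then show "{y\<in>?X. (\<lambda>i\<in>S. y i mod d i) = r}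
        = {y \<in> S \<rightarrow>\<^sub>E (UNIV :: nat set). int (\<Sum>i\<in>S. c i * y i) = t \<and> (\<forall>i\<in>S. y i mod d i = r i)}"
      by (auto simp: PiE_iff extensional_def fun_eq_iff)
  qed
  finally have "real (partition_count S c t) = (\<Sum>r\<in>?R. real (card {y \<in> S \<rightarrow>\<^sub>E (UNIV :: nat set). int (\<Sum>i\<in>S. c i * y i) = t \<and> (\<forall>i\<in>S. y i mod d i = r i)}))"
    by (simp add: partition_count_def of_nat_sum)
  also have "\<dots> = partition_quasi S c t"
    unfolding partition_quasi_def
  proof (rule sum.cong[OF refl], rule card_partitions_residue)
    fix r assume r: "r \<in> ?R"
    have "(\<Sum>i\<in>S. c i * r i) \<le> (\<Sum>i\<in>S. N)"
    proof (rule sum_mono)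
      fix i assume "i \<in> S"
      then have "c i * r i \<le> c i * d i" using r by (intro mult_left_mono) (auto simp: PiE_iff less_imp_le)
      then show "c i * r i \<le> N" using marks_mult[OF \<open>i \<in> S\<close>] by simp
    qed
    then have "(\<Sum>i\<in>S. c i * r i) \<le> card S * N" by simp
    then show "t \<ge> int (\<Sum>i\<in>S. c i * r i)"
      by (rule order_trans[OF iffD2[OF of_nat_le_iff] assms])
  qed auto
  finally show ?thesis .
qed

text \<open>Ehrhart reciprocity, termwise. The complement of a residue vector, r i replaced by N / c
  i - 1 - r i, changes its weight s into card S * N - sum c - s. Together with t to -t - sum c this
  sends the quotient x to -x - (l + 1), with l = card S - 1, and the polynomial (x + l choose l)
  then changes by (-1)^l.\<close>

lemma partition_quasi_reciprocity:
  "partition_quasi S c (- u - int (sum c S)) = (-1) ^ (card S - 1) * partition_quasi S c u"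
proof -
  let ?R = "\<Pi>\<^sub>E i\<in>S. {..<d i}"
  let ?s = "\<lambda>r. int (\<Sum>i\<in>S. c i * r i)"
  let ?l = "card S - 1"
  define flip where "flip r = (\<lambda>i\<in>S. d i - 1 - r i)" for r
  have Npos: "N > 0" using pos by (simp add: prod_pos)
  have cS: "card S > 0" using fin ne by (simp add: card_gt_0_iff)
  have flipR: "flip r \<in> ?R" if "r \<in> ?R" for r
    using that marks_div_pos by (auto simp: flip_def less_imp_diff_less)
  have flip2: "flip (flip r) = r" if "r \<in> ?R" for r
  proof
    fix i
    show "flip (flip r) i = r i"
    proof (cases "i \<in> S")
      case True
      then have "r i < d i" using that by auto
      then show ?thesis using True by (simp add: flip_def)
    qed (use that in \<open>auto simp: flip_def PiE_iff extensional_def\<close>)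
  qed
  have s_flip: "?s (flip r) = int (card S) * int N - int (sum c S) - ?s r" if "r \<in> ?R" for r
  proof -
    have "?s (flip r) + int (sum c S) + ?s r = (\<Sum>i\<in>S. int (c i) * int (flip r i) + int (c i) + int (c i) * int (r i))"
      by (simp add: sum.distrib of_nat_sum)
    also have "\<dots> = (\<Sum>i\<in>S. int N)"
    proof (rule sum.cong)
      fix i assume i: "i \<in> S"
      then have "r i < d i" using that by auto
      then have fl: "int (flip r i) + 1 + int (r i) = int (d i)" using i by (simp add: flip_def)
      have "int (c i) * int (flip r i) + int (c i) + int (c i) * int (r i) = int (c i) * int (d i)"
        unfolding fl[symmetric] by (simp add: distrib_left)
      also have "\<dots> = int N" by (metis marks_mult[OF i] of_nat_mult)
      finally show "int (c i) * int (flip r i) + int (c i) + int (c i) * int (r i) = int N" .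
    qed simp
    finally show ?thesis by simp
  qed
  define G where "G t = (if int N dvd t then ((of_int t :: real) / of_nat N + of_nat ?l) gchoose ?l else 0)" for t
  have G: "G (- t - int (card S) * int N) = (-1) ^ ?l * G t" for t
  proof (cases "int N dvd t")
    case True
    obtain L where L: "?l = L" "card S = Suc L" using cS by (cases "card S") auto
    obtain M :: real where M: "M = of_nat N" "M > 0" using Npos by simp
    have e: "(of_int (- t - int (card S) * int N) :: real) = - of_int t - (of_nat L + 1) * M"
      unfolding M(1) L(2) by simp
    have "(of_int (- t - int (card S) * int N) :: real) / of_nat N + of_nat ?l = - (of_int t / of_nat N + 1)"
      unfolding e L(1) M(1)[symmetric] using M(2) by (simp add: field_simps)
    then have "G (- t - int (card S) * int N) = (- (of_int t / of_nat N + 1)) gchoose ?l"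
      using True by (simp add: G_def dvd_diff)
    also have "\<dots> = (-1) ^ ?l * ((of_int t / of_nat N + of_nat ?l) gchoose ?l)"
      by (subst gbinomial_minus) (simp add: algebra_simps)
    finally show ?thesis using True by (simp add: G_def)
  next
    case False
    then have "\<not> int N dvd - t - int (card S) * int N"
      using dvd_add[of "int N" "- t - int (card S) * int N" "int (card S) * int N"] by auto
    then show ?thesis using False by (simp add: G_def)
  qed
  have "partition_quasi S c (- u - int (sum c S)) = (\<Sum>r\<in>?R. G (- u - int (sum c S) - ?s r))"
    by (simp add: partition_quasi_def G_def)
  also have "\<dots> = (\<Sum>r\<in>?R. G (- u - int (sum c S) - ?s (flip r)))"
    by (rule sum.reindex_bij_witness[of _ flip flip]) (auto simp: flip2 flipR)
  also have "\<dots> = (\<Sum>r\<in>?R. (-1) ^ ?l * G (u - ?s r))"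
  proof (rule sum.cong[OF refl])
    fix r assume "r \<in> ?R"
    then have "- u - int (sum c S) - ?s (flip r) = - (u - ?s r) - int (card S) * int N"
      using s_flip[of r] by linarith
    then show "G (- u - int (sum c S) - ?s (flip r)) = (-1) ^ ?l * G (u - ?s r)" by (simp only: G)
  qed
  also have "\<dots> = (-1) ^ ?l * partition_quasi S c u"
    by (simp add: partition_quasi_def G_def sum_distrib_left)
  finally show ?thesis .
qed

end

section \<open>Alcoves\<close>

context based_root_system
begin

abbreviation "P \<equiv> coweight_lattice \<Delta>"

lemma coweight_root_int:
  assumes "x \<in> P" "\<beta> \<in> \<Phi>" shows "\<beta> \<bullet> x \<in> \<int>"
  unfolding inner_expansion[of \<beta> x]
  using assms fw_int by (intro Ints_sum Ints_mult) (auto simp: coweight_lattice_def)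

lemma coweightI: "(\<And>\<alpha>. \<alpha> \<in> \<Delta> \<Longrightarrow> \<alpha> \<bullet> x \<in> \<int>) \<Longrightarrow> x \<in> P"
  by (simp add: coweight_lattice_def)

lemma coweight_add: "x \<in> P \<Longrightarrow> y \<in> P \<Longrightarrow> x + y \<in> P"
  and coweight_diff: "x \<in> P \<Longrightarrow> y \<in> P \<Longrightarrow> x - y \<in> P"
  and coweight_minus: "x \<in> P \<Longrightarrow> - x \<in> P"
  and coweight_zero: "0 \<in> P"
  and coweight_scale: "x \<in> P \<Longrightarrow> real k *\<^sub>R x \<in> P"
  by (auto simp: coweight_lattice_def inner_add_right inner_diff_right)

definition automorphisms :: "('a \<Rightarrow> 'a) set" where
  "automorphisms = {g. orthogonal_transformation g \<and> g ` \<Phi> = \<Phi>}"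

context
  fixes g assumes g: "g \<in> automorphisms"
begin

lemma automorphism_orthogonal: "orthogonal_transformation g"
  and automorphism_image: "g ` \<Phi> = \<Phi>"
  using g by (simp_all add: automorphisms_def)

lemma automorphism_linear: "linear g"
  using automorphism_orthogonal by (rule orthogonal_transformation_linear)

lemma automorphism_inner: "g x \<bullet> g y = x \<bullet> y"
  using automorphism_orthogonal by (simp add: orthogonal_transformation_def)

lemma automorphism_bij: "bij g"
  using automorphism_orthogonal by (rule orthogonal_transformation_bij)

lemma automorphism_inv: "inv g \<in> automorphisms"
proof -
  have "inv g ` \<Phi> = inv g ` (g ` \<Phi>)" by (simp only: automorphism_image)
  also have "\<dots> = \<Phi>" by (rule image_inv_f_f[OF bij_is_inj[OF automorphism_bij]])
  finally show ?thesis
    using orthogonal_transformation_inv[OF automorphism_orthogonal] by (simp add: automorphisms_def)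
qed

lemma automorphism_inv_cancel: "g (inv g x) = x" "inv g (g x) = x"
  using automorphism_bij by (simp_all add: bij_is_inj bij_is_surj surj_f_inv_f)

lemma automorphism_inv_inner: "\<beta> \<bullet> g x = inv g \<beta> \<bullet> x"
  by (metis automorphism_inner automorphism_inv_cancel(1))

lemma automorphism_root: "\<beta> \<in> \<Phi> \<Longrightarrow> g \<beta> \<in> \<Phi>"
  using automorphism_image by blast

end

lemma automorphism_coweight:
  assumes "g \<in> automorphisms" "x \<in> P" shows "g x \<in> P"
proof (rule coweightI)
  fix \<alpha> assume "\<alpha> \<in> \<Delta>"
  then have "inv g \<alpha> \<in> \<Phi>" using automorphism_root[OF automorphism_inv[OF assms(1)]] by blast
  then show "\<alpha> \<bullet> g x \<in> \<int>"
    using coweight_root_int assms by (simp add: automorphism_inv_inner)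
qed

lemma automorphism_comp: "g \<in> automorphisms \<Longrightarrow> k \<in> automorphisms \<Longrightarrow> g \<circ> k \<in> automorphisms"
  unfolding automorphisms_def mem_Collect_eq image_comp[symmetric]
  by (simp only: orthogonal_transformation_compose)

lemma automorphism_id: "id \<in> automorphisms"
  by (simp add: automorphisms_def id_def)

lemma automorphism_reflection: "\<alpha> \<in> \<Phi> \<Longrightarrow> root_reflection \<alpha> \<in> automorphisms"
  by (simp add: automorphisms_def orthogonal_root_reflection reflection_image)

lemma automorphism_uminus: "g \<in> automorphisms \<Longrightarrow> (\<lambda>x. - g x) \<in> automorphisms"
  unfolding automorphisms_def
proof (clarify, intro conjI)
  assume g: "orthogonal_transformation g" "g ` \<Phi> = \<Phi>"
  have "(\<lambda>x. - g x) ` \<Phi> = uminus ` g ` \<Phi>" by (simp add: image_image)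
  also have "\<dots> = \<Phi>" unfolding g(2) by (auto simp: image_iff) (metis minus_minus uminus_root_iff)
  finally show "(\<lambda>x. - g x) ` \<Phi> = \<Phi>" .
qed (simp add: orthogonal_transformation_neg)

lemma finite_automorphisms: "finite automorphisms"
proof (rule finite_imageD)
  show "finite ((\<lambda>g. restrict g \<Phi>) ` automorphisms)"
    by (rule finite_subset[of _ "\<Phi> \<rightarrow>\<^sub>E \<Phi>"]) (auto simp: automorphisms_def finite_PiE)
  show "inj_on (\<lambda>g. restrict g \<Phi>) automorphisms"
  proof (rule inj_onI)
    fix g k assume gk: "g \<in> automorphisms" "k \<in> automorphisms" "restrict g \<Phi> = restrict k \<Phi>"
    have "g \<alpha> = k \<alpha>" if "\<alpha> \<in> \<Delta>" for \<alpha> using gk(3) simple_root[OF that] by (metis restrict_apply')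
    then have "g x = k x" for x
      using linear_eq_on[of g k x \<Delta>] gk automorphism_linear span_simple by auto
    then show "g = k" by blast
  qed
qed

section \<open>The fundamental alcove and its stabilizer\<close>

definition alcove :: "'a set" where
  "alcove = {v. (\<forall>\<alpha>\<in>\<Delta>. 0 < \<alpha> \<bullet> v) \<and> theta \<bullet> v < 1}"

lemma alcove_pos_root:
  assumes "v \<in> alcove" "\<beta> \<in> \<Phi>\<^sub>p" shows "0 < \<beta> \<bullet> v" "\<beta> \<bullet> v < 1"
proof -
  obtain \<alpha> where a: "\<alpha> \<in> \<Delta>" "fw \<alpha> \<bullet> \<beta> > 0" using pos_ex assms by blast
  show "0 < \<beta> \<bullet> v"
    unfolding inner_expansion[of \<beta> v] using a assms pos_fw
    by (intro sum_pos2[of _ \<alpha>]) (auto simp: alcove_def less_imp_le)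
  have "\<beta> \<bullet> v \<le> theta \<bullet> v"
    unfolding inner_expansion[of \<beta> v] inner_expansion[of theta v]
    using assms theta_highest pos_root
    by (intro sum_mono mult_right_mono) (auto simp: alcove_def less_imp_le)
  then show "\<beta> \<bullet> v < 1" using assms by (simp add: alcove_def)
qed

text \<open>With h = ht(\<theta>) + 1 this point has value 1/h on every simple root and (h - 1)/h on
  \<theta>. It serves as a concrete interior point.\<close>

lemma alcove_center: "(1 / (rho \<bullet> theta + 1)) *\<^sub>R rho \<in> alcove"
proof -
  have "rho \<bullet> theta \<ge> 1" by (rule rho_pos) simp
  then show ?thesis
    by (auto simp: alcove_def inner_commute[of _ rho] field_simps)
qed

lemma open_unit_interval_int:
  fixes x y :: real
  assumes "j \<in> \<int>" "i \<in> \<int>" "0 < x + j" "x + j < 1" "0 < x + i" "x + i < 1"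
  shows "i = j"
proof -
  obtain a b where "j = of_int a" "i = of_int b" using assms by (auto elim!: Ints_cases)
  moreover have "\<bar>i - j\<bar> < 1" using assms by linarith
  ultimately show ?thesis by simp
qed

text \<open>A single point decides where the alcove goes: automorphisms and coweight translations
  preserve the hyperplanes of integral level. Concretely, the shift contributed by r to the
  transported root \<gamma> must be 0 or 1, according to the sign of \<gamma>, and so does not
  depend on the point.\<close>

lemma alcove_transport:
  assumes k: "k \<in> automorphisms" and r: "r \<in> P"
    and u: "u \<in> alcove" "k (u + r) \<in> alcove" and v: "v \<in> alcove"
  shows "k (v + r) \<in> alcove"
proof -
  have *: "0 < \<beta> \<bullet> k (v + r) \<and> \<beta> \<bullet> k (v + r) < 1" if b: "\<beta> \<in> \<Phi>\<^sub>p" for \<beta>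
  proof -
    define \<gamma> where "\<gamma> = inv k \<beta>"
    have g: "\<gamma> \<in> \<Phi>" unfolding \<gamma>_def using automorphism_root[OF automorphism_inv[OF k]] b pos_root by blast
    have e: "\<beta> \<bullet> k (w + r) = \<gamma> \<bullet> w + \<gamma> \<bullet> r" for w
      by (simp add: automorphism_inv_inner[OF k] \<gamma>_def inner_add_right)
    obtain j where j: "\<gamma> \<bullet> r = of_int j" using coweight_root_int[OF r g] by (auto elim: Ints_cases)
    have bu: "0 < \<gamma> \<bullet> u + of_int j" "\<gamma> \<bullet> u + of_int j < 1"
      using alcove_pos_root[OF u(2) b] by (simp_all add: e j)
    consider "\<gamma> \<in> \<Phi>\<^sub>p" | "- \<gamma> \<in> \<Phi>\<^sub>p" using pos_or_neg g by blast
    then show ?thesis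
    proof cases
      case 1
      then have "0 < \<gamma> \<bullet> u" "\<gamma> \<bullet> u < 1" "0 < \<gamma> \<bullet> v" "\<gamma> \<bullet> v < 1"
        using alcove_pos_root u v by blast+
      moreover from this bu have "j = 0" by linarith
      ultimately show ?thesis by (simp add: e j)
    next
      case 2
      then have "\<gamma> \<bullet> u < 0" "\<gamma> \<bullet> u > - 1" "\<gamma> \<bullet> v < 0" "\<gamma> \<bullet> v > -1"
        using alcove_pos_root[OF u(1) 2] alcove_pos_root[OF v 2] by simp_all
      moreover from this bu have "j = 1" by linarith
      ultimately show ?thesis by (simp add: e j)
    qed
  qed
  then show ?thesis by (auto simp: alcove_def)
qed

text \<open>The pair (k, r) stands for the affine map v to k (v + r), translation first. These maps
  may permute the walls of the alcove, so the stabilizer is in general nontrivial; its order is the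
  constant f of the overview.\<close>

definition alcove_stabilizer :: "(('a \<Rightarrow> 'a) \<times> 'a) set" where
  "alcove_stabilizer = {(k, r). k \<in> automorphisms \<and> r \<in> P \<and> (\<forall>v\<in>alcove. k (v + r) \<in> alcove)}"

lemma finite_alcove_stabilizer: "finite alcove_stabilizer"
proof (rule finite_imageD)
  show "finite (fst ` alcove_stabilizer)"
    by (rule finite_subset[OF _ finite_automorphisms]) (auto simp: alcove_stabilizer_def)
  show "inj_on fst alcove_stabilizer"
  proof (rule inj_onI)
    fix s t assume st: "s \<in> alcove_stabilizer" "t \<in> alcove_stabilizer" "fst s = fst t"
    obtain k r where s: "s = (k, r)" by fastforce
    then obtain r' where t: "t = (k, r')" using st(3) by (metis fst_conv surj_pair)
    have k: "k \<in> automorphisms" and rr: "r \<in> P" "r' \<in> P"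
      using st by (auto simp: s t alcove_stabilizer_def)
    let ?v = "(1 / (rho \<bullet> theta + 1)) *\<^sub>R rho"
    have kv: "k (?v + r) \<in> alcove" "k (?v + r') \<in> alcove"
      using st alcove_center by (auto simp: s t alcove_stabilizer_def)
    have "\<alpha> \<bullet> r = \<alpha> \<bullet> r'" if a: "\<alpha> \<in> \<Delta>" for \<alpha>
    proof -
      have e: "k \<alpha> \<bullet> k (?v + w) = \<alpha> \<bullet> ?v + \<alpha> \<bullet> w" for w
        unfolding automorphism_inner[OF k] by (rule inner_add_right)
      have i: "\<alpha> \<bullet> r \<in> \<int>" "\<alpha> \<bullet> r' \<in> \<int>" using coweight_root_int rr a by auto
      have "k \<alpha> \<in> \<Phi>" using automorphism_root[OF k] a by blast
      then consider "k \<alpha> \<in> \<Phi>\<^sub>p" | "- k \<alpha> \<in> \<Phi>\<^sub>p" using pos_or_neg by blast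
      then show ?thesis
      proof cases
        case 1
        show ?thesis
          by (rule open_unit_interval_int[OF i(2,1)])
            (use alcove_pos_root[OF kv(1) 1] alcove_pos_root[OF kv(2) 1] in \<open>simp_all only: e\<close>)
      next
        case 2
        have "- (\<alpha> \<bullet> r) = - (\<alpha> \<bullet> r')"
          by (rule open_unit_interval_int[of _ _ "- (\<alpha> \<bullet> ?v)"])
            (use alcove_pos_root[OF kv(1) 2] alcove_pos_root[OF kv(2) 2] i in
              \<open>simp_all only: e inner_minus_left minus_add_distrib Ints_minus\<close>)
        then show ?thesis by simp
      qed
    qed
    then have "r = r'" by (rule eqI_simple)
    then show "s = t" by (simp add: s t)
  qed
qed

lemma card_alcove_stabilizer_pos: "card alcove_stabilizer > 0"
proof -
  have "(id, 0) \<in> alcove_stabilizer"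
    by (simp add: alcove_stabilizer_def automorphism_id coweight_zero)
  then show ?thesis using finite_alcove_stabilizer card_gt_0_iff by blast
qed

definition alcove_positions :: "'a \<Rightarrow> (('a \<Rightarrow> 'a) \<times> 'a) set" where
  "alcove_positions y = {(g, p). g \<in> automorphisms \<and> p \<in> P \<and> g (y + p) \<in> alcove}"

text \<open>The affine maps taking y into the alcove form a coset of the stabilizer: fix one such
  map and compose the others with its inverse. \<open>alcove_transport\<close> shows that the
  quotient of two of them preserves the whole alcove.\<close>

lemma card_alcove_positions:
  assumes "alcove_positions y \<noteq> {}"
  shows "card (alcove_positions y) = card alcove_stabilizer"
proof -
  obtain g0 p0 where g0: "g0 \<in> automorphisms" and p0: "p0 \<in> P" and u: "g0 (y + p0) \<in> alcove"
    using assms by (auto simp: alcove_positions_def)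
  define u where "u = g0 (y + p0)"
  note lin = linear_add[OF automorphism_linear[OF g0]] linear_diff[OF automorphism_linear[OF g0]]
  note cancel = automorphism_inv_cancel[OF g0]
  have "bij_betw (\<lambda>(g, p). (g \<circ> inv g0, g0 (p - p0))) (alcove_positions y) alcove_stabilizer"
  proof (rule bij_betw_byWitness[where f' = "\<lambda>(k, r). (k \<circ> g0, p0 + inv g0 r)"])
    show "\<forall>a\<in>alcove_positions y. (\<lambda>(k, r). (k \<circ> g0, p0 + inv g0 r)) ((\<lambda>(g, p). (g \<circ> inv g0, g0 (p - p0))) a) = a"
      by (auto simp: fun_eq_iff cancel)
    show "\<forall>a\<in>alcove_stabilizer. (\<lambda>(g, p). (g \<circ> inv g0, g0 (p - p0))) ((\<lambda>(k, r). (k \<circ> g0, p0 + inv g0 r)) a) = a"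
      by (auto simp: fun_eq_iff cancel)
    show "(\<lambda>(g, p). (g \<circ> inv g0, g0 (p - p0))) ` alcove_positions y \<subseteq> alcove_stabilizer"
    proof (rule image_subsetI)
      fix a assume a: "a \<in> alcove_positions y"
      then obtain g p where gp: "a = (g, p)" "g \<in> automorphisms" "p \<in> P" "g (y + p) \<in> alcove"
        by (auto simp: alcove_positions_def)
      have k: "g \<circ> inv g0 \<in> automorphisms"
        by (intro automorphism_comp gp automorphism_inv g0)
      have r: "g0 (p - p0) \<in> P" by (rule automorphism_coweight[OF g0 coweight_diff[OF gp(3) p0]])
      have "u + g0 (p - p0) = g0 (y + p)" by (simp add: u_def lin)
      then have "(g \<circ> inv g0) (u + g0 (p - p0)) \<in> alcove" using gp by (simp add: cancel)
      then have "(g \<circ> inv g0, g0 (p - p0)) \<in> alcove_stabilizer"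
        unfolding alcove_stabilizer_def
        using alcove_transport[OF k r u[folded u_def]] k r by blast
      then show "(\<lambda>(g, p). (g \<circ> inv g0, g0 (p - p0))) a \<in> alcove_stabilizer" by (simp add: gp)
    qed
    show "(\<lambda>(k, r). (k \<circ> g0, p0 + inv g0 r)) ` alcove_stabilizer \<subseteq> alcove_positions y"
    proof (rule image_subsetI)
      fix a assume "a \<in> alcove_stabilizer"
      then obtain k r where kr: "a = (k, r)" "k \<in> automorphisms" "r \<in> P" "\<And>v. v \<in> alcove \<Longrightarrow> k (v + r) \<in> alcove"
        by (auto simp: alcove_stabilizer_def)
      have "k \<circ> g0 \<in> automorphisms" by (intro automorphism_comp kr g0)
      moreover have "p0 + inv g0 r \<in> P"
        by (rule coweight_add[OF p0 automorphism_coweight[OF automorphism_inv[OF g0] kr(3)]])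
      moreover have "(k \<circ> g0) (y + (p0 + inv g0 r)) \<in> alcove"
        using kr(4)[OF u] by (simp add: lin cancel add.assoc)
      ultimately show "(\<lambda>(k, r). (k \<circ> g0, p0 + inv g0 r)) a \<in> alcove_positions y"
        by (simp add: kr alcove_positions_def)
    qed
  qed
  then show ?thesis by (rule bij_betw_same_card)
qed

lemma finite_coweight_ball: "finite {p \<in> P. norm p \<le> R}"
proof (rule finite_imageD)
  define M where "M = \<lceil>(\<Sum>\<alpha>\<in>\<Delta>. norm \<alpha>) * \<bar>R\<bar>\<rceil>"
  have b: "\<bar>\<lfloor>\<alpha> \<bullet> p\<rfloor>\<bar> \<le> M" if "\<alpha> \<in> \<Delta>" "p \<in> P" "norm p \<le> R" for \<alpha> p
  proof -
    obtain j where j: "\<alpha> \<bullet> p = of_int j" using coweight_root_int[of p \<alpha>] \<open>p \<in> P\<close> simple_root[OF \<open>\<alpha> \<in> \<Delta>\<close>] by (auto elim: Ints_cases)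
    have "\<bar>\<alpha> \<bullet> p\<bar> \<le> norm \<alpha> * norm p" by (rule Cauchy_Schwarz_ineq2)
    also have "\<dots> \<le> (\<Sum>\<alpha>\<in>\<Delta>. norm \<alpha>) * \<bar>R\<bar>"
      using that by (intro mult_mono member_le_sum) (auto intro: sum_nonneg)
    finally have "of_int \<bar>j\<bar> \<le> (\<Sum>\<alpha>\<in>\<Delta>. norm \<alpha>) * \<bar>R\<bar>" by (simp add: j)
    then have "\<bar>j\<bar> \<le> M" unfolding M_def by linarith
    then show ?thesis by (simp add: j)
  qed
  show "finite ((\<lambda>p. \<lambda>\<alpha>\<in>\<Delta>. \<lfloor>\<alpha> \<bullet> p\<rfloor>) ` {p \<in> P. norm p \<le> R})"
  proof (rule finite_subset)
    show "(\<lambda>p. \<lambda>\<alpha>\<in>\<Delta>. \<lfloor>\<alpha> \<bullet> p\<rfloor>) ` {p \<in> P. norm p \<le> R} \<subseteq> \<Delta> \<rightarrow>\<^sub>E {-M..M}"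
      using b by (fastforce simp: abs_le_iff)
  qed (simp add: finite_PiE)
  show "inj_on (\<lambda>p. \<lambda>\<alpha>\<in>\<Delta>. \<lfloor>\<alpha> \<bullet> p\<rfloor>) {p \<in> P. norm p \<le> R}"
  proof (rule inj_onI, rule eqI_simple)
    fix p p' \<alpha> assume p: "p \<in> {p \<in> P. norm p \<le> R}" "p' \<in> {p \<in> P. norm p \<le> R}"
      and eq: "(\<lambda>\<alpha>\<in>\<Delta>. \<lfloor>\<alpha> \<bullet> p\<rfloor>) = (\<lambda>\<alpha>\<in>\<Delta>. \<lfloor>\<alpha> \<bullet> p'\<rfloor>)" and a: "\<alpha> \<in> \<Delta>"
    have "\<lfloor>\<alpha> \<bullet> p\<rfloor> = \<lfloor>\<alpha> \<bullet> p'\<rfloor>" using fun_cong[OF eq, of \<alpha>] a by simp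
    moreover have "\<alpha> \<bullet> p \<in> \<int>" "\<alpha> \<bullet> p' \<in> \<int>" using p a by (auto simp: coweight_lattice_def)
    ultimately show "\<alpha> \<bullet> p = \<alpha> \<bullet> p'" by (auto elim!: Ints_cases)
  qed
qed

text \<open>Makes the reflection in the wall \<theta> = 1 available: its translation part is the
  coroot of \<theta>.\<close>

lemma coroot_theta_coweight: "coroot theta \<in> P"
proof (rule coweightI)
  fix \<alpha> assume "\<alpha> \<in> \<Delta>"
  then have "2 * (theta \<bullet> \<alpha>) / (theta \<bullet> theta) \<in> \<int>" by (intro crystallographic) auto
  then show "\<alpha> \<bullet> coroot theta \<in> \<int>" by (simp add: coroot_def inner_commute)
qed

text \<open>Among all images of \<open>y\<close> under the extended affine group, one closest to a point of the
  alcove lies in the alcove: otherwise a reflection in a separating wall brings it closer.\<close>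

lemma alcove_positions_nonempty:
  assumes generic: "\<And>\<beta>. \<beta> \<in> \<Phi> \<Longrightarrow> \<beta> \<bullet> y \<notin> \<int>"
  shows "alcove_positions y \<noteq> {}"
proof -
  define a where "a = (1 / (rho \<bullet> theta + 1)) *\<^sub>R rho"
  have a: "a \<in> alcove" unfolding a_def by (rule alcove_center)
  define f where "f = (\<lambda>(g, p). norm (g (y + p) - a))"
  \<comment> \<open>Only images at least as close to a as y itself can be closest, and these are
    finitely many; the identity belongs to them.\<close>
  define F where "F = {s \<in> automorphisms \<times> P. f s \<le> norm (y - a)}"
  have "F \<subseteq> automorphisms \<times> {p \<in> P. norm p \<le> norm (y - a) + norm a + norm y}"
  proof
    fix s assume "s \<in> F"
    then obtain g p where s: "s = (g, p)" "g \<in> automorphisms" "p \<in> P" "norm (g (y + p) - a) \<le> norm (y - a)"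
      by (auto simp: F_def f_def)
    have "norm p \<le> norm (y + p) + norm y" by (metis add_diff_cancel_left' norm_triangle_ineq4)
    also have "norm (y + p) = norm (g (y + p))"
      using s(2) by (simp add: orthogonal_transformation_norm[OF automorphism_orthogonal])
    also have "\<dots> \<le> norm (g (y + p) - a) + norm a" by (metis diff_add_cancel norm_triangle_ineq)
    finally show "s \<in> automorphisms \<times> {p \<in> P. norm p \<le> norm (y - a) + norm a + norm y}" using s by auto
  qed
  then have "finite F"
    by (rule finite_subset) (intro finite_cartesian_product finite_automorphisms finite_coweight_ball)
  moreover have idF: "(id, 0) \<in> F" by (simp add: F_def f_def automorphism_id coweight_zero)
  ultimately obtain s where sF: "s \<in> F" and mn: "\<And>t. t \<in> F \<Longrightarrow> f s \<le> f t"
    by (metis arg_min_if_finite(1) arg_min_least empty_iff)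
  obtain g p where s: "s = (g, p)" "g \<in> automorphisms" "p \<in> P" using sF by (auto simp: F_def)
  have closest: "norm (g (y + p) - a) \<le> norm (k (y + r) - a)" if "k \<in> automorphisms" "r \<in> P" for k r
  proof (cases "(k, r) \<in> F")
    case True
    then show ?thesis using mn[OF True] by (simp add: s f_def)
  next
    case False
    then have "f (k, r) > norm (y - a)" using that by (auto simp: F_def)
    moreover have "f s \<le> norm (y - a)" using sF by (simp add: F_def)
    ultimately show ?thesis by (simp add: s f_def)
  qed
  define v where "v = g (y + p)"
  have gen: "\<beta> \<bullet> v \<notin> \<int>" if "\<beta> \<in> \<Phi>" for \<beta>
  proof
    assume v: "\<beta> \<bullet> v \<in> \<int>"
    have r: "inv g \<beta> \<in> \<Phi>" using automorphism_root[OF automorphism_inv[OF s(2)] that] .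
    have "\<beta> \<bullet> v = inv g \<beta> \<bullet> y + inv g \<beta> \<bullet> p"
      by (simp add: v_def automorphism_inv_inner[OF s(2)] inner_add_right)
    then have "inv g \<beta> \<bullet> y = \<beta> \<bullet> v - inv g \<beta> \<bullet> p" by simp
    then show False using v coweight_root_int[OF s(3) r] generic[OF r] by (metis Ints_diff)
  qed
  have "v \<in> alcove"
    unfolding alcove_def
  proof (intro CollectI conjI ballI; rule ccontr)
    fix \<alpha> assume al: "\<alpha> \<in> \<Delta>" "\<not> 0 < \<alpha> \<bullet> v"
    then have neg: "\<alpha> \<bullet> v < 0" using gen[of \<alpha>] by (metis Ints_0 linorder_neqE_linordered_idom simple_root)
    have apos: "\<alpha> \<bullet> a > 0" using a al by (auto simp: alcove_def)
    have "(root_reflection \<alpha> \<circ> g) (y + p) = root_reflection \<alpha> v" by (simp add: v_def)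
    then have "norm (v - a) \<le> norm (root_reflection \<alpha> v - a)"
      using closest[OF automorphism_comp[OF automorphism_reflection[of \<alpha>] s(2)] s(3)] al
      by (simp add: v_def)
    then have "(v - a) \<bullet> (v - a) \<le> (root_reflection \<alpha> v - a) \<bullet> (root_reflection \<alpha> v - a)"
      by (simp add: norm_le)
    moreover have "(w - a) \<bullet> (w - a) = w \<bullet> w - 2 * (w \<bullet> a) + a \<bullet> a" for w
      by (simp add: inner_diff_left inner_diff_right inner_commute)
    ultimately have "root_reflection \<alpha> v \<bullet> a \<le> v \<bullet> a" by simp
    then have "2 * (\<alpha> \<bullet> v) * (\<alpha> \<bullet> a) / (\<alpha> \<bullet> \<alpha>) \<ge> 0" by (simp add: root_reflection_inner)
    moreover have "2 * (\<alpha> \<bullet> v) * (\<alpha> \<bullet> a) < 0" by (rule mult_neg_pos) (use neg apos in simp_all)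
    then have "2 * (\<alpha> \<bullet> v) * (\<alpha> \<bullet> a) / (\<alpha> \<bullet> \<alpha>) < 0"
      by (rule divide_neg_pos) (use root_inner_pos al in blast)
    ultimately show False by simp
  next
    assume th: "\<not> theta \<bullet> v < 1"
    define t where "t = theta \<bullet> v - 1"
    have "theta \<bullet> v \<noteq> 1" using gen[OF theta_root] by (metis Ints_1)
    then have t: "t > 0" using th by (simp add: t_def)
    have tt: "theta \<bullet> theta > 0" using root_inner_pos by simp
    define k where "k = root_reflection theta \<circ> g"
    have k: "k \<in> automorphisms" unfolding k_def
      by (rule automorphism_comp[OF automorphism_reflection[OF theta_root] s(2)])
    \<comment> \<open>Translations act before k, so the coroot of \<theta> is pulled back by k; the
      composite moves v to its mirror image in \<theta> = 1, where t is the excess of v beyond that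
      wall.\<close>
    define r where "r = p + inv k (coroot theta)"
    have r: "r \<in> P" unfolding r_def
      by (rule coweight_add[OF s(3) automorphism_coweight[OF automorphism_inv[OF k] coroot_theta_coweight]])
    have "k (y + r) = k (y + p) + coroot theta"
      by (simp add: r_def linear_add[OF automorphism_linear[OF k]] automorphism_inv_cancel[OF k] flip: add.assoc)
    also have "\<dots> = v - t *\<^sub>R coroot theta"
    proof -
      have "root_reflection theta v = v - (theta \<bullet> v) *\<^sub>R coroot theta"
        by (simp add: root_reflection_def coroot_def mult.commute)
      then show ?thesis by (simp add: k_def t_def scaleR_diff_left flip: v_def)
    qed
    finally have kv: "k (y + r) - a = (v - a) - t *\<^sub>R coroot theta" by simp
    have "norm (v - a) \<le> norm ((v - a) - t *\<^sub>R coroot theta)"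
      using closest[OF k r] by (simp only: kv v_def)
    then have "(v - a) \<bullet> (v - a) \<le> ((v - a) - t *\<^sub>R coroot theta) \<bullet> ((v - a) - t *\<^sub>R coroot theta)"
      by (simp add: norm_le)
    also have "\<dots> = (v - a) \<bullet> (v - a) - 2 * t * (coroot theta \<bullet> (v - a)) + t * t * (coroot theta \<bullet> coroot theta)"
    proof -
      have "(w - t *\<^sub>R c) \<bullet> (w - t *\<^sub>R c) = w \<bullet> w - 2 * t * (c \<bullet> w) + t * t * (c \<bullet> c)" for w c :: 'a
        by (simp add: inner_diff_left inner_diff_right inner_commute algebra_simps)
      then show ?thesis .
    qed
    also have "\<dots> = (v - a) \<bullet> (v - a) + (4 * t / (theta \<bullet> theta)) * (theta \<bullet> a - 1)"
    proof -
      have "theta \<bullet> v = t + 1" by (simp add: t_def)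
      then have e1: "coroot theta \<bullet> (v - a) = 2 / (theta \<bullet> theta) * (t + 1 - theta \<bullet> a)"
        by (simp add: coroot_def inner_diff_right diff_divide_distrib)
      have e2: "coroot theta \<bullet> coroot theta = 4 / (theta \<bullet> theta)"
        using tt by (simp add: coroot_def)
      show ?thesis unfolding e1 e2 using tt by (simp add: field_simps)
    qed
    finally have "0 \<le> (4 * t / (theta \<bullet> theta)) * (theta \<bullet> a - 1)" by simp
    moreover have "(4 * t / (theta \<bullet> theta)) * (theta \<bullet> a - 1) < 0"
      using t tt a by (intro mult_pos_neg) (auto simp: alcove_def)
    ultimately show False by simp
  qed
  then have "(g, p) \<in> alcove_positions y" using s by (simp add: alcove_positions_def v_def)
  then show ?thesis by blast
qed

end

section \<open>Counting by alcoves\<close>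

lemma sum_pos_product_ex:
  fixes f g :: "'a \<Rightarrow> real"
  assumes "(\<Sum>a\<in>A. f a * g a) > 0" "\<And>a. a \<in> A \<Longrightarrow> f a \<ge> 0"
  obtains a where "a \<in> A" "f a > 0" "g a > 0"
proof -
  have "\<exists>a\<in>A. f a * g a > 0"
  proof (rule ccontr)
    assume "\<not> ?thesis"
    then have "(\<Sum>a\<in>A. f a * g a) \<le> 0" by (intro sum_nonpos) (auto simp: not_less)
    then show False using assms(1) by simp
  qed
  then show ?thesis using that assms(2) by (force simp: zero_less_mult_iff)
qed

context based_root_system
begin

definition affine_simple :: "'a set" where "affine_simple = insert (- theta) \<Delta>"

definition mark :: "'a \<Rightarrow> nat" where
  "mark \<alpha> = (if \<alpha> = - theta then 1 else nat \<lfloor>fw \<alpha> \<bullet> theta\<rfloor>)"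

lemma minus_theta_notin: "- theta \<notin> \<Delta>"
  using not_pos_and_neg[OF theta_pos] by auto

lemma finite_affine_simple [simp]: "finite affine_simple"
  and affine_simple_nonempty: "affine_simple \<noteq> {}"
  and card_affine_simple: "card affine_simple = Suc DIM('a)"
  using minus_theta_notin by (simp_all add: affine_simple_def card_simple)

lemma affine_simple_root: "\<alpha> \<in> affine_simple \<Longrightarrow> \<alpha> \<in> \<Phi>"
  by (auto simp: affine_simple_def)

lemma mark_simple:
  assumes "\<alpha> \<in> \<Delta>" shows "real (mark \<alpha>) = fw \<alpha> \<bullet> theta"
proof -
  have "\<alpha> \<noteq> - theta" using assms minus_theta_notin by blast
  moreover obtain j where "fw \<alpha> \<bullet> theta = of_int j" using fw_int[OF theta_root assms] by (auto elim: Ints_cases)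
  ultimately show ?thesis using theta_fw_pos[OF assms] by (simp add: mark_def)
qed

lemma mark_pos: "\<alpha> \<in> affine_simple \<Longrightarrow> mark \<alpha> > 0"
  using mark_simple[of \<alpha>] theta_fw_pos[of \<alpha>]
  by (cases "\<alpha> = - theta") (auto simp: affine_simple_def mark_def[of "- theta"])

lemma sum_affine_simple:
  fixes f :: "'a \<Rightarrow> real"
  shows "(\<Sum>\<alpha>\<in>affine_simple. real (mark \<alpha>) * f \<alpha>) = f (- theta) + (\<Sum>\<alpha>\<in>\<Delta>. (fw \<alpha> \<bullet> theta) * f \<alpha>)"
proof -
  have "(\<Sum>\<alpha>\<in>affine_simple. real (mark \<alpha>) * f \<alpha>)
      = real (mark (- theta)) * f (- theta) + (\<Sum>\<alpha>\<in>\<Delta>. real (mark \<alpha>) * f \<alpha>)"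
    unfolding affine_simple_def using minus_theta_notin by simp
  also have "(\<Sum>\<alpha>\<in>\<Delta>. real (mark \<alpha>) * f \<alpha>) = (\<Sum>\<alpha>\<in>\<Delta>. (fw \<alpha> \<bullet> theta) * f \<alpha>)"
    by (intro sum.cong) (simp_all add: mark_simple)
  finally show ?thesis by (simp add: mark_def[of "- theta"])
qed

lemma sum_mark: "real (sum mark affine_simple) = rho \<bullet> theta + 1"
  using sum_affine_simple[of "\<lambda>_. 1"] by (simp add: rho_inner)

text \<open>The affine simple roots on the q-fold alcove, with constant term q at -\<theta>. The
  levels are non-negative exactly on the closed dilated alcove and, weighted by the marks, add up to
  q.\<close>

definition level :: "nat \<Rightarrow> 'a \<Rightarrow> 'a \<Rightarrow> real" where
  "level q \<alpha> z = \<alpha> \<bullet> z + (if \<alpha> = - theta then real q else 0)"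

lemma level_sum: "(\<Sum>\<alpha>\<in>affine_simple. real (mark \<alpha>) * level q \<alpha> z) = real q"
proof -
  have "(\<Sum>\<alpha>\<in>\<Delta>. (fw \<alpha> \<bullet> theta) * level q \<alpha> z) = theta \<bullet> z"
    unfolding inner_expansion[of theta z]
    using minus_theta_notin by (intro sum.cong) (auto simp: level_def)
  then show ?thesis by (simp add: sum_affine_simple level_def)
qed

lemma level_int: "z \<in> P \<Longrightarrow> \<alpha> \<in> affine_simple \<Longrightarrow> level q \<alpha> z \<in> \<int>"
  using coweight_root_int[of z \<alpha>] affine_simple_root[of \<alpha>] by (simp add: level_def)

text \<open>The walls in D are moved inwards by n. It is used with D the ascents of g, once with
  margin 1 for the perturbed alcove and once with margin n + 1 for the avoided residues.\<close>

definition dilated_simplex :: "nat \<Rightarrow> 'a set \<Rightarrow> nat \<Rightarrow> 'a set" where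
  "dilated_simplex q D n = {z \<in> P. \<forall>\<alpha>\<in>affine_simple. level q \<alpha> z \<ge> (if \<alpha> \<in> D then real n else 0)}"

text \<open>The coordinates are the levels minus the prescribed margins. A coweight is rebuilt from
  its simple levels alone; the weighted sum then forces the correct level at -\<theta>, whose mark
  is 1.\<close>

lemma bij_dilated_simplex:
  assumes D: "D \<subseteq> affine_simple"
  shows "\<exists>f. bij_betw f (dilated_simplex q D n)
    {y \<in> affine_simple \<rightarrow>\<^sub>E (UNIV :: nat set).
      int (\<Sum>\<alpha>\<in>affine_simple. mark \<alpha> * y \<alpha>) = int q - int n * int (sum mark D)}"
proof -
  define s where "s \<alpha> = (if \<alpha> \<in> D then n else 0)" for \<alpha>
  let ?Y = "{y \<in> affine_simple \<rightarrow>\<^sub>E (UNIV :: nat set). int (\<Sum>\<alpha>\<in>affine_simple. mark \<alpha> * y \<alpha>) = int q - int n * int (sum mark D)}"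
  have s_sum: "(\<Sum>\<alpha>\<in>affine_simple. real (mark \<alpha>) * real (s \<alpha>)) = real n * real (sum mark D)"
  proof -
    have "(\<Sum>\<alpha>\<in>affine_simple. real (mark \<alpha>) * real (s \<alpha>)) = (\<Sum>\<alpha>\<in>affine_simple. if \<alpha> \<in> D then real (mark \<alpha>) * real n else 0)"
      by (intro sum.cong) (auto simp: s_def)
    also have "\<dots> = (\<Sum>\<alpha>\<in>D. real (mark \<alpha>) * real n)"
      using D by (simp add: sum.If_cases Int_absorb1)
    finally show ?thesis by (simp add: sum_distrib_left mult.commute)
  qed
  have Y: "y \<in> ?Y \<longleftrightarrow> y \<in> affine_simple \<rightarrow>\<^sub>E UNIV \<and>
      (\<Sum>\<alpha>\<in>affine_simple. real (mark \<alpha>) * (real (y \<alpha>) + real (s \<alpha>))) = real q" for y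
  proof -
    have "int (\<Sum>\<alpha>\<in>affine_simple. mark \<alpha> * y \<alpha>) = int q - int n * int (sum mark D)
        \<longleftrightarrow> real_of_int (int (\<Sum>\<alpha>\<in>affine_simple. mark \<alpha> * y \<alpha>)) = real_of_int (int q - int n * int (sum mark D))"
      by (rule of_int_eq_iff[symmetric])
    also have "\<dots> \<longleftrightarrow> (\<Sum>\<alpha>\<in>affine_simple. real (mark \<alpha>) * real (y \<alpha>)) = real q - real n * real (sum mark D)"
      by simp
    also have "\<dots> \<longleftrightarrow> (\<Sum>\<alpha>\<in>affine_simple. real (mark \<alpha>) * (real (y \<alpha>) + real (s \<alpha>))) = real q"
      unfolding distrib_left sum.distrib s_sum by linarith
    finally show ?thesis by blast
  qed
  define f where "f z = (\<lambda>\<alpha>\<in>affine_simple. nat (\<lfloor>level q \<alpha> z\<rfloor> - int (s \<alpha>)))" for z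
  define b where "b y = (\<Sum>\<alpha>\<in>\<Delta>. (real (y \<alpha>) + real (s \<alpha>)) *\<^sub>R fw \<alpha>)" for y :: "'a \<Rightarrow> nat"
  have f: "real (f z \<alpha>) + real (s \<alpha>) = level q \<alpha> z"
    if z: "z \<in> dilated_simplex q D n" and a: "\<alpha> \<in> affine_simple" for z \<alpha>
  proof -
    have "z \<in> P" using z by (simp add: dilated_simplex_def)
    then obtain j where j: "level q \<alpha> z = of_int j" using level_int[OF _ a] Ints_cases by metis
    have "level q \<alpha> z \<ge> real (s \<alpha>)" using z a by (auto simp: dilated_simplex_def s_def)
    then have "j \<ge> int (s \<alpha>)" unfolding j by linarith
    then show ?thesis using a by (simp add: f_def j)
  qed
  have b: "\<alpha> \<bullet> b y = real (y \<alpha>) + real (s \<alpha>)" if "\<alpha> \<in> \<Delta>" for y \<alpha>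
  proof -
    have "\<alpha> \<bullet> b y = (\<Sum>\<beta>\<in>\<Delta>. if \<beta> = \<alpha> then real (y \<alpha>) + real (s \<alpha>) else 0)"
      unfolding b_def inner_sum_right
      using that by (intro sum.cong) (auto simp: inner_commute[of \<alpha> "fw c" for c] fw_simple)
    then show ?thesis using that by simp
  qed
  have lb: "level q \<alpha> (b y) = real (y \<alpha>) + real (s \<alpha>)" if y: "y \<in> ?Y" and a: "\<alpha> \<in> affine_simple" for y \<alpha>
  proof (cases "\<alpha> \<in> \<Delta>")
    case True
    then have "\<alpha> \<noteq> - theta" using minus_theta_notin by blast
    then show ?thesis using b[OF True] by (simp add: level_def)
  next
    case False
    then have al: "\<alpha> = - theta" using a by (simp add: affine_simple_def)
    have "real q = (real (y (- theta)) + real (s (- theta))) + (\<Sum>\<alpha>\<in>\<Delta>. (fw \<alpha> \<bullet> theta) * (real (y \<alpha>) + real (s \<alpha>)))"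
      using y unfolding Y sum_affine_simple by simp
    also have "(\<Sum>\<alpha>\<in>\<Delta>. (fw \<alpha> \<bullet> theta) * (real (y \<alpha>) + real (s \<alpha>))) = theta \<bullet> b y"
      unfolding inner_expansion[of theta "b y"] by (intro sum.cong) (simp_all add: b)
    finally show ?thesis by (simp add: al level_def)
  qed
  have "bij_betw f (dilated_simplex q D n) ?Y"
  proof (rule bij_betw_byWitness[where f' = b])
    show "\<forall>z\<in>dilated_simplex q D n. b (f z) = z"
    proof (rule ballI, rule eqI_simple)
      fix z \<alpha> assume z: "z \<in> dilated_simplex q D n" and a: "\<alpha> \<in> \<Delta>"
      have "\<alpha> \<in> affine_simple" "\<alpha> \<noteq> - theta" using a minus_theta_notin by (auto simp: affine_simple_def)
      then show "\<alpha> \<bullet> b (f z) = \<alpha> \<bullet> z" using b[OF a] f[OF z] by (simp add: level_def)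
    qed
    show "\<forall>y\<in>?Y. f (b y) = y"
    proof (rule ballI, rule ext)
      fix y \<alpha> assume y: "y \<in> ?Y"
      show "f (b y) \<alpha> = y \<alpha>"
      proof (cases "\<alpha> \<in> affine_simple")
        case True
        have "level q \<alpha> (b y) = of_int (int (y \<alpha>) + int (s \<alpha>))" using lb[OF y True] by simp
        then have "\<lfloor>level q \<alpha> (b y)\<rfloor> = int (y \<alpha>) + int (s \<alpha>)" by (simp only: floor_of_int)
        then show ?thesis using True by (simp add: f_def)
      next
        case False
        then show ?thesis using y by (auto simp: f_def PiE_iff extensional_def)
      qed
    qed
    show "f ` dilated_simplex q D n \<subseteq> ?Y"
    proof (rule image_subsetI)
      fix z assume z: "z \<in> dilated_simplex q D n"
      have "(\<Sum>\<alpha>\<in>affine_simple. real (mark \<alpha>) * (real (f z \<alpha>) + real (s \<alpha>))) = (\<Sum>\<alpha>\<in>affine_simple. real (mark \<alpha>) * level q \<alpha> z)"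
        by (intro sum.cong) (simp_all add: f[OF z])
      then show "f z \<in> ?Y" unfolding Y level_sum by (simp add: f_def)
    qed
    show "b ` ?Y \<subseteq> dilated_simplex q D n"
    proof (rule image_subsetI)
      fix y assume y: "y \<in> ?Y"
      have "b y \<in> P" by (rule coweightI) (simp add: b)
      moreover have "level q \<alpha> (b y) \<ge> (if \<alpha> \<in> D then real n else 0)" if "\<alpha> \<in> affine_simple" for \<alpha>
        unfolding lb[OF y that] by (simp add: s_def)
      ultimately show "b y \<in> dilated_simplex q D n" by (simp add: dilated_simplex_def)
    qed
  qed
  then show ?thesis by blast
qed

lemma card_dilated_simplex:
  assumes "D \<subseteq> affine_simple"
  shows "card (dilated_simplex q D n) = partition_count affine_simple mark (int q - int n * int (sum mark D))"
proof -
  obtain f where "bij_betw f (dilated_simplex q D n)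
    {y \<in> affine_simple \<rightarrow>\<^sub>E (UNIV :: nat set).
      int (\<Sum>\<alpha>\<in>affine_simple. mark \<alpha> * y \<alpha>) = int q - int n * int (sum mark D)}"
    using bij_dilated_simplex[OF assms] by (rule exE)
  then show ?thesis unfolding partition_count_def by (rule bij_betw_same_card)
qed

lemma finite_dilated_simplex:
  assumes "D \<subseteq> affine_simple" shows "finite (dilated_simplex q D n)"
proof -
  obtain f where "bij_betw f (dilated_simplex q D n)
    {y \<in> affine_simple \<rightarrow>\<^sub>E (UNIV :: nat set).
      int (\<Sum>\<alpha>\<in>affine_simple. mark \<alpha> * y \<alpha>) = int q - int n * int (sum mark D)}"
    using bij_dilated_simplex[OF assms] by (rule exE)
  then show ?thesis
    by (rule iffD2[OF bij_betw_finite
        finite_partitions[OF finite_affine_simple affine_simple_nonempty mark_pos]])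
qed

text \<open>For g in \<open>automorphisms\<close>, the walls on which shifting by -g \<rho> excludes
  level 0. Together with \<open>asc\<close> this is a mark-weighted affine analogue of the ascents
  of a permutation.\<close>

definition ascents :: "('a \<Rightarrow> 'a) \<Rightarrow> 'a set" where
  "ascents g = {\<alpha> \<in> affine_simple. \<alpha> \<bullet> g rho > 0}"

definition asc :: "('a \<Rightarrow> 'a) \<Rightarrow> nat" where "asc g = sum mark (ascents g)"

lemma ascents_subset: "ascents g \<subseteq> affine_simple"
  by (auto simp: ascents_def)

lemma rho_root_bound:
  assumes "\<beta> \<in> \<Phi>" shows "\<beta> \<bullet> rho \<noteq> 0" "\<bar>\<beta> \<bullet> rho\<bar> < rho \<bullet> theta + 1"
proof -
  have *: "1 \<le> \<gamma> \<bullet> rho \<and> \<gamma> \<bullet> rho \<le> rho \<bullet> theta" if g: "\<gamma> \<in> \<Phi>\<^sub>p" for \<gamma>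
  proof -
    have "rho \<bullet> \<gamma> \<le> rho \<bullet> theta"
      unfolding rho_inner using theta_highest pos_root[OF g] by (intro sum_mono) auto
    then show ?thesis using rho_pos[OF g] by (simp add: inner_commute)
  qed
  consider "\<beta> \<in> \<Phi>\<^sub>p" | "- \<beta> \<in> \<Phi>\<^sub>p" using pos_or_neg assms by blast
  then show "\<beta> \<bullet> rho \<noteq> 0" "\<bar>\<beta> \<bullet> rho\<bar> < rho \<bullet> theta + 1"
    using *[of \<beta>] *[of "- \<beta>"] by (cases; force)+
qed

lemma rho_image_bound:
  assumes "g \<in> automorphisms" "\<beta> \<in> \<Phi>"
  shows "\<beta> \<bullet> g rho \<noteq> 0" "\<bar>\<beta> \<bullet> g rho\<bar> < rho \<bullet> theta + 1"
  using rho_root_bound[OF automorphism_root[OF automorphism_inv[OF assms(1)] assms(2)]]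
  by (simp_all add: automorphism_inv_inner[OF assms(1)])

text \<open>No root vanishes on g \<rho>, so passing to -g exchanges ascents and non-ascents among
  the affine simple roots.\<close>

lemma asc_uminus:
  assumes "g \<in> automorphisms"
  shows "asc g + asc (\<lambda>x. - g x) = sum mark affine_simple"
proof -
  have "ascents (\<lambda>x. - g x) = affine_simple - ascents g"
    using rho_image_bound(1)[OF assms affine_simple_root] by (force simp: ascents_def)
  then show ?thesis
    unfolding asc_def using sum.subset_diff[OF ascents_subset finite_affine_simple, of mark g]
    by (simp add: add.commute)
qed

section \<open>Perturbed coweights and forbidden residues\<close>

definition avoids :: "nat \<Rightarrow> nat \<Rightarrow> 'a \<Rightarrow> bool" where
  "avoids n q x \<longleftrightarrow> (\<forall>(\<alpha>, k)\<in>root_arrangement \<Phi> \<Delta> 1 (int n). \<forall>m::int. \<alpha> \<bullet> x \<noteq> of_int (k + m * int q))"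

lemma avoids_iff:
  "avoids n q x \<longleftrightarrow> (\<forall>\<alpha>\<in>\<Phi>\<^sub>p. \<forall>k m. 1 \<le> k \<and> k \<le> int n \<longrightarrow> \<alpha> \<bullet> x \<noteq> of_int (k + m * int q))"
  by (auto simp: avoids_def root_arrangement_def)

text \<open>Shifting by a small multiple of \<open>rho\<close> moves every coweight off the hyperplanes.\<close>

definition perturbed :: "nat \<Rightarrow> 'a \<Rightarrow> 'a" where
  "perturbed q x = (1 / real q) *\<^sub>R (x - (1 / (rho \<bullet> theta + 1)) *\<^sub>R rho)"

lemma height_pos: "rho \<bullet> theta + 1 > 0"
  using rho_pos[OF theta_pos] by simp

lemma perturbed_generic:
  assumes "q > 0" "x \<in> P" "\<beta> \<in> \<Phi>"
  shows "\<beta> \<bullet> perturbed q x \<notin> \<int>"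
proof
  assume "\<beta> \<bullet> perturbed q x \<in> \<int>"
  then have "real q * (\<beta> \<bullet> perturbed q x) \<in> \<int>" by (intro Ints_mult) auto
  moreover have "real q * (\<beta> \<bullet> perturbed q x) = \<beta> \<bullet> x - (\<beta> \<bullet> rho) / (rho \<bullet> theta + 1)"
    using assms(1) by (simp add: perturbed_def inner_diff_right)
  ultimately have "\<beta> \<bullet> x - (\<beta> \<bullet> x - (\<beta> \<bullet> rho) / (rho \<bullet> theta + 1)) \<in> \<int>"
    using coweight_root_int[OF assms(2,3)] by (intro Ints_diff) auto
  then have "(\<beta> \<bullet> rho) / (rho \<bullet> theta + 1) \<in> \<int>" by simp
  then obtain j where j: "(\<beta> \<bullet> rho) / (rho \<bullet> theta + 1) = of_int j" by (auto elim: Ints_cases)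
  have "\<bar>(\<beta> \<bullet> rho) / (rho \<bullet> theta + 1)\<bar> < 1"
    using rho_root_bound(2)[OF assms(3)] height_pos by (simp add: abs_divide)
  then have "j = 0" unfolding j by linarith
  then show False using j rho_root_bound(1)[OF assms(3)] height_pos by simp
qed

text \<open>The inequality at a wall compares an integral level with a nonzero number of absolute
  value below 1: it means level at least 1 if that number is positive, that is at an ascent, and at
  least 0 otherwise.\<close>

lemma perturbed_alcove_iff:
  assumes g: "g \<in> automorphisms" and x: "x \<in> P" and q: "q > 0"
  shows "g (perturbed q x) \<in> alcove \<longleftrightarrow> g x \<in> dilated_simplex q (ascents g) 1"
proof -
  let ?h = "rho \<bullet> theta + 1"
  have e: "\<alpha> \<bullet> g (perturbed q x) = (\<alpha> \<bullet> g x - (\<alpha> \<bullet> g rho) / ?h) / real q" for \<alpha>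
    by (simp add: perturbed_def linear_cmul[OF automorphism_linear[OF g]]
        linear_diff[OF automorphism_linear[OF g]] inner_diff_right)
  have simple: "0 < \<alpha> \<bullet> g (perturbed q x) \<longleftrightarrow> (\<alpha> \<bullet> g rho) / ?h < level q \<alpha> (g x)" if "\<alpha> \<in> \<Delta>" for \<alpha>
    using that minus_theta_notin q by (auto simp: e level_def zero_less_divide_iff)
  have top: "theta \<bullet> g (perturbed q x) < 1 \<longleftrightarrow> (- theta \<bullet> g rho) / ?h < level q (- theta) (g x)"
    using q by (simp add: e level_def divide_less_eq) linarith
  have int: "(\<alpha> \<bullet> g rho) / ?h < level q \<alpha> (g x) \<longleftrightarrow> level q \<alpha> (g x) \<ge> (if \<alpha> \<in> ascents g then real 1 else 0)"
    if a: "\<alpha> \<in> affine_simple" for \<alpha>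
  proof -
    obtain j where j: "level q \<alpha> (g x) = of_int j"
      using level_int[OF automorphism_coweight[OF g x] a] by (auto elim: Ints_cases)
    have ab: "\<bar>(\<alpha> \<bullet> g rho) / ?h\<bar> < 1"
      using rho_image_bound(2)[OF g affine_simple_root[OF a]] height_pos by (simp add: abs_divide)
    show ?thesis
    proof (cases "\<alpha> \<in> ascents g")
      case True
      then have "(\<alpha> \<bullet> g rho) / ?h > 0" using height_pos by (simp add: ascents_def)
      then show ?thesis using True ab unfolding j by (simp add: abs_if) linarith
    next
      case False
      then have "\<alpha> \<bullet> g rho < 0"
        using a rho_image_bound(1)[OF g affine_simple_root[OF a]] by (auto simp: ascents_def)
      then have "(\<alpha> \<bullet> g rho) / ?h < 0" using height_pos by (simp add: divide_neg_pos)
      then show ?thesis using False ab unfolding j by (simp add: abs_if) linarith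
    qed
  qed
  have "g (perturbed q x) \<in> alcove \<longleftrightarrow> (\<forall>\<alpha>\<in>affine_simple. (\<alpha> \<bullet> g rho) / ?h < level q \<alpha> (g x))"
    unfolding alcove_def affine_simple_def by (auto simp: simple top)
  also have "\<dots> \<longleftrightarrow> g x \<in> dilated_simplex q (ascents g) 1"
    unfolding dilated_simplex_def using automorphism_coweight[OF g x] int by auto
  finally show ?thesis .
qed

text \<open>At an ascent the pulled-back root is positive, because \<rho> is positive on it, so its
  value must avoid 1..n modulo q. The level agrees with that value modulo q and is at least 1, hence
  at least n + 1.\<close>

lemma avoids_dilated_simplex:
  assumes g: "g \<in> automorphisms" and x: "x \<in> P" and q: "q > n"
    and z: "g x \<in> dilated_simplex q (ascents g) 1" and av: "avoids n q x"
  shows "g x \<in> dilated_simplex q (ascents g) (Suc n)"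
proof -
  have "level q \<alpha> (g x) \<ge> real (Suc n)" if a: "\<alpha> \<in> ascents g" for \<alpha>
  proof -
    have aff: "\<alpha> \<in> affine_simple" using a ascents_subset by blast
    obtain j where j: "level q \<alpha> (g x) = of_int j"
      using level_int[OF automorphism_coweight[OF g x] aff] by (auto elim: Ints_cases)
    have "level q \<alpha> (g x) \<ge> 1" using z a aff by (auto simp: dilated_simplex_def)
    then have "j \<ge> 1" unfolding j by simp
    define \<gamma> where "\<gamma> = inv g \<alpha>"
    have r: "\<gamma> \<in> \<Phi>" unfolding \<gamma>_def
      using automorphism_root[OF automorphism_inv[OF g] affine_simple_root[OF aff]] .
    have "\<gamma> \<bullet> rho > 0" using a by (simp add: \<gamma>_def ascents_def automorphism_inv_inner[OF g])
    then have "\<gamma> \<in> \<Phi>\<^sub>p" using r rho_pos[of "- \<gamma>"] neg_pos_iff[OF r] by (force simp: inner_commute)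
    then have ne: "\<gamma> \<bullet> x \<noteq> of_int (k + m * int q)" if "1 \<le> k" "k \<le> int n" for k m
      using av that unfolding avoids_iff by blast
    have e: "\<gamma> \<bullet> x = \<alpha> \<bullet> g x" by (simp add: \<gamma>_def automorphism_inv_inner[OF g])
    have "\<gamma> \<bullet> x = of_int (j + (if \<alpha> = - theta then -1 else 0) * int q)"
      using j by (auto simp: e level_def)
    then have "\<not> (1 \<le> j \<and> j \<le> int n)" using ne by blast
    then have "j \<ge> int (Suc n)" using \<open>j \<ge> 1\<close> by simp
    then show ?thesis unfolding j by linarith
  qed
  then show ?thesis using z by (auto simp: dilated_simplex_def)
qed

text \<open>The walls control all positive roots: with w = g x and \<gamma> = g \<beta>, the value
  of \<gamma> on w is congruent to a number in n + 1..q. If \<gamma> is positive, an ascent in its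
  support gives the lower bound and \<theta> the upper one. If \<gamma> = -\<delta> is negative, the
  same argument applies to q - \<delta>, written as (q - \<theta>) + (\<theta> - \<delta>).\<close>

lemma dilated_simplex_avoids:
  assumes g: "g \<in> automorphisms" and x: "x \<in> P" and q: "q > n"
    and z: "g x \<in> dilated_simplex q (ascents g) (Suc n)"
  shows "avoids n q x"
  unfolding avoids_iff
proof (intro ballI allI impI, elim conjE)
  fix \<beta> k m assume b: "\<beta> \<in> \<Phi>\<^sub>p" and k: "1 \<le> k" "k \<le> int n"
  define w where "w = g x"
  define s where "s = g rho"
  have lev: "level q \<alpha> w \<ge> (if \<alpha> \<in> ascents g then real (Suc n) else 0)" if "\<alpha> \<in> affine_simple" for \<alpha>
    using z that by (auto simp: dilated_simplex_def w_def)
  have wn: "\<alpha> \<bullet> w \<ge> 0" "\<alpha> \<bullet> s > 0 \<Longrightarrow> \<alpha> \<bullet> w \<ge> real (Suc n)" if a: "\<alpha> \<in> \<Delta>" for \<alpha>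
  proof -
    have "\<alpha> \<in> affine_simple" "\<alpha> \<noteq> - theta" using a minus_theta_notin by (auto simp: affine_simple_def)
    then show "\<alpha> \<bullet> w \<ge> 0" "\<alpha> \<bullet> s > 0 \<Longrightarrow> \<alpha> \<bullet> w \<ge> real (Suc n)"
      using lev[of \<alpha>] by (auto simp: level_def ascents_def s_def split: if_splits)
  qed
  have th: "theta \<bullet> w \<le> real q" "theta \<bullet> s < 0 \<Longrightarrow> theta \<bullet> w \<le> real q - real (Suc n)"
    using lev[of "- theta"] by (auto simp: affine_simple_def level_def ascents_def s_def split: if_splits)
  have gr: "g \<beta> \<in> \<Phi>" using automorphism_root[OF g] b pos_root by blast
  have e: "\<beta> \<bullet> x = g \<beta> \<bullet> w" "g \<beta> \<bullet> s = \<beta> \<bullet> rho"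
    by (simp_all add: w_def s_def automorphism_inner[OF g])
  have spos: "g \<beta> \<bullet> s > 0" using rho_pos[OF b] unfolding e(2) inner_commute[of \<beta> rho] by linarith
  have fw1: "v \<ge> 1" if "v > 0" "v \<in> \<int>" for v :: real using that by (auto elim!: Ints_cases)
  have term_ge: "c * t \<ge> real (Suc n)" if "c \<ge> 1" "t \<ge> real (Suc n)" for c t :: real
    using mult_mono[of 1 c "real (Suc n)" t] that by simp
  consider "g \<beta> \<in> \<Phi>\<^sub>p" | "- g \<beta> \<in> \<Phi>\<^sub>p" using pos_or_neg gr by blast
  then show "\<beta> \<bullet> x \<noteq> of_int (k + m * int q)"
  proof cases
    case 1
    obtain \<alpha> where a: "\<alpha> \<in> \<Delta>" "fw \<alpha> \<bullet> g \<beta> > 0" "\<alpha> \<bullet> s > 0"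
      using sum_pos_product_ex[OF spos[unfolded inner_expansion[of "g \<beta>" s]] pos_fw[OF 1]] by blast
    have "real (Suc n) \<le> (fw \<alpha> \<bullet> g \<beta>) * (\<alpha> \<bullet> w)"
      using a fw1[OF a(2) fw_int[OF gr a(1)]] wn(2)[OF a(1,3)] by (intro term_ge)
    also have "\<dots> \<le> (\<Sum>\<alpha>\<in>\<Delta>. (fw \<alpha> \<bullet> g \<beta>) * (\<alpha> \<bullet> w))"
      using a(1) pos_fw[OF 1] wn(1) by (intro member_le_sum) auto
    also have "\<dots> = g \<beta> \<bullet> w" by (simp add: inner_expansion[of "g \<beta>" w])
    finally have lo: "real (Suc n) \<le> g \<beta> \<bullet> w" .
    have "g \<beta> \<bullet> w \<le> theta \<bullet> w"
      unfolding inner_expansion[of "g \<beta>" w] inner_expansion[of theta w]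
      using theta_highest[OF gr] wn(1) by (intro sum_mono mult_right_mono) auto
    with th have hi: "g \<beta> \<bullet> w \<le> real q" by linarith
    show ?thesis
    proof
      assume "\<beta> \<bullet> x = of_int (k + m * int q)"
      with lo hi have "real_of_int (int (Suc n)) \<le> of_int (k + m * int q)" "real_of_int (k + m * int q) \<le> of_int (int q)"
        by (simp_all add: e)
      then have *: "int (Suc n) \<le> k + m * int q" "k + m * int q \<le> int q" by (simp_all only: of_int_le_iff)
      consider "m \<le> 0" | "m \<ge> 1" by linarith
      then show False
      proof cases
        case 1
        then have "m * int q \<le> 0" by (simp add: mult_nonpos_nonneg)
        then show False using * k by linarith
      next
        case 2
        then have "1 * int q \<le> m * int q" by (intro mult_right_mono) auto
        then show False using * k by linarith
      qed
    qed
  next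
    case 2
    define \<delta> where "\<delta> = - g \<beta>"
    have d: "\<delta> \<in> \<Phi>\<^sub>p" "\<delta> \<in> \<Phi>" using 2 gr by (simp_all add: \<delta>_def)
    have dexp: "theta \<bullet> u - \<delta> \<bullet> u = (\<Sum>\<alpha>\<in>\<Delta>. (fw \<alpha> \<bullet> theta - fw \<alpha> \<bullet> \<delta>) * (\<alpha> \<bullet> u))" for u
      by (simp add: inner_expansion[of theta u] inner_expansion[of \<delta> u] sum_subtractf left_diff_distrib)
    have c0: "fw \<alpha> \<bullet> theta - fw \<alpha> \<bullet> \<delta> \<ge> 0" if "\<alpha> \<in> \<Delta>" for \<alpha> using theta_highest[OF d(2) that] by simp
    have nonneg: "(fw \<alpha> \<bullet> theta - fw \<alpha> \<bullet> \<delta>) * (\<alpha> \<bullet> w) \<ge> 0" if "\<alpha> \<in> \<Delta>" for \<alpha>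
      using c0[OF that] wn(1)[OF that] by simp
    have sneg: "\<delta> \<bullet> s < 0" using spos by (simp add: \<delta>_def)
    have hi: "\<delta> \<bullet> w \<le> real q - real (Suc n)"
    \<comment> \<open>Here \<delta> is negative on s. Either -\<theta> is an ascent, or \<theta> -
      \<delta> is positive on s and one of the simple roots in it is an ascent.\<close>
    proof (cases "theta \<bullet> s < 0")
      case True
      have "theta \<bullet> w - \<delta> \<bullet> w \<ge> 0" unfolding dexp using nonneg by (rule sum_nonneg)
      then show ?thesis using th(2)[OF True] by linarith
    next
      case False
      then have "(\<Sum>\<alpha>\<in>\<Delta>. (fw \<alpha> \<bullet> theta - fw \<alpha> \<bullet> \<delta>) * (\<alpha> \<bullet> s)) > 0"
        using sneg dexp[of s] by linarith
      from sum_pos_product_ex[OF this c0]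
      obtain \<alpha> where a: "\<alpha> \<in> \<Delta>" "fw \<alpha> \<bullet> theta - fw \<alpha> \<bullet> \<delta> > 0" "\<alpha> \<bullet> s > 0"
        by blast
      have "real (Suc n) \<le> (fw \<alpha> \<bullet> theta - fw \<alpha> \<bullet> \<delta>) * (\<alpha> \<bullet> w)"
        using a wn(2)[OF a(1,3)] fw_int[OF theta_root a(1)] fw_int[OF d(2) a(1)]
        by (intro term_ge fw1 Ints_diff)
      also have "\<dots> \<le> theta \<bullet> w - \<delta> \<bullet> w"
        unfolding dexp using a(1) nonneg by (intro member_le_sum) auto
      finally show ?thesis using th(1) by linarith
    qed
    have lo: "\<delta> \<bullet> w \<ge> 0"
      unfolding inner_expansion[of \<delta> w] using pos_fw[OF d(1)] wn(1) by (intro sum_nonneg) auto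
    show ?thesis
    proof
      assume "\<beta> \<bullet> x = of_int (k + m * int q)"
      then have "\<delta> \<bullet> w = - of_int (k + m * int q)" by (simp add: e \<delta>_def)
      with lo hi have "real_of_int (int (Suc n) - int q) \<le> of_int (k + m * int q)" "real_of_int (k + m * int q) \<le> of_int 0"
        by simp_all
      then have *: "int (Suc n) - int q \<le> k + m * int q" "k + m * int q \<le> 0" by (simp_all only: of_int_le_iff)
      consider "m \<le> -1" | "m \<ge> 0" by linarith
      then show False
      proof cases
        case 1
        then have "m * int q \<le> (-1) * int q" by (intro mult_right_mono) auto
        then show False using * k by linarith
      next
        case 2
        then have "m * int q \<ge> 0" by simp
        then show False using * k by linarith
      qed
    qed
  qed
qed

text \<open>The perturbation costs 1 and the avoided residues cost n more at each ascent; this is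
  the origin of n + 1.\<close>

lemma card_avoiding_alcove:
  assumes g: "g \<in> automorphisms" and q: "q > n"
  shows "card {x \<in> P. avoids n q x \<and> g (perturbed q x) \<in> alcove}
       = partition_count affine_simple mark (int q - int (Suc n) * int (asc g))"
proof -
  have "g ` {x \<in> P. avoids n q x \<and> g (perturbed q x) \<in> alcove} = dilated_simplex q (ascents g) (Suc n)"
  proof (intro equalityI subsetI)
    fix z assume "z \<in> g ` {x \<in> P. avoids n q x \<and> g (perturbed q x) \<in> alcove}"
    then show "z \<in> dilated_simplex q (ascents g) (Suc n)"
      using perturbed_alcove_iff[OF g] avoids_dilated_simplex[OF g _ q] q by auto
  next
    fix z assume z: "z \<in> dilated_simplex q (ascents g) (Suc n)"
    define x where "x = inv g z"
    have gx: "g x = z" by (simp add: x_def automorphism_inv_cancel[OF g])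
    have x: "x \<in> P" unfolding x_def
      by (rule automorphism_coweight[OF automorphism_inv[OF g]]) (use z in \<open>simp add: dilated_simplex_def\<close>)
    have "z \<in> dilated_simplex q (ascents g) 1"
      using z by (force simp: dilated_simplex_def)
    then have "g (perturbed q x) \<in> alcove" using perturbed_alcove_iff[OF g x] q gx by simp
    moreover have "avoids n q x" using dilated_simplex_avoids[OF g x q] z gx by simp
    ultimately show "z \<in> g ` {x \<in> P. avoids n q x \<and> g (perturbed q x) \<in> alcove}"
      using x gx by blast
  qed
  moreover have "inj_on g {x \<in> P. avoids n q x \<and> g (perturbed q x) \<in> alcove}"
    using automorphism_bij[OF g] by (meson bij_is_inj inj_on_subset subset_UNIV)
  ultimately have "card {x \<in> P. avoids n q x \<and> g (perturbed q x) \<in> alcove} = card (dilated_simplex q (ascents g) (Suc n))"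
    using card_image[of g "{x \<in> P. avoids n q x \<and> g (perturbed q x) \<in> alcove}"] by presburger
  then show ?thesis by (simp only: card_dilated_simplex[OF ascents_subset] asc_def)
qed

lemma finite_avoiding_alcove:
  assumes g: "g \<in> automorphisms" and q: "q > 0"
  shows "finite {x \<in> P. avoids n q x \<and> g (perturbed q x) \<in> alcove}"
proof (rule finite_imageD)
  show "finite (g ` {x \<in> P. avoids n q x \<and> g (perturbed q x) \<in> alcove})"
    by (rule finite_subset[OF _ finite_dilated_simplex[OF ascents_subset]])
      (use perturbed_alcove_iff[OF g _ q] in auto)
  show "inj_on g {x \<in> P. avoids n q x \<and> g (perturbed q x) \<in> alcove}"
    using automorphism_bij[OF g] by (meson bij_is_inj inj_on_subset subset_UNIV)
qed

section \<open>Residue classes and the double count\<close>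

definition coweight_cong :: "nat \<Rightarrow> ('a \<times> 'a) set" where
  "coweight_cong q = {(x, y). x \<in> P \<and> y \<in> P \<and> (\<exists>z\<in>P. x - y = real q *\<^sub>R z)}"

lemma equiv_coweight_cong: "equiv P (coweight_cong q)"
proof (rule equivI)
  show "coweight_cong q \<subseteq> P \<times> P" by (auto simp: coweight_cong_def)
  show "refl_on P (coweight_cong q)"
    by (auto simp: refl_on_def coweight_cong_def intro!: bexI[of _ 0] coweight_zero)
  show "sym (coweight_cong q)"
  proof (rule symI)
    fix x y assume "(x, y) \<in> coweight_cong q"
    then obtain z where "x \<in> P" "y \<in> P" "z \<in> P" "x - y = real q *\<^sub>R z" by (auto simp: coweight_cong_def)
    then show "(y, x) \<in> coweight_cong q"
      using coweight_minus[of z] by (auto simp: coweight_cong_def intro!: bexI[of _ "- z"]) (metis minus_diff_eq)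
  qed
  show "trans (coweight_cong q)"
  proof (rule transI)
    fix x y w assume "(x, y) \<in> coweight_cong q" "(y, w) \<in> coweight_cong q"
    then obtain z z' where z: "x \<in> P" "w \<in> P" "z \<in> P" "z' \<in> P" "x - y = real q *\<^sub>R z" "y - w = real q *\<^sub>R z'"
      by (auto simp: coweight_cong_def)
    have "x - w = (x - y) + (y - w)" by simp
    also have "\<dots> = real q *\<^sub>R (z + z')" by (simp only: z scaleR_add_right)
    finally show "(x, w) \<in> coweight_cong q" using z coweight_add[of z z'] by (auto simp: coweight_cong_def)
  qed
qed

lemma avoids_cong:
  assumes "(x, y) \<in> coweight_cong q" "avoids n q x" shows "avoids n q y"
  unfolding avoids_iff
proof (intro ballI allI impI notI)
  fix \<alpha> k m assume a: "\<alpha> \<in> \<Phi>\<^sub>p" and k: "1 \<le> k \<and> k \<le> int n" and e: "\<alpha> \<bullet> y = of_int (k + m * int q)"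
  obtain z where z: "z \<in> P" "x - y = real q *\<^sub>R z" using assms by (auto simp: coweight_cong_def)
  obtain j where j: "\<alpha> \<bullet> z = of_int j" using coweight_root_int[OF z(1) pos_root[OF a]] by (auto elim: Ints_cases)
  have "\<alpha> \<bullet> x = \<alpha> \<bullet> y + real q * (\<alpha> \<bullet> z)"
    using arg_cong[OF z(2), of "(\<bullet>) \<alpha>"] by (simp add: inner_diff_right)
  then have "\<alpha> \<bullet> x = of_int (k + (m + j) * int q)" by (simp add: e j algebra_simps)
  then show False using assms(2) a k unfolding avoids_iff by blast
qed

text \<open>Moving the representative by q p moves the perturbed and rescaled point by p. So the
  pairs for one class are the alcove positions of a single generic point, and their number is the
  same for every class.\<close>

lemma card_class_positions:
  assumes q: "q > 0" and X: "X \<in> P // coweight_cong q"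
  shows "card {(g, x). g \<in> automorphisms \<and> x \<in> X \<and> g (perturbed q x) \<in> alcove} = card alcove_stabilizer"
proof -
  obtain x0 where x0: "x0 \<in> P" "X = coweight_cong q `` {x0}" using X by (auto elim: quotientE)
  have X_iff: "x \<in> X \<longleftrightarrow> (\<exists>p\<in>P. x = x0 + real q *\<^sub>R p)" for x
  proof
    assume "x \<in> X"
    then obtain z where "z \<in> P" "x0 - x = real q *\<^sub>R z" by (auto simp: x0 coweight_cong_def)
    then show "\<exists>p\<in>P. x = x0 + real q *\<^sub>R p"
      using coweight_minus[of z] by (intro bexI[of _ "- z"]) (auto simp: algebra_simps)
  next
    assume "\<exists>p\<in>P. x = x0 + real q *\<^sub>R p"
    then obtain p where p: "p \<in> P" "x = x0 + real q *\<^sub>R p" by blast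
    have "x \<in> P" using p x0 by (simp add: coweight_add coweight_scale)
    then show "x \<in> X"
      using p x0 coweight_minus[of p] by (auto simp: coweight_cong_def intro!: bexI[of _ "- p"])
  qed
  have pert: "perturbed q (x0 + real q *\<^sub>R p) = perturbed q x0 + p" for p
    using q by (simp add: perturbed_def algebra_simps)
  have "bij_betw (\<lambda>(g, p). (g, x0 + real q *\<^sub>R p)) (alcove_positions (perturbed q x0))
      {(g, x). g \<in> automorphisms \<and> x \<in> X \<and> g (perturbed q x) \<in> alcove}"
  proof (rule bij_betw_imageI)
    show "inj_on (\<lambda>(g, p). (g, x0 + real q *\<^sub>R p)) (alcove_positions (perturbed q x0))"
      using q by (auto simp: inj_on_def)
    show "(\<lambda>(g, p). (g, x0 + real q *\<^sub>R p)) ` alcove_positions (perturbed q x0)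
        = {(g, x). g \<in> automorphisms \<and> x \<in> X \<and> g (perturbed q x) \<in> alcove}"
      by (auto simp: X_iff alcove_positions_def pert image_iff)
  qed
  moreover have "card (alcove_positions (perturbed q x0)) = card alcove_stabilizer"
    by (intro card_alcove_positions alcove_positions_nonempty perturbed_generic q x0)
  ultimately show ?thesis by (simp add: bij_betw_same_card)
qed

text \<open>Double count of the pairs (g, x) for which x avoids the residues and g brings the
  perturbed x into the alcove. Sorted by the class of x they give the left side, sorted by g the
  right side.\<close>

theorem complement_count_alcoves:
  assumes q: "q > n"
  shows "card alcove_stabilizer * complement_count \<Delta> (root_arrangement \<Phi> \<Delta> 1 (int n)) q
       = (\<Sum>g\<in>automorphisms. partition_count affine_simple mark (int q - int (Suc n) * int (asc g)))"
proof -
  have q0: "q > 0" using q by simp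
  define T where "T = (SIGMA g:automorphisms. {x \<in> P. avoids n q x \<and> g (perturbed q x) \<in> alcove})"
  define cls where "cls t = coweight_cong q `` {snd t}" for t :: "('a \<Rightarrow> 'a) \<times> 'a"
  define G where "G = {X \<in> P // coweight_cong q. \<forall>x\<in>X. avoids n q x}"
  have finT: "finite T"
    unfolding T_def using finite_avoiding_alcove[OF _ q0] by (intro finite_SigmaI finite_automorphisms)
  have fibre: "{t \<in> T. cls t = X} = {(g, x). g \<in> automorphisms \<and> x \<in> X \<and> g (perturbed q x) \<in> alcove}"
    if X: "X \<in> G" for X
  proof -
    have XP: "X \<in> P // coweight_cong q" using X by (simp add: G_def)
    then obtain x0 where x0: "X = coweight_cong q `` {x0}" by (rule quotientE)
    have cl: "x \<in> P" "coweight_cong q `` {x} = X" if "x \<in> X" for x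
    proof -
      have x: "(x0, x) \<in> coweight_cong q" using that x0 by simp
      then show "x \<in> P" by (simp add: coweight_cong_def)
      show "coweight_cong q `` {x} = X"
        unfolding x0 by (rule equiv_class_eq[OF equiv_coweight_cong x, symmetric])
    qed
    show ?thesis
    proof (intro equalityI subsetI)
      fix t assume "t \<in> {t \<in> T. cls t = X}"
      then obtain g x where t: "t = (g, x)" "g \<in> automorphisms" "x \<in> P" "g (perturbed q x) \<in> alcove"
        "coweight_cong q `` {x} = X" by (auto simp: T_def cls_def)
      have "x \<in> coweight_cong q `` {x}" using t(3) by (rule equiv_class_self[OF equiv_coweight_cong])
      then have "x \<in> X" by (simp only: t(5))
      with t(2,4) show "t \<in> {(g, x). g \<in> automorphisms \<and> x \<in> X \<and> g (perturbed q x) \<in> alcove}"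
        unfolding t(1) by blast
    next
      fix t assume "t \<in> {(g, x). g \<in> automorphisms \<and> x \<in> X \<and> g (perturbed q x) \<in> alcove}"
      then obtain g x where t: "t = (g, x)" "g \<in> automorphisms" "x \<in> X" "g (perturbed q x) \<in> alcove"
        by blast
      have "avoids n q x" using X t(3) by (simp add: G_def)
      then show "t \<in> {t \<in> T. cls t = X}" using t cl[OF t(3)] by (simp add: T_def cls_def)
    qed
  qed
  have fibre_card: "card {t \<in> T. cls t = X} = card alcove_stabilizer" if "X \<in> G" for X
    unfolding fibre[OF that] using that by (intro card_class_positions q0) (simp add: G_def)
  have "cls ` T = G"
  proof (intro equalityI subsetI)
    fix X assume "X \<in> cls ` T"
    then obtain g x where "x \<in> P" "avoids n q x" "X = coweight_cong q `` {x}"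
      by (auto simp: T_def cls_def)
    then show "X \<in> G" by (auto simp: G_def quotientI intro: avoids_cong)
  next
    fix X assume X: "X \<in> G"
    then have "{t \<in> T. cls t = X} \<noteq> {}"
      using fibre_card[OF X] card_alcove_stabilizer_pos by (metis card.empty less_irrefl)
    then show "X \<in> cls ` T" by blast
  qed
  then have "card T = (\<Sum>X\<in>G. card {t \<in> T. cls t = X})"
    using sum.group[OF finT finite_imageI[OF finT, of cls] subset_refl, of "\<lambda>_. 1::nat"] by (simp only: card_eq_sum)
  also have "\<dots> = card G * card alcove_stabilizer" by (simp add: fibre_card)
  finally have "card T = card G * card alcove_stabilizer" .
  moreover have "card T = (\<Sum>g\<in>automorphisms. card {x \<in> P. avoids n q x \<and> g (perturbed q x) \<in> alcove})"
    unfolding T_def using finite_avoiding_alcove[OF _ q0] by (intro card_SigmaI finite_automorphisms) blast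
  moreover have "\<dots> = (\<Sum>g\<in>automorphisms. partition_count affine_simple mark (int q - int (Suc n) * int (asc g)))"
    by (intro sum.cong refl card_avoiding_alcove q)
  moreover have "G = {X \<in> coweight_lattice_mod \<Delta> q. \<forall>x\<in>X. \<forall>(\<alpha>, k)\<in>root_arrangement \<Phi> \<Delta> 1 (int n).
      \<forall>m::int. \<alpha> \<bullet> x \<noteq> of_int (k + m * int q)}"
    by (simp add: G_def coweight_lattice_mod_def coweight_cong_def avoids_def)
  ultimately show ?thesis by (simp add: complement_count_def mult.commute)
qed

section \<open>The characteristic quasi-polynomial and its symmetry\<close>

definition alcove_quasi :: "nat \<Rightarrow> int \<Rightarrow> real" where
  "alcove_quasi n t = (1 / real (card alcove_stabilizer)) *
     (\<Sum>g\<in>automorphisms. partition_quasi affine_simple mark (t - int (Suc n) * int (asc g)))"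

lemma prod_mark_pos: "prod mark affine_simple > 0"
  by (rule prod_pos) (rule mark_pos)

lemma periodic_alcove_quasi: "periodic_poly (prod mark affine_simple) (alcove_quasi n)"
  unfolding alcove_quasi_def
  by (rule periodic_poly_scale, rule periodic_poly_sum,
      rule periodic_poly_shift[of _ "partition_quasi affine_simple mark"],
      rule periodic_poly_partition_quasi[OF finite_affine_simple mark_pos])

lemma alcove_quasi_count:
  "\<forall>\<^sub>F q in sequentially.
     alcove_quasi n (int q) = real (complement_count \<Delta> (root_arrangement \<Phi> \<Delta> 1 (int n)) q)"
proof -
  \<comment> \<open>The first two summands put every shifted argument into the range of
    \<open>partition_count_quasi\<close>, as \<open>asc g\<close> is at most the sum of all marks;
    the last gives q > n.\<close>
  define B where "B = Suc n * sum mark affine_simple + card affine_simple * prod mark affine_simple + Suc n"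
  have "alcove_quasi n (int q) = real (complement_count \<Delta> (root_arrangement \<Phi> \<Delta> 1 (int n)) q)"
    if q: "q \<ge> B" for q
  proof -
    have "partition_quasi affine_simple mark (int q - int (Suc n) * int (asc g))
        = real (partition_count affine_simple mark (int q - int (Suc n) * int (asc g)))" for g
    proof (rule partition_count_quasi[symmetric, OF finite_affine_simple affine_simple_nonempty mark_pos])
      have "asc g \<le> sum mark affine_simple"
        unfolding asc_def using ascents_subset by (intro sum_mono2) auto
      then have "Suc n * asc g \<le> Suc n * sum mark affine_simple" by (rule mult_le_mono2)
      then have "card affine_simple * prod mark affine_simple + Suc n * asc g \<le> q"
        using q unfolding B_def by linarith
      then have "int (card affine_simple * prod mark affine_simple + Suc n * asc g) \<le> int q"
        by (simp only: of_nat_le_iff)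
      then show "int (card affine_simple * prod mark affine_simple) \<le> int q - int (Suc n) * int (asc g)"
        by (simp only: of_nat_add of_nat_mult le_diff_eq)
    qed
    then have "alcove_quasi n (int q) = (1 / real (card alcove_stabilizer)) *
        real (\<Sum>g\<in>automorphisms. partition_count affine_simple mark (int q - int (Suc n) * int (asc g)))"
      by (simp only: alcove_quasi_def of_nat_sum)
    also have "\<dots> = (1 / real (card alcove_stabilizer)) *
        real (card alcove_stabilizer * complement_count \<Delta> (root_arrangement \<Phi> \<Delta> 1 (int n)) q)"
    proof -
      have "q > n" using q by (simp add: B_def)
      then show ?thesis by (simp only: complement_count_alcoves)
    qed
    finally show ?thesis using card_alcove_stabilizer_pos by simp
  qed
  then show ?thesis unfolding eventually_sequentially by blast
qed

lemma alcove_quasi_int: "alcove_quasi n t \<in> \<int>"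
proof (rule periodic_poly_int[OF periodic_alcove_quasi prod_mark_pos])
  show "\<forall>\<^sub>F q in sequentially. alcove_quasi n (int q) \<in> \<int>"
    using alcove_quasi_count[of n] by (rule eventually_mono) (simp only: Ints_of_nat)
qed

text \<open>The definite description ranges over integer-valued functions, so the real-valued
  candidate is first rounded, which changes nothing by \<open>alcove_quasi_int\<close>. Agreement of
  quasi-polynomials at large arguments then gives uniqueness.\<close>

lemma char_quasi_alcove:
  "of_int (char_quasi \<Delta> (root_arrangement \<Phi> \<Delta> 1 (int n)) t) = alcove_quasi n t"
proof -
  let ?A = "root_arrangement \<Phi> \<Delta> 1 (int n)"
  define f where "f t = \<lfloor>alcove_quasi n t\<rfloor>" for t
  have f: "of_int (f t) = alcove_quasi n t" for t
    using alcove_quasi_int[of n t] by (simp add: f_def)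
  have "char_quasi \<Delta> ?A = f"
    unfolding char_quasi_def
  proof (rule the_equality, intro conjI)
    show "quasi_polynomial f"
      unfolding quasi_polynomial_iff f using periodic_alcove_quasi prod_mark_pos by blast
    show "\<forall>\<^sub>F q in sequentially. f (int q) = int (complement_count \<Delta> ?A q)"
      using alcove_quasi_count[of n] by (rule eventually_mono) (simp add: f_def)
  next
    fix g assume g: "quasi_polynomial g \<and> (\<forall>\<^sub>F q in sequentially. g (int q) = int (complement_count \<Delta> ?A q))"
    then obtain \<rho> where r: "\<rho> > 0" "periodic_poly \<rho> (\<lambda>t. of_int (g t))"
      unfolding quasi_polynomial_iff by blast
    have "(\<lambda>t. of_int (g t)) = alcove_quasi n"
    proof (rule periodic_poly_unique[OF r(2,1) periodic_alcove_quasi prod_mark_pos])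
      show "\<forall>\<^sub>F q in sequentially. of_int (g (int q)) = alcove_quasi n (int q)"
        using conjunct2[OF g] alcove_quasi_count[of n] by eventually_elim simp
    qed
    then have "of_int (g t) = (of_int (f t) :: real)" for t unfolding f by (rule fun_cong)
    then show "g = f" by (simp add: fun_eq_iff)
  qed
  then show ?thesis by (simp add: f)
qed

lemma alcove_quasi_reciprocity:
  "alcove_quasi n (int n * int (sum mark affine_simple) - t) = (-1) ^ DIM('a) * alcove_quasi n t"
proof -
  let ?h = "sum mark affine_simple"
  let ?L = "partition_quasi affine_simple mark"
  have neg: "(\<lambda>x. - g x) \<in> automorphisms" if "g \<in> automorphisms" for g
    using that by (rule automorphism_uminus)
  have "(\<Sum>g\<in>automorphisms. ?L (int n * int ?h - t - int (Suc n) * int (asc g)))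
      = (\<Sum>g\<in>automorphisms. ?L (int n * int ?h - t - int (Suc n) * int (asc (\<lambda>x. - g x))))"
    by (rule sum.reindex_bij_witness[of _ "\<lambda>g x. - g x" "\<lambda>g x. - g x"]) (auto simp: neg)
  also have "\<dots> = (\<Sum>g\<in>automorphisms. (-1) ^ DIM('a) * ?L (t - int (Suc n) * int (asc g)))"
  proof (rule sum.cong[OF refl])
    fix g assume g: "g \<in> automorphisms"
    have "int (asc (\<lambda>x. - g x)) = int ?h - int (asc g)"
      using asc_uminus[OF g] by linarith
    \<comment> \<open>The n h in the argument is exactly what the pairing of g with -g needs: of the
      (n + 1) h produced by the complementary ascents, one h remains, the shift required by
      \<open>partition_quasi_reciprocity\<close>.\<close>
    then have "int n * int ?h - t - int (Suc n) * int (asc (\<lambda>x. - g x))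
        = - (t - int (Suc n) * int (asc g)) - int ?h"
      by (simp only: of_nat_Suc) (simp add: algebra_simps)
    then show "?L (int n * int ?h - t - int (Suc n) * int (asc (\<lambda>x. - g x)))
        = (-1) ^ DIM('a) * ?L (t - int (Suc n) * int (asc g))"
      using partition_quasi_reciprocity[OF finite_affine_simple affine_simple_nonempty mark_pos,
          where u = "t - int (Suc n) * int (asc g)"]
      by (simp only: card_affine_simple diff_Suc_1)
  qed
  finally show ?thesis
    by (simp only: alcove_quasi_def sum_distrib_left[symmetric] mult.left_commute)
qed

end

theorem theorem5p6:
  fixes \<Phi> \<Delta> :: "'a::euclidean_space set" and h n :: nat and t :: int
  assumes "irreducible_root_system \<Phi>"
    and "simple_roots \<Phi> \<Delta>"
    and "coxeter_number \<Delta> h"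
    and "n \<ge> 1"
  shows "char_quasi \<Delta> (root_arrangement \<Phi> \<Delta> 1 (int n)) (int n * int h - t) =
         (-1) ^ DIM('a) * char_quasi \<Delta> (root_arrangement \<Phi> \<Delta> 1 (int n)) t"
proof -
  interpret based_root_system \<Phi> \<Delta> by standard (fact assms)+
  have "real h = real (sum mark affine_simple)"
    using coxeter_number_height[OF assms(3)] sum_mark by simp
  then have h: "h = sum mark affine_simple" by (simp only: of_nat_eq_iff)
  have "real_of_int (char_quasi \<Delta> (root_arrangement \<Phi> \<Delta> 1 (int n)) (int n * int h - t)) =
      real_of_int ((-1) ^ DIM('a) * char_quasi \<Delta> (root_arrangement \<Phi> \<Delta> 1 (int n)) t)"
    unfolding of_int_mult of_int_power of_int_minus of_int_1 char_quasi_alcove h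
    by (rule alcove_quasi_reciprocity)
  then show ?thesis by (simp only: of_int_eq_iff)
qed

end
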